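(* Let $u(x,t)$ be the solution of the Cauchy problem $$u_{txx}-3u_x+3u_xu_{xx}+uu_{xxx}=0,\quad x\in\mathbb R,\ t>0,\qquad u(x,0)=u_0(x),\ x\in\mathbb R,$$ where $u_0$ is smooth, decays sufficiently fast as $|x|\to\infty$, and satisfies $-u_{0xx}(x)+1>0$ for all $x$. Let $\hat M(y,t,z)$ be the solution of the $3\times3$ matrix Riemann--Hilbert problem (stated in the context) whose data (jump matrix and residue conditions) are determined by $u_0$. Then $u$ is expressed in terms of $\hat M$ in the parametric form $u(x,t)=\hat u(y(x,t),t)$, where $$x(y,t)=y+\lim_{z\to0}\left(\frac{\sum_{j=1}^3\hat M_{j3}(y,t,z)}{\sum_{j=1}^3\hat M_{j3}(y,t,0)}-1\right)\frac1z,\qquad \hat u(y,t)=\frac{\partial x(y,t)}{\partial t},$$ and $y(x,t)$ denotes the inverse of $y\mapsto x(y,t)$.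
   Context: Standing assumptions: the solution $u$ is real-valued, smooth, decays sufficiently fast as $|x|\to\infty$, and $1-u_{xx}(x,t)>0$ for all $(x,t)$. Notation: $\omega=e^{2\pi i/3}$; $\lambda_j(z)=z\omega^j$, $j=1,2,3$; $\Lambda(z)=\mathrm{diag}(\lambda_1,\lambda_2,\lambda_3)=z\,\mathrm{diag}(\omega,\omega^2,1)$; $q=(1-u_{xx})^{1/3}$; $$U=\frac{q_x}{3q}\begin{pmatrix}0&1-\omega^2&1-\omega\\1-\omega&0&1-\omega^2\\1-\omega^2&1-\omega&0\end{pmatrix};\qquad y(x,t)=x-\int_x^\infty(q(\xi,t)-1)\,d\xi;$$ $Q(x,t,z)=y(x,t)\Lambda(z)+t\Lambda^{-1}(z)$. Eigenfunctions: $M(x,t,z)$ is the $3\times3$ matrix solution of the system of integral equations $$M_{jl}(x,t,z)=\delta_{jl}+\int_{\infty_{jl}}^x e^{(\lambda_j(z)-\lambda_l(z))\int_\xi^x q(\zeta,t)d\zeta}\,(UM)_{jl}(\xi,t,z)\,d\xi,$$ where $\infty_{jl}=+\infty$ if $\operatorname{Re}\lambda_j(z)\ge\operatorname{Re}\lambda_l(z)$ and $\infty_{jl}=-\infty$ if $\operatorname{Re}\lambda_j(z)<\operatorname{Re}\lambda_l(z)$. Contour: $\Sigma=\mathbb R\cup\omega\mathbb R\cup\omega^2\mathbb R$ (the set where $\operatorname{Re}\lambda_j=\operatorname{Re}\lambda_l$ for some $j\ne l$); it divides the plane into six open sectors. $\mathbb R$ is oriented from left to right, and $\omega\mathbb R,\omega^2\mathbb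 R$ are oriented as its images under rotation by $\omega,\omega^2$; subscripts $+$ and $-$ denote limits from the left and the right side. $M$ is piecewise meromorphic in $z$ relative to $\Sigma$. Scattering data (determined by $u_0$, by setting $t=0$): the matrix $S_0(z)$, $z\in\Sigma$, is defined by $M_+(x,0,z)=M_-(x,0,z)e^{Q(x,0,z)}S_0(z)e^{-Q(x,0,z)}$. Generically $M$ has at most finitely many poles in $\mathbb C\setminus\Sigma$, all simple, distinct columns have distinct poles, and the residue at a pole $z_n$ of the $l$-th column is governed by a constant $v_n^{jl}$, for some $j\neq l$, as in the residue condition below (taken at $t=0$). Riemann--Hilbert problem: given $\{S_0(z),\,z\in\Sigma;\ z_n,v_n^{jl}\}$, find for each $y\in\mathbb R$, $t\ge0$ a piecewise (relative to $\Sigma$) meromorphic $3\times3$ matrix function $\hat M(y,t,z)$ such that: (1) $\hat M_+(y,t,z)=\hat M_-(y,t,z)\,e^{y\Lambda(z)+t\Lambda^{-1}(z)}S_0(z)e^{-y\Lambda(z)-t\Lambda^{-1}(z)}$, $z\in\Sigma$; (2) $\hat M(y,t,z)=I+O(1/z)$ as $z\to\infty$; (3) if $z_n$ is a pole of the $l$-th column $\hat M^{(l)}$, then $\operatorname{Res}_{z=z_n}\hat M^{(l)}(y,t,z)=\hat M^{(j)}(y,t,z_n)\,v_n^{jl}\,e^{y(\lambda_j(z_n)-\lambda_l(z_n))+t(\lambda_j^{-1}(z_n)-\lambda_l^{-1}(z_n))}$. Its solution is unique and is $\hat M(y(x,t),t,z)=M(x,t,z)$. $\hat M(y,t,0)$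 denotes the limit as $z\to0$. *)

theory Defs
  imports "HOL-Complex_Analysis.Complex_Analysis" "HOL-Library.Landau_Symbols"
begin

section \<open>The Cauchy problem\<close>

text \<open>Functions \<open>u x t\<close> live on \<open>x \<in> \<real>\<close>, \<open>t \<ge> 0\<close>; at \<open>t = 0\<close> the time derivative is one-sided.\<close>

definition dx :: "(real \<Rightarrow> real \<Rightarrow> real) \<Rightarrow> real \<Rightarrow> real \<Rightarrow> real" where
  "dx f x t = deriv (\<lambda>\<xi>. f \<xi> t) x"

definition dt :: "(real \<Rightarrow> real \<Rightarrow> real) \<Rightarrow> real \<Rightarrow> real \<Rightarrow> real" where
  "dt f x t = vector_derivative (\<lambda>\<tau>. f x \<tau>) (at t within {0..})"

definition smooth_halfplane :: "(real \<Rightarrow> real \<Rightarrow> real) \<Rightarrow> bool" where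
  "smooth_halfplane u \<longleftrightarrow>
     (\<forall>a b. let f = (dx ^^ a) ((dt ^^ b) u) in
        continuous_on (UNIV \<times> {0..}) (\<lambda>(x, t). f x t) \<and>
        (\<forall>x. \<forall>t\<ge>0. (\<lambda>\<xi>. f \<xi> t) differentiable (at x) \<and>
                   (\<lambda>\<tau>. f x \<tau>) differentiable (at t within {0..})))"

text \<open>The meaning given here to ``sufficiently fast'' decay: every \<open>x\<close>-derivative is
  \<open>O(|x|\<^sup>-\<^sup>p)\<close> for one fixed \<open>p > 1\<close>, locally uniformly in \<open>t\<close>. Much faster decay would be
  unnatural, as the flow of this equation does not preserve it unless the initial data satisfy
  further moment conditions.\<close>

definition decays_halfplane :: "(real \<Rightarrow> real \<Rightarrow> real) \<Rightarrow> bool" where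
  "decays_halfplane u \<longleftrightarrow>
     (\<exists>p>1. \<forall>a T. \<exists>C. \<forall>x. \<forall>t\<in>{0..T}. \<bar>(dx ^^ a) u x t\<bar> \<le> C * (1 + \<bar>x\<bar>) powr (- p))"

definition smooth_line :: "(real \<Rightarrow> real) \<Rightarrow> bool" where
  "smooth_line f \<longleftrightarrow> (\<forall>a x. (deriv ^^ a) f differentiable (at x))"

definition decays_line :: "(real \<Rightarrow> real) \<Rightarrow> bool" where
  "decays_line f \<longleftrightarrow> (\<exists>p>1. \<forall>a. \<exists>C. \<forall>x. \<bar>(deriv ^^ a) f x\<bar> \<le> C * (1 + \<bar>x\<bar>) powr (- p))"

definition cauchy_solution :: "(real \<Rightarrow> real) \<Rightarrow> (real \<Rightarrow> real \<Rightarrow> real) \<Rightarrow> bool" where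
  "cauchy_solution u0 u \<longleftrightarrow>
     (\<forall>x. \<forall>t>0. dx (dx (dt u)) x t - 3 * dx u x t + 3 * dx u x t * dx (dx u) x t
                 + u x t * dx (dx (dx u)) x t = 0) \<and>
     (\<forall>x. u x 0 = u0 x)"

section \<open>The spectral problem of a profile\<close>

definition omega :: complex where
  "omega = exp (2 * of_real pi * \<i> / 3)"

definition lam :: "complex \<Rightarrow> complex^3" where
  "lam z = vector [z * omega, z * omega ^ 2, z * omega ^ 3]"

definition diag_matrix :: "complex^3 \<Rightarrow> complex^3^3" where
  "diag_matrix d = (\<chi> i j. if i = j then d $ i else 0)"

text \<open>The exponential of the diagonal matrix \<open>y \<Lambda>(z) + t \<Lambda>(z)\<^sup>-\<^sup>1\<close>; its inverse is
  \<open>expQ (- y) (- t) z\<close>.\<close>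

definition expQ :: "real \<Rightarrow> real \<Rightarrow> complex \<Rightarrow> complex^3^3" where
  "expQ y t z = diag_matrix (\<chi> j. exp (of_real y * lam z $ j + of_real t * inverse (lam z $ j)))"

text \<open>In this section \<open>w\<close> is the profile \<open>u(\<sqdot>,t)\<close> at one fixed time.\<close>

definition qfun :: "(real \<Rightarrow> real) \<Rightarrow> real \<Rightarrow> real" where
  "qfun w x = root 3 (1 - deriv (deriv w) x)"

definition Umat :: "(real \<Rightarrow> real) \<Rightarrow> real \<Rightarrow> complex^3^3" where
  "Umat w x = (deriv (qfun w) x / (3 * qfun w x)) *\<^sub>R
     vector [vector [0, 1 - omega ^ 2, 1 - omega],
             vector [1 - omega, 0, 1 - omega ^ 2],
             vector [1 - omega ^ 2, 1 - omega, 0]]"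

definition yfun :: "(real \<Rightarrow> real) \<Rightarrow> real \<Rightarrow> real" where
  "yfun w x = x - (LBINT \<xi>=ereal x..\<infinity>. qfun w \<xi> - 1)"

definition contour :: "complex set" where
  "contour = {of_real s * omega ^ k | s k. k < 3}"

definition inf_jl :: "complex \<Rightarrow> 3 \<Rightarrow> 3 \<Rightarrow> ereal" where
  "inf_jl z j l = (if Re (lam z $ j) \<ge> Re (lam z $ l) then \<infinity> else - \<infinity>)"

definition eigen_integrand ::
    "(real \<Rightarrow> real) \<Rightarrow> (real \<Rightarrow> complex^3^3) \<Rightarrow> complex \<Rightarrow> 3 \<Rightarrow> 3 \<Rightarrow> real \<Rightarrow> real \<Rightarrow> complex" where
  "eigen_integrand w m z j l x \<xi> =
     exp ((lam z $ j - lam z $ l) * of_real (LBINT \<zeta>=ereal \<xi>..ereal x. qfun w \<zeta>))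
       * (Umat w \<xi> ** m \<xi>) $ j $ l"

text \<open>\<open>m\<close> is the solution \<open>x \<mapsto> M(x,z)\<close>, for one \<open>z\<close>; solutions are understood to be bounded in \<open>x\<close>.
  The interval integral from \<open>\<infinity>\<close> down to \<open>x\<close> carries a minus sign.\<close>

definition eigenfunction :: "(real \<Rightarrow> real) \<Rightarrow> complex \<Rightarrow> (real \<Rightarrow> complex^3^3) \<Rightarrow> bool" where
  "eigenfunction w z m \<longleftrightarrow> bounded (range m) \<and>
     (\<forall>x j l. interval_lebesgue_integrable lborel (inf_jl z j l) (ereal x) (eigen_integrand w m z j l x) \<and>
        m x $ j $ l = (if j = l then 1 else 0)
          + (LBINT \<xi>=inf_jl z j l..ereal x. eigen_integrand w m z j l x \<xi>))"

section \<open>Scattering data and the Riemann--Hilbert problem\<close>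

text \<open>Discrete data: a finite set \<open>Z\<close> of points \<open>z\<^sub>n\<close>, and for \<open>p = z\<^sub>n\<close> the (only) column
  \<open>l = col p\<close> allowed to have a pole at \<open>p\<close>, the index \<open>j = src p\<close> and the constant \<open>v\<^sub>n\<^sup>j\<^sup>l = v p\<close>.\<close>

definition discrete_data :: "complex set \<Rightarrow> (complex \<Rightarrow> 3) \<Rightarrow> (complex \<Rightarrow> 3) \<Rightarrow> bool" where
  "discrete_data Z col src \<longleftrightarrow> finite Z \<and> Z \<inter> contour = {} \<and> (\<forall>p\<in>Z. src p \<noteq> col p)"

text \<open>Piecewise meromorphy, with at most simple poles obeying the residue condition.\<close>

definition pole_condition ::
    "complex set \<Rightarrow> (complex \<Rightarrow> 3) \<Rightarrow> (complex \<Rightarrow> 3) \<Rightarrow> (complex \<Rightarrow> complex) \<Rightarrow>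
     real \<Rightarrow> real \<Rightarrow> (complex \<Rightarrow> complex^3^3) \<Rightarrow> bool" where
  "pole_condition Z col src v y t F \<longleftrightarrow>
     (\<forall>i l. (\<lambda>z. F z $ i $ l) holomorphic_on - (contour \<union> {p \<in> Z. col p = l})) \<and>
     (\<forall>p\<in>Z. \<forall>i. let j = src p; l = col p in
        (\<exists>c. ((\<lambda>z. (z - p) * F z $ i $ l) \<longlongrightarrow> c) (at p)) \<and>
        residue (\<lambda>z. F z $ i $ l) p =
          F p $ i $ j * v p * exp (of_real y * (lam p $ j - lam p $ l)
                                 + of_real t * (inverse (lam p $ j) - inverse (lam p $ l))))"

text \<open>The line \<open>\<omega>\<^sup>k \<real>\<close> is directed along \<open>\<omega>\<^sup>k\<close>, so its left side is \<open>Im (w / \<omega>\<^sup>k) > 0\<close>.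
  The jump relation makes sense away from the origin, where \<open>\<Lambda>\<^sup>-\<^sup>1\<close> is singular.\<close>

definition jump_condition ::
    "(complex \<Rightarrow> complex^3^3) \<Rightarrow> real \<Rightarrow> real \<Rightarrow> (complex \<Rightarrow> complex^3^3) \<Rightarrow> bool" where
  "jump_condition S y t F \<longleftrightarrow>
     (\<forall>k<3. \<forall>s::real. s \<noteq> 0 \<longrightarrow>
       (let z = of_real s * omega ^ k in
        \<exists>Fplus Fminus.
          (F \<longlongrightarrow> Fplus) (at z within {w. Im (w / omega ^ k) > 0}) \<and>
          (F \<longlongrightarrow> Fminus) (at z within {w. Im (w / omega ^ k) < 0}) \<and>
          Fplus = Fminus ** expQ y t z ** S z ** expQ (- y) (- t) z))"

text \<open>The spectral data \<open>S\<close>, \<open>Z\<close>, \<open>col\<close>, \<open>src\<close>, \<open>v\<close> of the profile \<open>w\<close> (in the generic case), read off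
  from its eigenfunctions \<open>M x z\<close> at \<open>t = 0\<close>.\<close>

definition scattering_data ::
    "(real \<Rightarrow> real) \<Rightarrow> (real \<Rightarrow> complex \<Rightarrow> complex^3^3) \<Rightarrow> (complex \<Rightarrow> complex^3^3) \<Rightarrow>
     complex set \<Rightarrow> (complex \<Rightarrow> 3) \<Rightarrow> (complex \<Rightarrow> 3) \<Rightarrow> (complex \<Rightarrow> complex) \<Rightarrow> bool" where
  "scattering_data w M S Z col src v \<longleftrightarrow>
     discrete_data Z col src \<and>
     (\<forall>z. z \<notin> contour \<union> Z \<longrightarrow> eigenfunction w z (\<lambda>x. M x z)) \<and>
     (\<forall>x. pole_condition Z col src v (yfun w x) 0 (M x) \<and>
          jump_condition S (yfun w x) 0 (M x))"

text \<open>The last clause is the existence of \<open>F(0)\<close>. It cannot be dropped: left multiplication by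
  \<open>I + A / z\<close> respects all the other clauses.\<close>

definition rh_solution ::
    "(complex \<Rightarrow> complex^3^3) \<Rightarrow> complex set \<Rightarrow> (complex \<Rightarrow> 3) \<Rightarrow> (complex \<Rightarrow> 3) \<Rightarrow>
     (complex \<Rightarrow> complex) \<Rightarrow> real \<Rightarrow> real \<Rightarrow> (complex \<Rightarrow> complex^3^3) \<Rightarrow> bool" where
  "rh_solution S Z col src v y t F \<longleftrightarrow>
     jump_condition S y t F \<and>
     (\<forall>i j. (\<lambda>z. F z $ i $ j - mat 1 $ i $ j)
              \<in> O[inf at_infinity (principal (- contour))](\<lambda>z. 1 / z)) \<and>
     pole_condition Z col src v y t F \<and>
     (\<exists>F0. (F \<longlongrightarrow> F0) (at 0 within - contour))"

text \<open>\<open>X y t\<close> is the value of the parametrization \<open>x(y,t)\<close> defined by the limit formula. The index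
  \<open>3 :: 3\<close> denotes the last column.\<close>

definition is_parametrization ::
    "(real \<Rightarrow> real \<Rightarrow> complex \<Rightarrow> complex^3^3) \<Rightarrow> (real \<Rightarrow> real \<Rightarrow> real) \<Rightarrow> bool" where
  "is_parametrization Mhat X \<longleftrightarrow>
     (\<forall>y. \<forall>t\<ge>0. \<exists>M0 L.
        (Mhat y t \<longlongrightarrow> M0) (at 0 within - contour) \<and>
        (\<Sum>j\<in>UNIV. M0 $ j $ 3) \<noteq> 0 \<and>
        ((\<lambda>z. ((\<Sum>j\<in>UNIV. Mhat y t z $ j $ 3) / (\<Sum>j\<in>UNIV. M0 $ j $ 3) - 1) * (1 / z))
            \<longlongrightarrow> L) (at 0 within - contour) \<and>
        of_real (X y t) = of_real y + L)"

end

theory Submission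
  imports Defs
begin

text \<open>The equation is the compatibility condition of \<open>\<psi>\<^sub>x\<^sub>x\<^sub>x = z\<^sup>3 (1 - u\<^sub>x\<^sub>x) \<psi>\<close> and
  \<open>\<psi>\<^sub>t = z\<^sup>-\<^sup>3 \<psi>\<^sub>x\<^sub>x - u \<psi>\<^sub>x + u\<^sub>x \<psi>\<close>, and \<open>t \<mapsto> x(y,t)\<close> are the characteristics of \<open>q\<^sub>t + (u q)\<^sub>x = 0\<close>.
  Along a characteristic the second equation is a linear ordinary differential equation whose
  propagator is holomorphic in \<open>z \<noteq> 0\<close> and tends to the identity as \<open>z \<rightarrow> \<infinity>\<close>. Applied to the
  eigenfunctions at \<open>t = 0\<close> it therefore yields, for every \<open>t\<close>, a matrix which inherits from them
  the jump, the poles and the normalization at infinity, so no spectral analysis at \<open>t > 0\<close> is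
  needed.

  At \<open>z = 0\<close> the propagator has an essential singularity. There one uses that the propagated
  functions also solve the \<open>x\<close>-equation, in a gauge in which they are, for small \<open>z\<close>, a perturbation of
  size \<open>O(z)\<close> of the free solutions: this gives the limit at \<open>z = 0\<close>, and the column sum
  \<open>q e\<^bsup>(x - y) z\<^esup> (1 + O(z\<^sup>2))\<close>, whose expansion contains \<open>x - y\<close>. By Liouville's theorem and Cramer's
  rule the Riemann--Hilbert problem has no other solution.\<close>

text \<open>The eigenfunctions are given, for each \<open>z\<close>, only as bounded solutions of an
  integral equation, and the bound at hand for the propagated ones contains an exponential of
  \<open>1 / norm z\<close>. Uniformity in \<open>z\<close> is extracted from the differential
  equations: a solution with prescribed limits at the ends of the line satisfies |m - \<delta>|
  \<le> \<epsilon> sup |m|, with \<epsilon> proportional to |z| near 0 and to 1/|z| near infinity.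
  Once \<epsilon> \<le> 1/2 the supremum is absorbed, so only its finiteness matters.

  The accuracy required at \<open>z = 0\<close> shapes the rest. The formula reads off the
  coefficient of \<open>z\<close> in a column sum, so an error of order \<open>z\<close> would spoil
  it; hence the change to a phase in \<open>x\<close> instead of \<open>y\<close> and the second,
  quadratic estimate for the sum.

  The propagated functions solve the time equation by construction, but nothing is known in advance
  about their differentiability in space for t > 0. The space equation is therefore transported from
  t = 0 by a Volterra argument.

  Uniqueness rests on det S = 1. This is derived from the initial eigenfunctions, whose determinant
  is constant because the equation is a commutator plus a traceless term.\<close>

no_notation fps_nth (infixl "$" 75)

section \<open>Uniqueness for the Riemann--Hilbert problem\<close>

lemma omega_eq: "omega = Complex (-1/2) (sqrt 3 / 2)"
proof -
  have "cos (2 * pi / 3) = -1/2" "sin (2 * pi / 3) = sqrt 3 / 2"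
    by (simp_all add: cos_120 sin_120)
  then show ?thesis
    unfolding omega_def by (simp add: complex_eq_iff Re_exp Im_exp)
qed

lemma omega_cube [simp]: "omega ^ 3 = 1"
  by (simp add: omega_eq complex_eq_iff power3_eq_cube algebra_simps)

lemma omega_square: "omega ^ 2 = - 1 - omega"
  by (simp add: omega_eq complex_eq_iff power2_eq_square)

lemma norm_omega [simp]: "norm omega = 1"
  unfolding omega_def norm_exp_eq_Re by simp

lemma omega_nonzero [simp]: "omega \<noteq> 0"
  using norm_omega by force

definition ray_line :: "nat \<Rightarrow> complex set" where
  "ray_line k = {w. Im (w / omega ^ k) = 0}"

text \<open>Division by a number of modulus 1 is multiplication by its conjugate. Written as an
  inner product, the condition selecting a side of a contour line falls under the facts on
  hyperplanes and half-spaces.\<close>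

lemma Im_div_omega: "Im (w / omega ^ k) = (\<i> * omega ^ k) \<bullet> w"
proof -
  have "w / omega ^ k = w * cnj (omega ^ k)"
    by (subst complex_div_cnj) (simp add: norm_power)
  then show ?thesis
    by (simp add: inner_complex_def algebra_simps del: complex_cnj_power)
qed

lemma ray_line_alt: "ray_line k = {of_real s * omega ^ k | s. True}"
proof (rule set_eqI)
  fix w
  have "Im (w / omega ^ k) = 0 \<longleftrightarrow> (\<exists>s. w / omega ^ k = of_real s)"
    by (metis Im_complex_of_real complex_is_Real_iff Reals_cases)
  then show "w \<in> ray_line k \<longleftrightarrow> w \<in> {of_real s * omega ^ k | s. True}"
    by (auto simp: ray_line_def field_simps)
qed

lemma contour_eq: "contour = (\<Union>k<3. ray_line k)"
  unfolding contour_def ray_line_alt by blast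

lemma closed_ray_line: "closed (ray_line k)"
  unfolding ray_line_def Im_div_omega by (rule closed_hyperplane)

lemma closed_contour: "closed contour"
  unfolding contour_eq by (intro closed_UN) (auto simp: closed_ray_line)

lemma interior_ray_line: "interior (ray_line k) = {}"
  unfolding ray_line_def Im_div_omega by (rule interior_hyperplane) simp

lemma interior_contour: "interior contour = {}"
proof -
  have "interior (ray_line 0 \<union> ray_line 1 \<union> ray_line 2) = {}"
    by (simp only: interior_closed_Un_empty_interior closed_Un closed_ray_line interior_ray_line)
  moreover have "{..<3::nat} = {0,1,2}" by auto
  then have "contour = ray_line 0 \<union> ray_line 1 \<union> ray_line 2"
    unfolding contour_eq by auto
  ultimately show ?thesis by simp
qed

lemma zero_in_contour [simp]: "0 \<in> contour"
  unfolding contour_eq ray_line_def by (auto intro!: exI[of _ 0])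

text \<open>Three lines and finitely many points have empty interior, so their complement is dense.
  This makes limits within the complement unique, also at points of the contour.\<close>

lemma offcontour_islimpt:
  assumes "finite Z"
  shows "at z within - (contour \<union> Z) \<noteq> bot"
proof -
  have "interior (contour \<union> Z) = {}"
    using assms by (simp add: interior_closed_Un_empty_interior closed_contour interior_contour empty_interior_finite)
  then have "closure (- (contour \<union> Z)) = UNIV"
    by (simp add: closure_interior)
  moreover have "open (- (contour \<union> Z))"
    using assms by (intro open_Compl closed_Un closed_contour finite_imp_closed)
  ultimately show ?thesis
    by (metis UNIV_I trivial_limit_within interior_limit_point interior_open closure_def Un_iff mem_Collect_eq)
qed

text \<open>The lines are removed one at a time. Pasting across a line needs an open set cut by that
  line only, so the lines still to be treated are first taken out of the open set. The origin,
  common to all three, comes back with the last line; the points of \<open>Z\<close> are isolated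
  singularities of a continuous function.\<close>

lemma holomorphic_off_contour:
  assumes cont: "continuous_on UNIV g" and hol: "g holomorphic_on - (contour \<union> Z)" and Z: "finite Z"
  shows "g holomorphic_on UNIV"
proof -
  have 3: "{..<3::nat} = {0,1,2}" by auto
  have paste: "g holomorphic_on T"
    if "open T" "g holomorphic_on (T - ray_line k)" for T k
  proof (rule holomorphic_on_paste_across_line[where d = "\<i> * omega ^ k" and k = 0])
    show "g holomorphic_on T \<inter> {z. (\<i> * omega ^ k) \<bullet> z < 0}"
         "g holomorphic_on T \<inter> {z. 0 < (\<i> * omega ^ k) \<bullet> z}"
      by (rule holomorphic_on_subset[OF that(2)], auto simp: ray_line_def Im_div_omega)+
    show "continuous_on T g" using cont continuous_on_subset by blast
  qed (use that in auto)
  have o: "open (- Z)" using Z by (intro open_Compl finite_imp_closed)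
  have "- (contour \<union> Z) = - Z - ray_line 1 - ray_line 2 - ray_line 0"
    unfolding contour_eq 3 by blast
  then have "g holomorphic_on (- Z - ray_line 1 - ray_line 2 - ray_line 0)"
    using hol by simp
  then have "g holomorphic_on (- Z - ray_line 1 - ray_line 2)"
    by (rule paste[of _ 0, rotated]) (intro open_Diff o closed_ray_line)
  moreover have "- Z - ray_line 1 - ray_line 2 = - Z - ray_line 2 - ray_line 1" by blast
  ultimately have "g holomorphic_on (- Z - ray_line 2 - ray_line 1)" by simp
  then have "g holomorphic_on (- Z - ray_line 2)"
    by (rule paste[OF open_Diff[OF o closed_ray_line]])
  then have "g holomorphic_on (- Z)"
    by (rule paste[OF o])
  then show ?thesis
    by (intro no_isolated_singularity[OF cont _ _ Z]) (auto simp: Compl_eq_Diff_UNIV)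
qed

lemma tendsto_offcontour_sides:
  assumes "k < 3" "s \<noteq> 0" "z = of_real s * omega ^ k"
    and up: "(h \<longlongrightarrow> c) (at z within {w. Im (w / omega ^ k) > 0})"
    and down: "(h \<longlongrightarrow> c) (at z within {w. Im (w / omega ^ k) < 0})"
  shows "(h \<longlongrightarrow> c) (at z within - contour)"
proof -
  have "(h \<longlongrightarrow> c) (at z within ({w. Im (w / omega ^ k) > 0} \<union> {w. Im (w / omega ^ k) < 0}))"
    using up down by (rule Lim_Un)
  then show ?thesis
    by (rule tendsto_within_subset) (use assms(1) in \<open>auto simp: contour_eq ray_line_def\<close>)
qed

text \<open>The boundary limits exist only along the complement, so the extension \<open>g\<close>
  is chosen pointwise. Density of the complement (\<open>approx\<close>) carries the estimates for
  \<open>h\<close> over to \<open>g\<close>, both for continuity and for the limit at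
  infinity.\<close>

proposition liouville_off_contour:
  assumes Z: "finite Z" and hol: "h holomorphic_on - (contour \<union> Z)"
    and lims: "\<And>z. z \<in> contour \<union> Z \<Longrightarrow> \<exists>c. (h \<longlongrightarrow> c) (at z within - (contour \<union> Z))"
    and inf: "(h \<longlongrightarrow> L) (inf at_infinity (principal (- contour)))"
    and z: "z \<notin> contour \<union> Z"
  shows "h z = L"
proof -
  define D where "D = - (contour \<union> Z)"
  have oD: "open D" unfolding D_def
    using Z by (intro open_Compl closed_Un closed_contour finite_imp_closed)
  have ntr: "at w within D \<noteq> bot" for w
    unfolding D_def by (rule offcontour_islimpt[OF Z])
  have ex: "\<exists>c. (h \<longlongrightarrow> c) (at w within D)" for w
  proof (cases "w \<in> D")
    case True
    then have "isCont h w"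
      using hol oD holomorphic_on_imp_continuous_on continuous_on_eq_continuous_at unfolding D_def by blast
    then show ?thesis
      by (meson isCont_def tendsto_within_subset subset_UNIV Lim_at_imp_Lim_at_within)
  qed (use lims in \<open>auto simp: D_def\<close>)
  define g where "g w = (SOME c. (h \<longlongrightarrow> c) (at w within D))" for w
  have g: "(h \<longlongrightarrow> g w) (at w within D)" for w
    unfolding g_def using ex by (rule someI_ex)
  have gh: "g w = h w" if "w \<in> D" for w
  proof (rule tendsto_unique[OF ntr g])
    have "isCont h w"
      using that hol oD holomorphic_on_imp_continuous_on continuous_on_eq_continuous_at unfolding D_def by blast
    then show "(h \<longlongrightarrow> h w) (at w within D)"
      by (meson isCont_def Lim_at_imp_Lim_at_within)
  qed
  have approx: "\<exists>w'\<in>D. dist w' w < d \<and> dist (h w') (g w) < e" if "d > 0" "e > 0" for w d e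
  proof -
    have "eventually (\<lambda>w'. dist (h w') (g w) < e) (at w within D)"
      using g[of w] \<open>e > 0\<close> by (rule tendstoD)
    moreover have "eventually (\<lambda>w'. w' \<in> D \<and> dist w' w < d) (at w within D)"
      unfolding eventually_at using \<open>d > 0\<close> by auto
    ultimately have "eventually (\<lambda>w'. (w' \<in> D \<and> dist w' w < d) \<and> dist (h w') (g w) < e) (at w within D)"
      by (rule eventually_conj[rotated])
    then show ?thesis using ntr[of w] eventually_happens' by blast
  qed
  have contg: "continuous_on UNIV g"
    unfolding continuous_on_iff
  proof (intro ballI allI impI)
    fix w :: complex and e :: real assume "e > 0"
    then have "eventually (\<lambda>w'. dist (h w') (g w) < e / 2) (at w within D)"
      by (intro tendstoD[OF g]) auto
    then obtain d where d: "d > 0" "\<And>w'. w' \<in> D \<Longrightarrow> w' \<noteq> w \<Longrightarrow> dist w' w < d \<Longrightarrow> dist (h w') (g w) < e / 2"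
      unfolding eventually_at by blast
    show "\<exists>d>0. \<forall>x'\<in>UNIV. dist x' w < d \<longrightarrow> dist (g x') (g w) < e"
    proof (intro exI conjI ballI impI)
      fix v assume v: "dist v w < d"
      show "dist (g v) (g w) < e"
      proof (cases "v = w")
        case False
        \<comment> \<open>The bound by \<open>dist v w\<close> forces \<open>w' \<noteq> w\<close>;
          this is needed because \<open>d\<close> controls \<open>h\<close> only at points other
          than \<open>w\<close>.\<close>
        have "min (d - dist v w) (dist v w) > 0" using v False by simp
        from approx[OF this, of "e/2" v] \<open>e > 0\<close> obtain w' where
          w': "w' \<in> D" "dist w' v < min (d - dist v w) (dist v w)" "dist (h w') (g v) < e / 2" by auto
        have "dist w' w < d" "w' \<noteq> w" using w'(2) dist_triangle[of w' w v] by (auto simp: dist_commute)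
        then have "dist (h w') (g w) < e / 2" using d(2) w'(1) by blast
        then show ?thesis using w'(3) dist_triangle[of "g v" "g w" "h w'"] by (simp add: dist_commute)
      qed (use \<open>e > 0\<close> in simp)
    qed (use d in auto)
  qed
  have "g holomorphic_on D"
    using gh by (intro holomorphic_transform[OF hol[folded D_def]]) auto
  then have holg: "g holomorphic_on UNIV"
    using holomorphic_off_contour[OF contg _ Z] by (simp add: D_def)
  have "(g \<longlongrightarrow> L) at_infinity"
  proof (rule tendstoI)
    fix e :: real assume "e > 0"
    then have "eventually (\<lambda>w. dist (h w) L < e / 2) (inf at_infinity (principal (- contour)))"
      by (intro tendstoD[OF inf]) auto
    then obtain R where R: "\<And>w. norm w \<ge> R \<Longrightarrow> w \<notin> contour \<Longrightarrow> dist (h w) L < e / 2"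
      unfolding eventually_inf_principal eventually_at_infinity by auto
    show "eventually (\<lambda>w. dist (g w) L < e) at_infinity"
      unfolding eventually_at_infinity
    proof (intro exI allI impI)
      fix w :: complex assume w: "norm w \<ge> R + 1"
      from approx[of 1 "e/2" w] \<open>e > 0\<close> obtain w' where
        w': "w' \<in> D" "dist w' w < 1" "dist (h w') (g w) < e / 2" by auto
      have "norm w' \<ge> R" using w w'(2) norm_triangle_ineq2[of w w'] by (simp add: dist_norm norm_minus_commute)
      then have "dist (h w') L < e / 2" using R w'(1) by (auto simp: D_def)
      then show "dist (g w) L < e" using w'(3) dist_triangle[of "g w" L "h w'"] by (simp add: dist_commute)
    qed
  qed
  then have "g z = L" by (rule Liouville_weak[OF holg])
  then show ?thesis using gh[of z] z by (simp add: D_def)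
qed

section \<open>Determinants without jump, and Cramer's rule\<close>

lemma tendsto_det_3:
  fixes f :: "'a \<Rightarrow> complex^3^3"
  assumes "(f \<longlongrightarrow> A) F"
  shows "((\<lambda>x. det (f x)) \<longlongrightarrow> det A) F"
  unfolding det_3 by (intro tendsto_intros assms)

lemma det_diag_matrix: "det (diag_matrix d) = d $ 1 * d $ 2 * d $ 3"
  by (simp add: det_3 diag_matrix_def)

lemma diag_matrix_mult_left: "(diag_matrix d ** A) $ i $ j = d $ i * A $ i $ j"
proof -
  have "(\<Sum>k\<in>UNIV. (if i = k then d $ i else 0) * A $ k $ j) = (\<Sum>k\<in>UNIV. if i = k then d $ i * A $ k $ j else 0)"
    by (intro sum.cong) auto
  then show ?thesis
    by (simp add: matrix_matrix_mult_def diag_matrix_def)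
qed

lemma diag_matrix_mult_right: "(A ** diag_matrix d) $ i $ j = A $ i $ j * d $ j"
proof -
  have "(\<Sum>k\<in>UNIV. A $ i $ k * (if k = j then d $ k else 0)) = (\<Sum>k\<in>UNIV. if k = j then A $ i $ k * d $ k else 0)"
    by (intro sum.cong) auto
  then show ?thesis
    by (simp add: matrix_matrix_mult_def diag_matrix_def)
qed

lemma expQ_component_mult: "expQ y t z = diag_matrix (\<chi> j. exp (of_real y * lam z $ j + of_real t / lam z $ j))"
  by (simp add: expQ_def field_simps)

lemma det_expQ_conj: "det (A ** expQ y t z ** S ** expQ (- y) (- t) z) = det A * det S"
proof -
  have "det (expQ y t z) * det (expQ (- y) (- t) z) = 1"
    by (simp add: expQ_component_mult det_diag_matrix flip: exp_add)
  then show ?thesis by (simp add: det_mul mult_ac)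
qed

text \<open>Serves to subtract from a singular column the multiple of another column that cancels
  its pole.\<close>

lemma det_column_operation_3:
  fixes A :: "complex^3^3"
  assumes "l \<noteq> j"
  shows "det (\<chi> i k. if k = l then A $ i $ l - c * A $ i $ j else A $ i $ k) = det A"
  using assms exhaust_3[of l] exhaust_3[of j]
  by (auto simp: det_3 algebra_simps)

lemma offcontour_open:
  assumes "finite Z"
  shows "open (- (contour \<union> Z))"
  using assms by (intro open_Compl closed_Un closed_contour finite_imp_closed)

text \<open>The singularity at \<open>p\<close> is isolated, so the limit that the pole condition
  merely asserts to exist is the residue. As a limit the residue relation survives multiplication by
  functions continuous at \<open>p\<close>; the next lemma is the way back.\<close>

lemma pole_condition_tendsto:
  assumes dd: "discrete_data Z col src" and pole: "pole_condition Z col src v y t F" and p: "p \<in> Z"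
  shows "((\<lambda>z. (z - p) * F z $ i $ col p) \<longlongrightarrow> F p $ i $ src p * v p *
     exp (of_real y * (lam p $ src p - lam p $ col p) + of_real t * (inverse (lam p $ src p) - inverse (lam p $ col p)))) (at p)"
proof -
  have Z: "finite Z" and pc: "p \<notin> contour" using dd p by (auto simp: discrete_data_def)
  obtain r where r: "((\<lambda>z. (z - p) * F z $ i $ col p) \<longlongrightarrow> r) (at p)"
    and rr: "residue (\<lambda>z. F z $ i $ col p) p = F p $ i $ src p * v p *
       exp (of_real y * (lam p $ src p - lam p $ col p) + of_real t * (inverse (lam p $ src p) - inverse (lam p $ col p)))"
    using pole p by (force simp: pole_condition_def Let_def)
  have "(\<lambda>z. F z $ i $ col p) holomorphic_on - (contour \<union> {p' \<in> Z. col p' = col p})"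
    using pole by (simp add: pole_condition_def)
  then have hol: "(\<lambda>z. F z $ i $ col p) holomorphic_on (- (contour \<union> (Z - {p})) - {p})"
    by (rule holomorphic_on_subset) auto
  have "residue (\<lambda>z. F z $ i $ col p) p = r"
    by (rule residue_simple'[OF offcontour_open _ hol]) (use Z pc r in \<open>auto simp: mult.commute\<close>)
  with r rr show ?thesis by simp
qed

lemma pole_conditionI:
  assumes dd: "discrete_data Z col src"
    and hol: "\<And>i l. (\<lambda>z. F z $ i $ l) holomorphic_on - (contour \<union> {p \<in> Z. col p = l})"
    and lim: "\<And>p i. p \<in> Z \<Longrightarrow> ((\<lambda>z. (z - p) * F z $ i $ col p) \<longlongrightarrow> F p $ i $ src p * v p *
     exp (of_real y * (lam p $ src p - lam p $ col p) + of_real t * (inverse (lam p $ src p) - inverse (lam p $ col p)))) (at p)"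
  shows "pole_condition Z col src v y t F"
  unfolding pole_condition_def Let_def
proof (intro conjI allI ballI exI hol)
  fix p i assume p: "p \<in> Z"
  then have Z: "finite Z" and pc: "p \<notin> contour" using dd by (auto simp: discrete_data_def)
  show "((\<lambda>z. (z - p) * F z $ i $ col p) \<longlongrightarrow> F p $ i $ src p * v p *
     exp (of_real y * (lam p $ src p - lam p $ col p) + of_real t * (inverse (lam p $ src p) - inverse (lam p $ col p)))) (at p)"
    by (rule lim[OF p])
  have hol': "(\<lambda>z. F z $ i $ col p) holomorphic_on (- (contour \<union> (Z - {p})) - {p})"
    by (rule holomorphic_on_subset[OF hol]) auto
  show "residue (\<lambda>z. F z $ i $ col p) p = F p $ i $ src p * v p *
     exp (of_real y * (lam p $ src p - lam p $ col p) + of_real t * (inverse (lam p $ src p) - inverse (lam p $ col p)))"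
    by (rule residue_simple'[OF offcontour_open _ hol']) (use Z pc lim[OF p, of i] in \<open>auto simp: mult.commute\<close>)
qed

text \<open>The jump factor has determinant 1, so the one-sided limits of the determinant agree on
  the contour. At a pole the residue is a multiple of another column, so the determinant stays
  finite. The limit \<open>L\<close> is left general because the result is applied to matrices with
  mixed rows, whose limits at infinity are singular off the diagonal case.\<close>

proposition det_no_jump:
  assumes dd: "discrete_data Z col src"
    and S: "\<And>k s. k < 3 \<Longrightarrow> s \<noteq> 0 \<Longrightarrow> det (S (of_real s * omega ^ k)) = 1"
    and jump: "jump_condition S y t B" and pole: "pole_condition Z col src v y t B"
    and zero: "(B \<longlongrightarrow> B0) (at 0 within - contour)"
    and inf: "(B \<longlongrightarrow> L) (inf at_infinity (principal (- contour)))"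
    and z: "z \<notin> contour \<union> Z"
  shows "det (B z) = det L"
proof (rule liouville_off_contour[OF _ _ _ tendsto_det_3[OF inf] z])
  show Z: "finite Z" using dd by (simp add: discrete_data_def)
  have hol: "(\<lambda>z. B z $ i $ l) holomorphic_on - (contour \<union> {p \<in> Z. col p = l})" for i l
    using pole by (simp add: pole_condition_def)
  have hol': "(\<lambda>z. B z $ i $ l) holomorphic_on - (contour \<union> Z)" for i l
    by (rule holomorphic_on_subset[OF hol]) auto
  show "(\<lambda>z. det (B z)) holomorphic_on - (contour \<union> Z)"
    unfolding det_3 by (intro holomorphic_intros hol')
  fix w assume w: "w \<in> contour \<union> Z"
  show "\<exists>c. ((\<lambda>z. det (B z)) \<longlongrightarrow> c) (at w within - (contour \<union> Z))"
  proof (cases "w \<in> Z")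
    case True
    define l where "l = col w"
    define j where "j = src w"
    have jl: "l \<noteq> j" and wc: "w \<notin> contour" using True dd by (auto simp: discrete_data_def l_def j_def)
    define T where "T = - (contour \<union> (Z - {w}))"
    have oT: "open T" unfolding T_def using Z by (intro offcontour_open) auto
    have wT: "w \<in> T" using wc by (simp add: T_def)
    have T: "T - {w} = - (contour \<union> Z)" using True wc by (auto simp: T_def)
    define c where "c = v w * exp (of_real y * (lam w $ j - lam w $ l)
                                 + of_real t * (inverse (lam w $ j) - inverse (lam w $ l)))"
    have res: "((\<lambda>z. (z - w) * B z $ i $ l) \<longlongrightarrow> B w $ i $ j * c) (at w)" for i
      using pole_condition_tendsto[OF dd pole True, of i] by (simp add: l_def j_def c_def mult.assoc)
    have cont: "((\<lambda>z. B z $ i $ k) \<longlongrightarrow> B w $ i $ k) (at w)" if "k \<noteq> l" for i k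
    proof -
      have "(\<lambda>z. B z $ i $ k) holomorphic_on T"
        by (rule holomorphic_on_subset[OF hol]) (use that in \<open>auto simp: T_def l_def\<close>)
      then show ?thesis
        using oT wT by (metis holomorphic_on_imp_continuous_on continuous_on_eq_continuous_at isCont_def)
    qed
    \<comment> \<open>The residue condition says precisely that \<open>(z - w) * H i z\<close> tends
      to 0, so the corrected column has a removable singularity; the correction does not change the
      determinant.\<close>
    define H where "H i z = B z $ i $ l - c / (z - w) * B z $ i $ j" for i z
    have "\<exists>d. (H i \<longlongrightarrow> d) (at w)" for i
    proof -
      have "((\<lambda>z. (z - w) * B z $ i $ l - c * B z $ i $ j) \<longlongrightarrow> B w $ i $ j * c - c * B w $ i $ j) (at w)"
        using jl by (intro tendsto_intros res cont) auto
      then have "((\<lambda>z. (z - w) * B z $ i $ l - c * B z $ i $ j) \<longlongrightarrow> 0) (at w)"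
        by (simp add: mult.commute)
      then have lim: "((\<lambda>z. (z - w) * H i z) \<longlongrightarrow> 0) (at w)"
        by (rule Lim_transform_eventually) (auto simp: eventually_at_filter H_def right_diff_distrib intro!: always_eventually)
      have "H i holomorphic_on (T - {w})"
        unfolding H_def T by (intro holomorphic_intros hol') (use True in auto)
      then obtain g where g: "g holomorphic_on T" "\<And>z. z \<in> T - {w} \<Longrightarrow> g z = H i z"
        using holomorphic_on_extend_lim[of "H i" T w] lim oT wT by (auto simp: interior_open)
      have "(g \<longlongrightarrow> g w) (at w)"
        using g(1) oT wT by (metis holomorphic_on_imp_continuous_on continuous_on_eq_continuous_at isCont_def)
      moreover have "\<forall>\<^sub>F z in at w. g z = H i z"
        using oT wT g(2) by (auto simp: eventually_at_topological)
      ultimately show ?thesis using Lim_transform_eventually by blast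
    qed
    then obtain d where d: "\<And>i. (H i \<longlongrightarrow> d i) (at w)" by metis
    have "((\<lambda>z. det (\<chi> i k. if k = l then H i z else B z $ i $ k)) \<longlongrightarrow>
           det (\<chi> i k. if k = l then d i else B w $ i $ k)) (at w)"
      by (intro tendsto_det_3 vec_tendstoI) (use d cont in auto)
    then have "((\<lambda>z. det (B z)) \<longlongrightarrow> det (\<chi> i k. if k = l then d i else B w $ i $ k)) (at w)"
      unfolding H_def det_column_operation_3[OF jl] .
    then show ?thesis using Lim_at_imp_Lim_at_within by blast
  next
    case False
    then obtain k s where k: "k < 3" and ws: "w = of_real s * omega ^ k"
      using w unfolding contour_def by blast
    have "\<exists>c. ((\<lambda>z. det (B z)) \<longlongrightarrow> c) (at w within - contour)"
    proof (cases "s = 0")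
      case True
      then show ?thesis using tendsto_det_3[OF zero] ws by auto
    next
      case s: False
      obtain Bp Bm where
        p: "(B \<longlongrightarrow> Bp) (at w within {u. Im (u / omega ^ k) > 0})" and
        m: "(B \<longlongrightarrow> Bm) (at w within {u. Im (u / omega ^ k) < 0})" and
        e: "Bp = Bm ** expQ y t w ** S w ** expQ (- y) (- t) w"
        using jump k s unfolding jump_condition_def ws Let_def by blast
      have "det Bp = det Bm"
        unfolding e det_expQ_conj using S[OF k s] by (simp add: ws)
      then show ?thesis
        using tendsto_offcontour_sides[OF k s ws tendsto_det_3[OF p]] tendsto_det_3[OF m] by auto
    qed
    then show ?thesis
      by (rule ex_forward, elim tendsto_within_subset) auto
  qed
qed

text \<open>Rows are exchanged rather than columns because jump and residue relations act from the
  right, that is, on each row separately: a matrix with rows from two solutions satisfies them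
  again.\<close>

definition replace_row :: "3 \<Rightarrow> 3 \<Rightarrow> complex^3^3 \<Rightarrow> complex^3^3 \<Rightarrow> complex^3^3" where
  "replace_row i j A B = (\<chi> r. if r = j then A $ i else B $ r)"

lemma replace_row_mult: "replace_row i j (A ** V) (B ** V) = replace_row i j A B ** V"
  by (simp add: replace_row_def matrix_matrix_mult_def vec_eq_iff)

lemma tendsto_replace_row:
  assumes "(f \<longlongrightarrow> A) F" "(g \<longlongrightarrow> B) F"
  shows "((\<lambda>x. replace_row i j (f x) (g x)) \<longlongrightarrow> replace_row i j A B) F"
  unfolding replace_row_def
  by (rule vec_tendstoI) (auto intro!: tendsto_vec_nth assms)

text \<open>Cramer's rule: divided by \<open>det B\<close>, these determinants are the coefficients
  of row \<open>i\<close> of \<open>A\<close> in terms of the rows of \<open>B\<close>.\<close>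

lemma replace_row_expand:
  "(\<Sum>j\<in>UNIV. det (replace_row i j A B) * B $ j $ l) = det B * A $ i $ l"
  using exhaust_3[of l]
  by (auto simp: sum_3 det_3 replace_row_def algebra_simps)

lemma rh_solution_tendsto_infinity:
  assumes "rh_solution S Z col src v y t F"
  shows "(F \<longlongrightarrow> mat 1) (inf at_infinity (principal (- contour)))"
proof (intro vec_tendstoI)
  fix i j
  have "((\<lambda>z. 1 / z) \<longlongrightarrow> (0::complex)) (inf at_infinity (principal (- contour)))"
    by (rule tendsto_mono[OF inf_le1]) (simp add: divide_inverse tendsto_inverse_0)
  then have lim: "((\<lambda>z. c * norm (1 / z)) \<longlongrightarrow> 0) (inf at_infinity (principal (- contour)))" for c
    by (intro tendsto_mult_right_zero tendsto_norm_zero)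
  have "(\<lambda>z. F z $ i $ j - mat 1 $ i $ j) \<in> O[inf at_infinity (principal (- contour))](\<lambda>z. 1 / z)"
    using assms by (simp add: rh_solution_def)
  then obtain c where "\<forall>\<^sub>F z in inf at_infinity (principal (- contour)).
      norm (F z $ i $ j - mat 1 $ i $ j) \<le> c * norm (1 / z)"
    by (elim landau_o.bigE)
  then have "((\<lambda>z. F z $ i $ j - mat 1 $ i $ j) \<longlongrightarrow> 0) (inf at_infinity (principal (- contour)))"
    by (rule Lim_null_comparison[OF _ lim])
  then show "((\<lambda>z. F z $ i $ j) \<longlongrightarrow> mat 1 $ i $ j) (inf at_infinity (principal (- contour)))"
    by (simp add: LIM_zero_iff)
qed

text \<open>This is the argument that F G^-1 is entire and tends to I, without inverses: the entries
  of F adj(G) are determinants of \<open>G\<close> with one row taken from \<open>F\<close>, and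
  each of them is constant by \<open>det_no_jump\<close>.\<close>

theorem rh_solution_unique:
  assumes dd: "discrete_data Z col src"
    and S: "\<And>k s. k < 3 \<Longrightarrow> s \<noteq> 0 \<Longrightarrow> det (S (of_real s * omega ^ k)) = 1"
    and F: "rh_solution S Z col src v y t F" and G: "rh_solution S Z col src v y t G"
    and z: "z \<notin> contour \<union> Z"
  shows "F z = G z"
proof -
  obtain F0 G0 where zero: "(F \<longlongrightarrow> F0) (at 0 within - contour)" "(G \<longlongrightarrow> G0) (at 0 within - contour)"
    using F G unfolding rh_solution_def by blast
  have jump: "jump_condition S y t F" "jump_condition S y t G"
    and pole: "pole_condition Z col src v y t F" "pole_condition Z col src v y t G"
    using F G unfolding rh_solution_def by auto
  have *: "det (replace_row i j (F z) (G z)) = det (replace_row i j (mat 1) (mat 1))" for i j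
  proof (rule det_no_jump[where B = "\<lambda>z. replace_row i j (F z) (G z)", OF dd])
    show "((\<lambda>z. replace_row i j (F z) (G z)) \<longlongrightarrow> replace_row i j F0 G0) (at 0 within - contour)"
      by (intro tendsto_replace_row zero)
    show "((\<lambda>z. replace_row i j (F z) (G z)) \<longlongrightarrow> replace_row i j (mat 1) (mat 1))
            (inf at_infinity (principal (- contour)))"
      by (intro tendsto_replace_row rh_solution_tendsto_infinity[OF F] rh_solution_tendsto_infinity[OF G])
    show "jump_condition S y t (\<lambda>z. replace_row i j (F z) (G z))"
      unfolding jump_condition_def Let_def
    proof (intro allI impI)
      fix k :: nat and s :: real assume ks: "k < 3" "s \<noteq> 0"
      let ?w = "of_real s * omega ^ k" 
      obtain Fp Fm where F:
        "(F \<longlongrightarrow> Fp) (at ?w within {u. Im (u / omega ^ k) > 0})"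
        "(F \<longlongrightarrow> Fm) (at ?w within {u. Im (u / omega ^ k) < 0})"
        "Fp = Fm ** expQ y t ?w ** S ?w ** expQ (- y) (- t) ?w"
        using jump(1) ks unfolding jump_condition_def Let_def by blast
      obtain Gp Gm where G:
        "(G \<longlongrightarrow> Gp) (at ?w within {u. Im (u / omega ^ k) > 0})"
        "(G \<longlongrightarrow> Gm) (at ?w within {u. Im (u / omega ^ k) < 0})"
        "Gp = Gm ** expQ y t ?w ** S ?w ** expQ (- y) (- t) ?w"
        using jump(2) ks unfolding jump_condition_def Let_def by blast
      show "\<exists>Fplus Fminus.
          ((\<lambda>z. replace_row i j (F z) (G z)) \<longlongrightarrow> Fplus) (at ?w within {u. Im (u / omega ^ k) > 0}) \<and>
          ((\<lambda>z. replace_row i j (F z) (G z)) \<longlongrightarrow> Fminus) (at ?w within {u. Im (u / omega ^ k) < 0}) \<and>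
          Fplus = Fminus ** expQ y t ?w ** S ?w ** expQ (- y) (- t) ?w"
        by (intro exI[of _ "replace_row i j Fp Gp"] exI[of _ "replace_row i j Fm Gm"] conjI tendsto_replace_row F G)
          (simp only: F G replace_row_mult)
    qed
    show "pole_condition Z col src v y t (\<lambda>z. replace_row i j (F z) (G z))"
      unfolding pole_condition_def Let_def
    proof (intro conjI allI ballI)
      fix r l
      show "(\<lambda>z. replace_row i j (F z) (G z) $ r $ l) holomorphic_on - (contour \<union> {p \<in> Z. col p = l})"
        by (cases "r = j") (use pole in \<open>auto simp: replace_row_def pole_condition_def\<close>)
    next
      fix p r assume "p \<in> Z"
      then show "\<exists>c. ((\<lambda>z. (z - p) * replace_row i j (F z) (G z) $ r $ col p) \<longlongrightarrow> c) (at p)"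
        "residue (\<lambda>z. replace_row i j (F z) (G z) $ r $ col p) p = replace_row i j (F p) (G p) $ r $ src p * v p *
          exp (of_real y * (lam p $ src p - lam p $ col p) + of_real t * (inverse (lam p $ src p) - inverse (lam p $ col p)))"
        by (cases "r = j"; use pole in \<open>simp add: replace_row_def pole_condition_def Let_def\<close>)+
    qed
  qed (use z S in auto)
  have mat: "det (replace_row i j (mat 1) (mat 1)) = (if i = j then 1 else 0)" for i j
    using exhaust_3[of i] exhaust_3[of j] by (auto simp: det_3 replace_row_def mat_def)
  have "det (G z) = det (mat 1 :: complex^3^3)"
    by (rule det_no_jump[OF dd _ jump(2) pole(2) zero(2) rh_solution_tendsto_infinity[OF G]]) (use z S in auto)
  then have "F z $ i $ l = (\<Sum>j\<in>UNIV. det (replace_row i j (F z) (G z)) * G z $ j $ l)" for i l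
    unfolding replace_row_expand by simp
  then have "F z $ i $ l = (\<Sum>j\<in>UNIV. (if i = j then 1 else 0) * G z $ j $ l)" for i l
    unfolding * mat by simp
  then have "F z $ i $ l = G z $ i $ l" for i l
    by (simp add: if_distrib[of "\<lambda>x. x * _"] cong: if_cong)
  then show ?thesis by (simp add: vec_eq_iff)
qed

section \<open>Cyclic linear systems and zero curvature\<close>

text \<open>The variable upper limit is moved into the integrand. Freezing the argument after time
  \<open>t\<close> by \<open>min s t\<close> gives an integral over the fixed interval
  \<open>{0..T}\<close>, which exceeds the wanted one by
  \<open>(T - t) *\<^sub>R g y t\<close>.\<close>

lemma continuous_on_integral_upper:
  fixes g :: "real \<Rightarrow> real \<Rightarrow> 'a::banach"
  assumes g: "continuous_on (S \<times> {0..T}) (\<lambda>(y, s). g y s)"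
  shows "continuous_on (S \<times> {0..T}) (\<lambda>(y, t). integral {0..t} (g y))"
proof -
  have 1: "continuous_on ((S \<times> {0..T}) \<times> cbox 0 T) (\<lambda>(p, s). g (fst p) (min s (snd p)))"
  proof -
    have "continuous_on ((S \<times> {0..T}) \<times> cbox 0 T)
        ((\<lambda>(y, s). g y s) \<circ> (\<lambda>p. (fst (fst p), min (snd p) (snd (fst p)))))"
      by (intro continuous_on_compose continuous_on_subset[OF g] continuous_intros) auto
    then show ?thesis by (simp add: o_def case_prod_unfold)
  qed
  have 2: "integral {0..t} (g y) = integral {0..T} (\<lambda>s. g y (min s t)) - (T - t) *\<^sub>R g y t"
    if "y \<in> S" "t \<in> {0..T}" for y t
  proof -
    have gy: "continuous_on {0..T} (g y)"
    proof -
      have "continuous_on {0..T} ((\<lambda>(y, s). g y s) \<circ> (\<lambda>s. (y, s)))"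
        using that by (intro continuous_on_compose continuous_on_subset[OF g] continuous_intros) auto
      then show ?thesis by (simp add: o_def)
    qed
    have "continuous_on {0..T} (g y \<circ> (\<lambda>s. min s t))"
      using that by (intro continuous_on_compose continuous_intros continuous_on_subset[OF gy]) auto
    then have "(\<lambda>s. g y (min s t)) integrable_on {0..T}"
      by (intro integrable_continuous_real) (simp add: o_def)
    then have "integral {0..T} (\<lambda>s. g y (min s t))
      = integral {0..t} (\<lambda>s. g y (min s t)) + integral {t..T} (\<lambda>s. g y (min s t))"
      using that by (intro Henstock_Kurzweil_Integration.integral_combine[symmetric]) auto
    also have "integral {0..t} (\<lambda>s. g y (min s t)) = integral {0..t} (g y)"
      by (intro integral_cong) auto
    also have "integral {t..T} (\<lambda>s. g y (min s t)) = integral {t..T} (\<lambda>s. g y t)"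
      by (intro integral_cong) auto
    finally show ?thesis using that by simp
  qed
  have "continuous_on (S \<times> {0..T}) (\<lambda>p. integral (cbox 0 T) (\<lambda>s. g (fst p) (min s (snd p))) - (T - snd p) *\<^sub>R g (fst p) (snd p))"
    using g by (intro continuous_intros integral_continuous_on_param[OF 1]) (simp add: case_prod_unfold)
  then show ?thesis
    by (rule continuous_on_eq) (auto simp: 2)
qed

text \<open>The Taylor coefficients in \<open>\<zeta>\<close> of the solution of \<open>x\<^sub>i' = \<zeta> k\<^sub>i x\<^sub>i\<^sub>-\<^sub>1\<close>, \<open>x\<^sub>i(0) = c\<^sub>i\<close>, with
  cyclic indices \<open>i :: 3\<close> and a parameter \<open>y\<close>.\<close>

primrec cyclic_coeff ::
    "(3 \<Rightarrow> real \<Rightarrow> real \<Rightarrow> real) \<Rightarrow> (3 \<Rightarrow> complex) \<Rightarrow> nat \<Rightarrow> 3 \<Rightarrow> real \<Rightarrow> real \<Rightarrow> complex" where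
  "cyclic_coeff k c 0 i y t = c i"
| "cyclic_coeff k c (Suc n) i y t = integral {0..t} (\<lambda>s. of_real (k i y s) * cyclic_coeff k c n (i - 1) y s)"

definition cyclic_solution ::
    "(3 \<Rightarrow> real \<Rightarrow> real \<Rightarrow> real) \<Rightarrow> (3 \<Rightarrow> complex) \<Rightarrow> 3 \<Rightarrow> complex \<Rightarrow> real \<Rightarrow> real \<Rightarrow> complex" where
  "cyclic_solution k c i \<zeta> y t = (\<Sum>n. \<zeta> ^ n * cyclic_coeff k c n i y t)"

lemma power_fact_has_integral:
  fixes K t :: real
  assumes "t \<ge> 0"
  shows "((\<lambda>s. K * ((K * s) ^ n / fact n)) has_integral (K * t) ^ Suc n / fact (Suc n)) {0..t}"
proof -
  have "((\<lambda>s. (K * s) ^ Suc n / fact (Suc n)) has_real_derivative K * ((K * s) ^ n / fact n)) (at s within {0..t})" for s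
  proof -
    have "((\<lambda>s. (K * s) ^ Suc n) has_real_derivative of_nat (Suc n) * (K * (K * s) ^ n)) (at s within {0..t})"
      by (rule derivative_eq_intros refl)+ simp
    from DERIV_cdivide[OF this, of "fact (Suc n)"] show ?thesis
      by (simp del: of_nat_Suc power_Suc)
  qed
  then have "((\<lambda>s. K * ((K * s) ^ n / fact n)) has_integral (K * t) ^ Suc n / fact (Suc n) - (K * 0) ^ Suc n / fact (Suc n)) {0..t}"
    using assms by (intro fundamental_theorem_of_calculus) (auto simp: has_real_derivative_iff_has_vector_derivative)
  then show ?thesis by simp
qed

text \<open>With \<open>K \<ge> 1\<close> the bound also dominates the constant coefficient 1, so
  the same majorant serves when the system is compared with the one in which all coefficients equal
  1.\<close>

locale cyclic_ode =
  fixes k :: "3 \<Rightarrow> real \<Rightarrow> real \<Rightarrow> real" and c :: "3 \<Rightarrow> complex" and K T :: real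
  assumes K: "K \<ge> 1" and T: "T \<ge> 0"
    and k_cont: "\<And>i. continuous_on (UNIV \<times> {0..T}) (\<lambda>(y, t). k i y t)"
    and k_bound: "\<And>i y t. t \<in> {0..T} \<Longrightarrow> \<bar>k i y t\<bar> \<le> K"
    and c_bound: "\<And>i. norm (c i) \<le> 1"
begin

abbreviation "A \<equiv> cyclic_coeff k c"
abbreviation "X \<equiv> cyclic_solution k c"

lemma coeff_cont: "continuous_on (UNIV \<times> {0..T}) (\<lambda>(y, t). A n i y t)"
proof (induction n arbitrary: i)
  case (Suc n)
  have "continuous_on (UNIV \<times> {0..T}) (\<lambda>(y, s). of_real (k i y s) * A n (i - 1) y s)"
    using k_cont[of i] Suc[of "i - 1"] by (auto simp: case_prod_unfold intro!: continuous_intros)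
  then show ?case
    using continuous_on_integral_upper[of UNIV T "\<lambda>y s. of_real (k i y s) * A n (i - 1) y s"] by simp
qed (simp add: case_prod_unfold)

lemma slice_cont:
  assumes "continuous_on (UNIV \<times> {0..T}) (\<lambda>(y, t). f y t)" "t \<le> T"
  shows "continuous_on {0..t} (f y)"
proof -
  have "continuous_on {0..t} ((\<lambda>(y, s). f y s) \<circ> (\<lambda>s. (y, s)))"
    using assms(2) by (intro continuous_on_compose continuous_on_subset[OF assms(1)] continuous_intros) auto
  then show ?thesis by (simp add: o_def)
qed

lemma term_cont: "t \<le> T \<Longrightarrow> continuous_on {0..t} (\<lambda>s. of_real (k i y s) * A n j y s)"
  using slice_cont[OF k_cont[of i], of t y] slice_cont[OF coeff_cont[of n j], of t y]
  by (intro continuous_intros)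

lemma coeff_bound: "t \<in> {0..T} \<Longrightarrow> norm (A n i y t) \<le> (K * t) ^ n / fact n"
proof (induction n arbitrary: i t)
  case (Suc n)
  have "norm (A (Suc n) i y t) \<le> integral {0..t} (\<lambda>s. K * ((K * s) ^ n / fact n))"
    unfolding cyclic_coeff.simps
  proof (rule integral_norm_bound_integral)
    fix s assume s: "s \<in> {0..t}"
    have "norm (A n (i - 1) y s) \<le> (K * s) ^ n / fact n" "\<bar>k i y s\<bar> \<le> K"
      using s Suc.prems by (auto intro!: Suc.IH k_bound)
    then show "norm (of_real (k i y s) * A n (i - 1) y s) \<le> K * ((K * s) ^ n / fact n)"
      using K unfolding norm_mult norm_of_real by (intro mult_mono) auto
  next
    show "(\<lambda>s. K * ((K * s) ^ n / fact n)) integrable_on {0..t}"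
      using Suc.prems power_fact_has_integral[of t K n] by (auto simp: integrable_on_def)
  qed (use Suc.prems in \<open>auto intro!: integrable_continuous_real term_cont\<close>)
  also have "\<dots> = (K * t) ^ Suc n / fact (Suc n)"
    using Suc.prems by (intro integral_unique power_fact_has_integral) auto
  finally show ?case .
qed (simp add: c_bound)

definition maj :: "complex \<Rightarrow> nat \<Rightarrow> real" where
  "maj \<zeta> n = (norm \<zeta> * (K * T)) ^ n / fact n"

lemma maj_sums: "maj \<zeta> sums exp (norm \<zeta> * (K * T))"
  unfolding maj_def using exp_converges[of "norm \<zeta> * (K * T)"] by (simp add: divide_inverse mult.commute)

lemma coeff_bound': "t \<in> {0..T} \<Longrightarrow> norm (A n i y t) \<le> (K * T) ^ n / fact n"
proof -
  assume t: "t \<in> {0..T}"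
  then have "(K * t) ^ n \<le> (K * T) ^ n"
    using K by (intro power_mono mult_left_mono) auto
  then show ?thesis
    using coeff_bound[OF t, of n i y] by (simp add: divide_right_mono order_trans)
qed

lemma term_bound: "t \<in> {0..T} \<Longrightarrow> norm (\<zeta> ^ n * A n i y t) \<le> maj \<zeta> n"
  using mult_left_mono[OF coeff_bound', of t "norm \<zeta> ^ n" n i y]
  by (simp add: maj_def norm_mult norm_power power_mult_distrib)

lemma term_sums: "t \<in> {0..T} \<Longrightarrow> (\<lambda>n. \<zeta> ^ n * A n i y t) sums X i \<zeta> y t"
  unfolding cyclic_solution_def
  by (intro summable_sums summable_comparison_test'[OF sums_summable[OF maj_sums[of \<zeta>]], of 0] term_bound)

lemma solution_bound: "t \<in> {0..T} \<Longrightarrow> norm (X i \<zeta> y t) \<le> exp (norm \<zeta> * (K * T))"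
  unfolding cyclic_solution_def sums_unique[OF maj_sums]
  by (intro norm_suminf_le term_bound sums_summable[OF maj_sums])

lemma solution_uniform:
  "uniform_limit (UNIV \<times> {0..T}) (\<lambda>n p. \<Sum>m<n. \<zeta> ^ m * A m i (fst p) (snd p))
     (\<lambda>p. X i \<zeta> (fst p) (snd p)) sequentially"
  unfolding cyclic_solution_def
  by (rule Weierstrass_m_test[OF _ sums_summable[OF maj_sums]]) (auto intro!: term_bound)

lemma solution_cont: "continuous_on (UNIV \<times> {0..T}) (\<lambda>(y, t). X i \<zeta> y t)"
proof -
  have "continuous_on (UNIV \<times> {0..T}) (\<lambda>p. X i \<zeta> (fst p) (snd p))"
    using coeff_cont
    by (intro uniform_limit_theorem[OF _ solution_uniform] always_eventually allI continuous_intros)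
      (auto simp: case_prod_unfold)
  then show ?thesis by (simp add: case_prod_unfold)
qed

text \<open>Uniform convergence on the interval allows integration term by term, and the recursion
  for the coefficients raises the power of \<zeta> by one; the constant term supplies the initial
  value.\<close>

lemma solution_integral:
  assumes t: "t \<in> {0..T}"
  shows "X i \<zeta> y t = c i + \<zeta> * integral {0..t} (\<lambda>s. of_real (k i y s) * X (i - 1) \<zeta> y s)"
proof -
  have u0: "uniform_limit {0..t} (\<lambda>n s. \<Sum>m<n. \<zeta> ^ m * (of_real (k i y s) * A m (i - 1) y s))
     (\<lambda>s. suminf (\<lambda>m. \<zeta> ^ m * (of_real (k i y s) * A m (i - 1) y s))) sequentially"
  proof (rule Weierstrass_m_test)
    show "summable (\<lambda>n. K * maj \<zeta> n)"
      by (intro summable_mult sums_summable[OF maj_sums])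
    fix n s assume "s \<in> {0..t}"
    then have s: "s \<in> {0..T}" using t by auto
    have "norm (of_real (k i y s) :: complex) * norm (\<zeta> ^ n * A n (i - 1) y s) \<le> K * maj \<zeta> n"
      using K k_bound[OF s, of i y] by (intro mult_mono term_bound s) auto
    then show "norm (\<zeta> ^ n * (of_real (k i y s) * A n (i - 1) y s)) \<le> K * maj \<zeta> n"
      by (simp add: norm_mult ac_simps)
  qed
  have h: "suminf (\<lambda>m. \<zeta> ^ m * (of_real (k i y s) * A m (i - 1) y s)) = of_real (k i y s) * X (i - 1) \<zeta> y s"
    if "s \<in> {0..t}" for s
  proof -
    have "(\<lambda>m. of_real (k i y s) * (\<zeta> ^ m * A m (i - 1) y s)) sums (of_real (k i y s) * X (i - 1) \<zeta> y s)"
      using that t by (intro sums_mult term_sums) auto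
    then show ?thesis by (simp add: sums_iff mult.left_commute)
  qed
  have u: "uniform_limit {0..t} (\<lambda>n s. \<Sum>m<n. \<zeta> ^ m * (of_real (k i y s) * A m (i - 1) y s))
     (\<lambda>s. of_real (k i y s) * X (i - 1) \<zeta> y s) sequentially"
    by (rule iffD1[OF uniform_limit_cong'[OF refl h] u0])
  have cm: "continuous_on {0..t} (\<lambda>s. \<zeta> ^ m * (of_real (k i y s) * A m (i - 1) y s))" for m
    using t by (intro continuous_on_mult_left term_cont) auto
  obtain I J where
    I: "\<And>n. ((\<lambda>s. \<Sum>m<n. \<zeta> ^ m * (of_real (k i y s) * A m (i - 1) y s)) has_integral I n) {0..t}" and
    J: "((\<lambda>s. of_real (k i y s) * X (i - 1) \<zeta> y s) has_integral J) {0..t}" and IJ: "I \<longlonglongrightarrow> J"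
    by (rule uniform_limit_integral[OF u]) (use cm in \<open>auto intro!: continuous_on_sum\<close>)
  have "I = (\<lambda>n. \<Sum>m<n. \<zeta> ^ m * A (Suc m) i y t)"
  proof
    fix n
    have "I n = integral {0..t} (\<lambda>s. \<Sum>m<n. \<zeta> ^ m * (of_real (k i y s) * A m (i - 1) y s))"
      using I by (rule integral_unique[symmetric])
    also have "\<dots> = (\<Sum>m<n. integral {0..t} (\<lambda>s. \<zeta> ^ m * (of_real (k i y s) * A m (i - 1) y s)))"
      using cm by (intro integral_sum) (auto intro!: integrable_continuous_real)
    finally show "I n = (\<Sum>m<n. \<zeta> ^ m * A (Suc m) i y t)" by simp
  qed
  with IJ have "(\<lambda>m. \<zeta> ^ m * A (Suc m) i y t) sums J" by (simp add: sums_def)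
  then have "(\<lambda>m. \<zeta> * (\<zeta> ^ m * A (Suc m) i y t)) sums (\<zeta> * J)" by (rule sums_mult)
  then have "(\<lambda>n. \<zeta> ^ n * A n i y t) sums (\<zeta> * J + c i)"
    using sums_Suc[of "\<lambda>n. \<zeta> ^ n * A n i y t" "\<zeta> * J"] by (simp add: mult.assoc)
  then have "X i \<zeta> y t = \<zeta> * J + c i" using term_sums[OF t] sums_unique2 by blast
  then show ?thesis using J by (simp add: integral_unique)
qed

lemma solution_initial: "X i \<zeta> y 0 = c i"
  using solution_integral[of 0 i \<zeta> y] T by simp

lemma solution_deriv:
  assumes t: "t \<in> {0..T}"
  shows "((\<lambda>t. X i \<zeta> y t) has_vector_derivative \<zeta> * (of_real (k i y t) * X (i - 1) \<zeta> y t)) (at t within {0..T})"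
proof -
  have "continuous_on {0..T} (\<lambda>s. of_real (k i y s) * X (i - 1) \<zeta> y s)"
    using slice_cont[OF k_cont[of i], of T y] slice_cont[OF solution_cont[of "i - 1" \<zeta>], of T y]
    by (intro continuous_intros) auto
  then have "((\<lambda>t. integral {0..t} (\<lambda>s. of_real (k i y s) * X (i - 1) \<zeta> y s)) has_vector_derivative
      of_real (k i y t) * X (i - 1) \<zeta> y t) (at t within {0..T})"
    by (rule integral_has_vector_derivative[OF _ t])
  then have "((\<lambda>t. c i + \<zeta> * integral {0..t} (\<lambda>s. of_real (k i y s) * X (i - 1) \<zeta> y s)) has_vector_derivative
      \<zeta> * (of_real (k i y t) * X (i - 1) \<zeta> y t)) (at t within {0..T})"
    by (auto intro!: derivative_eq_intros)
  then show ?thesis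
    by (rule has_vector_derivative_transform[OF t _, rotated]) (use solution_integral in auto)
qed

lemma solution_holomorphic:
  assumes "t \<in> {0..T}"
  shows "(\<lambda>\<zeta>. X i \<zeta> y t) holomorphic_on UNIV"
proof -
  have "(\<lambda>\<zeta>. X i \<zeta> y t) holomorphic_on ball 0 (norm w + 1)" for w :: complex
    by (rule power_series_holomorphic[where a = "\<lambda>n. A n i y t"])
      (use term_sums[OF assms] in \<open>auto simp: mult.commute\<close>)
  then have "(\<lambda>\<zeta>. X i \<zeta> y t) field_differentiable at w" for w
    using holomorphic_on_imp_differentiable_at[of "\<lambda>\<zeta>. X i \<zeta> y t" "ball 0 (norm w + 1)" w] by simp
  then show ?thesis by (simp add: holomorphic_on_def)
qed

text \<open>With \<zeta> = 1/z this becomes the normalization of the propagator as \<open>z\<close>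
  tends to infinity, with a constant independent of \<open>y\<close>.\<close>

lemma solution_near_zero:
  assumes t: "t \<in> {0..T}" and z: "norm \<zeta> \<le> 1"
  shows "norm (X i \<zeta> y t - c i) \<le> norm \<zeta> * (K * T * exp (K * T))"
proof -
  have KT: "K * T \<ge> 0" using K T by simp
  have b: "norm (of_real (k i y s) * X (i - 1) \<zeta> y s) \<le> K * exp (K * T)" if "s \<in> cbox 0 t" for s
  proof -
    have s: "s \<in> {0..T}" using that t by auto
    have "norm (X (i - 1) \<zeta> y s) \<le> exp (norm \<zeta> * (K * T))" by (rule solution_bound[OF s])
    also have "\<dots> \<le> exp (K * T)" using KT mult_right_mono[OF z KT] by simp
    finally show ?thesis
      using k_bound[OF s, of i y] K by (simp add: norm_mult mult_mono)
  qed
  have "continuous_on {0..t} (\<lambda>s. of_real (k i y s) * X (i - 1) \<zeta> y s)"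
    using t slice_cont[OF k_cont[of i], of t y] slice_cont[OF solution_cont[of "i - 1" \<zeta>], of t y]
    by (intro continuous_intros) auto
  then have int: "((\<lambda>s. of_real (k i y s) * X (i - 1) \<zeta> y s) has_integral
      integral {0..t} (\<lambda>s. of_real (k i y s) * X (i - 1) \<zeta> y s)) (cbox 0 t)"
    using integrable_continuous_real by (auto simp: has_integral_integral)
  have "norm (integral {0..t} (\<lambda>s. of_real (k i y s) * X (i - 1) \<zeta> y s)) \<le> K * exp (K * T) * Henstock_Kurzweil_Integration.content (cbox 0 t)"
    by (rule has_integral_bound[OF _ int b]) (use K in auto)
  also have "\<dots> \<le> K * exp (K * T) * T" using t K by (intro mult_left_mono) auto
  finally have "norm (integral {0..t} (\<lambda>s. of_real (k i y s) * X (i - 1) \<zeta> y s)) \<le> K * T * exp (K * T)"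
    by (simp add: mult_ac)
  from mult_left_mono[OF this norm_ge_zero[of \<zeta>]] show ?thesis
    unfolding solution_integral[OF t] by (simp add: norm_mult)
qed

text \<open>For coefficients close to \<open>1\<close> the solution is close to the exponential of the cyclic shift.\<close>

lemma coeff_near_shift:
  assumes \<mu>: "norm \<mu> = 1" "\<And>i. c (i - 1) = \<mu> * c i"
    and \<epsilon>: "\<And>i s. s \<in> {0..T} \<Longrightarrow> \<bar>k i y s - 1\<bar> \<le> \<epsilon>"
  shows "t \<in> {0..T} \<Longrightarrow> norm (A n i y t - c i * (\<mu> * of_real t) ^ n / fact n) \<le> \<epsilon> * (of_nat n * ((K * t) ^ n / fact n))"
proof (induction n arbitrary: i t)
  case (Suc n)
  let ?g = "\<lambda>s. c (i - 1) * (\<mu> * of_real s) ^ n / fact n"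
  have e0: "\<epsilon> \<ge> 0" using \<epsilon>[of 0 1] T by force
  have "((\<lambda>s. c i * (\<mu> * of_real s) ^ Suc n / fact (Suc n)) has_vector_derivative ?g s) (at s within {0..t})" for s
  proof -
    have "((\<lambda>s. c i * (\<mu> * s) ^ Suc n) has_field_derivative of_nat (Suc n) * (c (i - 1) * (\<mu> * of_real s) ^ n)) (at (of_real s))"
      by (rule derivative_eq_intros refl)+ (simp add: \<mu>(2))
    from DERIV_cdivide[OF this, of "fact (Suc n)"]
    have "((\<lambda>s. c i * (\<mu> * s) ^ Suc n / fact (Suc n)) has_field_derivative ?g s) (at (of_real s))"
      by (simp del: of_nat_Suc power_Suc)
    then show ?thesis
      using has_vector_derivative_real_field by blast
  qed
  then have g: "(?g has_integral c i * (\<mu> * of_real t) ^ Suc n / fact (Suc n) - c i * (\<mu> * of_real 0) ^ Suc n / fact (Suc n)) {0..t}"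
    using Suc.prems by (intro fundamental_theorem_of_calculus) auto
  have kA: "(\<lambda>s. of_real (k i y s) * A n (i - 1) y s) integrable_on {0..t}"
    using Suc.prems by (intro integrable_continuous_real term_cont) auto
  have "A (Suc n) i y t - c i * (\<mu> * of_real t) ^ Suc n / fact (Suc n)
      = integral {0..t} (\<lambda>s. of_real (k i y s) * A n (i - 1) y s - ?g s)"
    using Henstock_Kurzweil_Integration.integral_diff[OF kA has_integral_integrable[OF g]] integral_unique[OF g] by simp
  also have "norm \<dots> \<le> integral {0..t} (\<lambda>s. (\<epsilon> * (of_nat n + 1)) * (K * ((K * s) ^ n / fact n)))"
  proof (rule integral_norm_bound_integral)
    show "(\<lambda>s. of_real (k i y s) * A n (i - 1) y s - ?g s) integrable_on {0..t}"
      by (intro Henstock_Kurzweil_Integration.integrable_diff kA has_integral_integrable[OF g])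
    show "(\<lambda>s. (\<epsilon> * (of_nat n + 1)) * (K * ((K * s) ^ n / fact n))) integrable_on {0..t}"
      using Suc.prems by (intro integrable_on_mult_right has_integral_integrable[OF power_fact_has_integral]) auto
    fix s assume "s \<in> {0..t}"
    then have s: "s \<in> {0..T}" using Suc.prems by auto
    let ?m = "(K * s) ^ n / fact n"
    have m: "?m \<ge> 0" using s K by auto
    \<comment> \<open>One coefficient is replaced by 1 at the cost of \<epsilon>, the remaining
      \<open>n\<close> by induction. This is the origin of the factor \<open>n\<close> in the
      error.\<close>
    have "of_real (k i y s) * A n (i - 1) y s - ?g s = of_real (k i y s - 1) * A n (i - 1) y s + (A n (i - 1) y s - ?g s)"
      by (simp add: algebra_simps)
    also have "norm \<dots> \<le> \<epsilon> * ?m + \<epsilon> * (of_nat n * ?m)"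
    proof (rule order_trans[OF norm_triangle_ineq add_mono])
      show "norm (of_real (k i y s - 1) * A n (i - 1) y s) \<le> \<epsilon> * ?m"
        using \<epsilon>[OF s, of i] coeff_bound[OF s, of n "i - 1" y] e0
        unfolding norm_mult norm_of_real by (intro mult_mono) auto
    qed (rule Suc.IH[OF s])
    also have "\<dots> = (\<epsilon> * (of_nat n + 1)) * (1 * ?m)" by (simp add: algebra_simps add_divide_distrib)
    also have "\<dots> \<le> (\<epsilon> * (of_nat n + 1)) * (K * ?m)"
      using K m e0 by (intro mult_left_mono mult_right_mono) auto
    finally show "norm (of_real (k i y s) * A n (i - 1) y s - ?g s) \<le> (\<epsilon> * (of_nat n + 1)) * (K * ?m)" .
  qed
  also have "\<dots> = \<epsilon> * (of_nat n + 1) * ((K * t) ^ Suc n / fact (Suc n))"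
    using Suc.prems by (intro integral_unique has_integral_mult_right power_fact_has_integral) auto
  finally show ?case by (simp add: algebra_simps)
qed simp

text \<open>The hypothesis on \<open>c\<close> says that it is an eigenvector of the cyclic shift
  with eigenvalue \<mu>. The bound is linear in \<epsilon>, with a constant depending on \<zeta> but
  not on \<open>y\<close>, so it yields limits in \<open>y\<close> for fixed \<zeta>.\<close>

lemma solution_near_shift:
  assumes \<mu>: "norm \<mu> = 1" "\<And>i. c (i - 1) = \<mu> * c i"
    and \<epsilon>: "\<And>i s. s \<in> {0..T} \<Longrightarrow> \<bar>k i y s - 1\<bar> \<le> \<epsilon>" and t: "t \<in> {0..T}"
  shows "norm (X i \<zeta> y t - c i * exp (\<zeta> * \<mu> * of_real t)) \<le> \<epsilon> * (\<Sum>n. of_nat n * maj \<zeta> n)"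
proof -
  have e0: "\<epsilon> \<ge> 0" using \<epsilon>[of 0 1] T by force
  have sm: "summable (\<lambda>n. of_nat n * maj \<zeta> n)"
  proof -
    have "summable (\<lambda>n. norm \<zeta> * (K * T) * maj \<zeta> n)"
      by (intro summable_mult sums_summable[OF maj_sums])
    also have "(\<lambda>n. norm \<zeta> * (K * T) * maj \<zeta> n) = (\<lambda>n. of_nat (Suc n) * maj \<zeta> (Suc n))"
      by (auto simp: maj_def fact_Suc simp del: of_nat_Suc)
    finally show ?thesis by (rule summable_Suc_iff[THEN iffD1])
  qed
  have "(\<lambda>n. c i * ((\<zeta> * \<mu> * of_real t) ^ n / fact n)) sums (c i * exp (\<zeta> * \<mu> * of_real t))"
    using exp_converges[of "\<zeta> * \<mu> * of_real t"] by (intro sums_mult) (simp add: scaleR_conv_of_real field_simps)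
  then have sums: "(\<lambda>n. \<zeta> ^ n * A n i y t - c i * ((\<zeta> * \<mu> * of_real t) ^ n / fact n)) sums (X i \<zeta> y t - c i * exp (\<zeta> * \<mu> * of_real t))"
    by (intro sums_diff term_sums[OF t])
  have b: "norm (\<zeta> ^ n * A n i y t - c i * ((\<zeta> * \<mu> * of_real t) ^ n / fact n)) \<le> \<epsilon> * (of_nat n * maj \<zeta> n)" for n
  proof -
    have "\<zeta> ^ n * A n i y t - c i * ((\<zeta> * \<mu> * of_real t) ^ n / fact n) = \<zeta> ^ n * (A n i y t - c i * (\<mu> * of_real t) ^ n / fact n)"
      by (simp add: power_mult_distrib algebra_simps)
    also have "norm \<dots> \<le> norm \<zeta> ^ n * (\<epsilon> * (of_nat n * ((K * t) ^ n / fact n)))"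
      unfolding norm_mult norm_power by (intro mult_left_mono coeff_near_shift[OF assms]) auto
    also have "\<dots> \<le> norm \<zeta> ^ n * (\<epsilon> * (of_nat n * ((K * T) ^ n / fact n)))"
      using e0 t K by (intro mult_left_mono divide_right_mono power_mono) auto
    finally show ?thesis by (simp add: maj_def power_mult_distrib mult_ac)
  qed
  have "norm (X i \<zeta> y t - c i * exp (\<zeta> * \<mu> * of_real t)) \<le> (\<Sum>n. \<epsilon> * (of_nat n * maj \<zeta> n))"
    unfolding sums_unique[OF sums] by (rule norm_suminf_le[OF b summable_mult[OF sm]])
  then show ?thesis using suminf_mult[OF sm] by simp
qed

end

section \<open>Zero curvature\<close>

lemma continuous_on_slice1:
  assumes "continuous_on (UNIV \<times> I) (\<lambda>(y, t). f y t)" "t \<in> I"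
  shows "continuous_on S (\<lambda>y. f y t)"
proof -
  have "continuous_on S ((\<lambda>(y, t). f y t) \<circ> (\<lambda>y. (y, t)))"
    using assms(2) by (intro continuous_on_compose continuous_on_subset[OF assms(1)] continuous_intros) auto
  then show ?thesis by (simp add: o_def)
qed

lemma continuous_on_swap:
  assumes "continuous_on (A \<times> B) (\<lambda>(y, t). f y t)"
  shows "continuous_on (B \<times> A) (\<lambda>(t, y). f y t)"
proof -
  have "continuous_on (B \<times> A) ((\<lambda>(y, t). f y t) \<circ> prod.swap)"
    by (intro continuous_on_compose continuous_on_subset[OF assms] continuous_on_swap) auto
  then show ?thesis by (simp add: o_def case_prod_unfold)
qed

lemma (in bounded_bilinear) continuous_on_pair:
  assumes "continuous_on A (\<lambda>(y, t). f y t)" "continuous_on A (\<lambda>(y, t). g y t)"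
  shows "continuous_on A (\<lambda>(y, t). prod (f y t) (g y t))"
  using assms continuous_on[of A "\<lambda>p. f (fst p) (snd p)" "\<lambda>p. g (fst p) (snd p)"]
  by (simp add: case_prod_unfold)

lemma compact_bound:
  assumes "continuous_on (UNIV \<times> {0..T::real}) (\<lambda>(y, t). f y t)"
  obtains B where "\<And>y t. y \<in> {a..b::real} \<Longrightarrow> t \<in> {0..T} \<Longrightarrow> norm (f y t :: 'a::real_normed_vector) \<le> B" "B > 0"
proof -
  have "compact ((\<lambda>(y, t). f y t) ` ({a..b::real} \<times> {0..T::real}))"
    by (intro compact_continuous_image continuous_on_subset[OF assms] compact_Times) auto
  then obtain B where "B > 0" "\<forall>x\<in>(\<lambda>(y, t). f y t) ` ({a..b} \<times> {0..T}). norm x \<le> B"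
    using compact_imp_bounded bounded_pos by metis
  then show ?thesis by (intro that[of B]) auto
qed

text \<open>The defect \<open>W = \<Phi> - V\<close> satisfies the Volterra equation
  \<open>W\<^sub>t = N W - \<integral>\<^sub>a\<^sup>y N\<^sub>y W\<close> with zero initial data, so it vanishes; differentiability of \<open>\<Phi>\<close> in
  \<open>y\<close> for \<open>t > 0\<close> is a conclusion, not an assumption.\<close>

theorem zero_curvature:
  fixes act :: "'m::real_normed_vector \<Rightarrow> 'v::banach \<Rightarrow> 'v"
    and \<Phi> :: "real \<Rightarrow> real \<Rightarrow> 'v" and L L' N N' :: "real \<Rightarrow> real \<Rightarrow> 'm"
  assumes act: "bounded_bilinear act" 
    and \<Phi>: "continuous_on (UNIV \<times> {0..T}) (\<lambda>(y, t). \<Phi> y t)"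
    and L: "continuous_on (UNIV \<times> {0..T}) (\<lambda>(y, t). L y t)"
    and L': "continuous_on (UNIV \<times> {0..T}) (\<lambda>(y, t). L' y t)"
    and N: "continuous_on (UNIV \<times> {0..T}) (\<lambda>(y, t). N y t)"
    and N': "continuous_on (UNIV \<times> {0..T}) (\<lambda>(y, t). N' y t)"
    and \<Phi>_t: "\<And>y t. t \<in> {0..T} \<Longrightarrow>
      ((\<lambda>t. \<Phi> y t) has_vector_derivative act (N y t) (\<Phi> y t)) (at t within {0..T})"
    and L_t: "\<And>y t. t \<in> {0..T} \<Longrightarrow> ((\<lambda>t. L y t) has_vector_derivative L' y t) (at t within {0..T})"
    and N_y: "\<And>y t. t \<in> {0..T} \<Longrightarrow> ((\<lambda>y. N y t) has_vector_derivative N' y t) (at y)"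
    and compat: "\<And>y t v. t \<in> {0..T} \<Longrightarrow>
      act (L' y t) v + act (L y t) (act (N y t) v) = act (N' y t) v + act (N y t) (act (L y t) v)"
    and init: "\<And>y. ((\<lambda>y. \<Phi> y 0) has_vector_derivative act (L y 0) (\<Phi> y 0)) (at y)"
    and t: "t \<in> {0..T}"
  shows "((\<lambda>y. \<Phi> y t) has_vector_derivative act (L y t) (\<Phi> y t)) (at y)"
proof -
  interpret act: bounded_bilinear act by fact
  obtain C where C: "C > 0" "\<And>x v. norm (act x v) \<le> norm x * norm v * C"
    using act.pos_bounded by blast
  define a b where "a = y - 1" and "b = y + 1"
  define L\<Phi> where "L\<Phi> \<eta> s = act (L \<eta> s) (\<Phi> \<eta> s)" for \<eta> s
  \<comment> \<open>\<open>V\<close> solves the integrated space equation with the values of \<Phi>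
    at the left end \<open>a\<close>. Unlike \<Phi> it is differentiable in the space variable for
    trivial reasons.\<close>
  define V where "V \<eta> s = \<Phi> a s + integral {a..\<eta>} (\<lambda>\<eta>. L\<Phi> \<eta> s)" for \<eta> s
  define W where "W \<eta> s = \<Phi> \<eta> s - V \<eta> s" for \<eta> s
  have cL\<Phi>: "continuous_on (UNIV \<times> {0..T}) (\<lambda>(y, t). L\<Phi> y t)"
    unfolding L\<Phi>_def by (intro act.continuous_on_pair L \<Phi>)
  have V_y: "((\<lambda>\<eta>. V \<eta> s) has_vector_derivative L\<Phi> \<eta> s) (at \<eta> within {a..b})"
    if "s \<in> {0..T}" "\<eta> \<in> {a..b}" for s \<eta>
    unfolding V_def using that integral_has_vector_derivative[OF continuous_on_slice1[OF cL\<Phi> that(1)] that(2)]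
    by (auto intro!: derivative_eq_intros)
  have cV: "continuous_on {a..b} (\<lambda>\<eta>. V \<eta> s)" if "s \<in> {0..T}" for s
    using V_y[OF that] by (metis continuous_on_eq_continuous_within has_vector_derivative_continuous)
  have cW: "continuous_on {a..b} (\<lambda>\<eta>. W \<eta> s)" if "s \<in> {0..T}" for s
    unfolding W_def by (intro continuous_on_diff cV continuous_on_slice1[OF \<Phi>] that)
  have V_t: "((\<lambda>s. V \<eta> s) has_vector_derivative act (N \<eta> s) (V \<eta> s) + integral {a..\<eta>} (\<lambda>\<eta>. act (N' \<eta> s) (W \<eta> s)))
      (at s within {0..T})" if s: "s \<in> {0..T}" and \<eta>: "\<eta> \<in> {a..b}" for s \<eta>
  proof -
    \<comment> \<open>By compatibility this is also the time derivative of \<open>L\<Phi>\<close>.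
      In the present form it is the space derivative of \<open>act N V\<close> up to the term
      \<open>act N' W\<close>, so its integral produces the local term plus an integral of the
      defect.\<close>
    define D where "D \<eta> s = act (N' \<eta> s) (\<Phi> \<eta> s) + act (N \<eta> s) (L\<Phi> \<eta> s)" for \<eta> s
    have D: "D \<eta> s = act (L \<eta> s) (act (N \<eta> s) (\<Phi> \<eta> s)) + act (L' \<eta> s) (\<Phi> \<eta> s)" if "s \<in> {0..T}" for \<eta> s
      using compat[OF that, of \<eta> "\<Phi> \<eta> s"] by (simp add: D_def L\<Phi>_def add.commute)
    have cD: "continuous_on (UNIV \<times> {0..T}) (\<lambda>(y, t). D y t)"
      using act.continuous_on_pair[OF N' \<Phi>] act.continuous_on_pair[OF N cL\<Phi>]
      unfolding D_def case_prod_unfold by (intro continuous_on_add)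
    have "((\<lambda>s. integral (cbox a \<eta>) (\<lambda>\<eta>. L\<Phi> \<eta> s)) has_vector_derivative integral (cbox a \<eta>) (\<lambda>\<eta>. D \<eta> s)) (at s within {0..T})"
    proof (rule leibniz_rule_vector_derivative)
      show "((\<lambda>s. L\<Phi> \<xi> s) has_vector_derivative D \<xi> s) (at s within {0..T})" if "s \<in> {0..T}" for \<xi> s
        unfolding L\<Phi>_def D[OF that] by (rule act.has_vector_derivative[OF L_t[OF that] \<Phi>_t[OF that]])
      show "(\<lambda>\<eta>. L\<Phi> \<eta> s) integrable_on cbox a \<eta>" if "s \<in> {0..T}" for s
        using continuous_on_slice1[OF cL\<Phi> that] by (intro integrable_continuous)
      show "continuous_on ({0..T} \<times> cbox a \<eta>) (\<lambda>(s, \<eta>). D \<eta> s)"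
        by (rule continuous_on_subset[OF continuous_on_swap[OF cD]]) auto
    qed (use s in auto)
    then have 1: "((\<lambda>s. V \<eta> s) has_vector_derivative act (N a s) (\<Phi> a s) + integral {a..\<eta>} (\<lambda>\<eta>. D \<eta> s)) (at s within {0..T})"
      unfolding V_def by (intro has_vector_derivative_add \<Phi>_t s) simp
    have cs: "{a..\<eta>} \<subseteq> {a..b}" using \<eta> by auto
    have "((\<lambda>\<eta>. act (N \<eta> s) (L\<Phi> \<eta> s) + act (N' \<eta> s) (V \<eta> s)) has_integral act (N \<eta> s) (V \<eta> s) - act (N a s) (V a s)) {a..\<eta>}"
    proof (rule fundamental_theorem_of_calculus)
      fix \<xi> assume "\<xi> \<in> {a..\<eta>}"
      then have \<xi>: "\<xi> \<in> {a..b}" using cs by auto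
      show "((\<lambda>\<eta>. act (N \<eta> s) (V \<eta> s)) has_vector_derivative act (N \<xi> s) (L\<Phi> \<xi> s) + act (N' \<xi> s) (V \<xi> s)) (at \<xi> within {a..\<eta>})"
        by (rule has_vector_derivative_within_subset[OF act.has_vector_derivative cs]) 
          (intro has_vector_derivative_at_within[OF N_y] V_y s \<xi>)+
    qed (use \<eta> in auto)
    moreover have "((\<lambda>\<eta>. act (N' \<eta> s) (W \<eta> s)) has_integral integral {a..\<eta>} (\<lambda>\<eta>. act (N' \<eta> s) (W \<eta> s))) {a..\<eta>}"
      by (intro integrable_integral integrable_continuous_real act.continuous_on
            continuous_on_slice1[OF N' s] continuous_on_subset[OF cW[OF s] cs])
    ultimately have "((\<lambda>\<eta>. (act (N \<eta> s) (L\<Phi> \<eta> s) + act (N' \<eta> s) (V \<eta> s)) + act (N' \<eta> s) (W \<eta> s)) has_integral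
        (act (N \<eta> s) (V \<eta> s) - act (N a s) (V a s)) + integral {a..\<eta>} (\<lambda>\<eta>. act (N' \<eta> s) (W \<eta> s))) {a..\<eta>}"
      by (rule has_integral_add)
    also have "(\<lambda>\<eta>. (act (N \<eta> s) (L\<Phi> \<eta> s) + act (N' \<eta> s) (V \<eta> s)) + act (N' \<eta> s) (W \<eta> s)) = (\<lambda>\<eta>. D \<eta> s)"
      by (auto simp: W_def D_def act.diff_right)
    finally have "integral {a..\<eta>} (\<lambda>\<eta>. D \<eta> s) = (act (N \<eta> s) (V \<eta> s) - act (N a s) (V a s)) + integral {a..\<eta>} (\<lambda>\<eta>. act (N' \<eta> s) (W \<eta> s))"
      by (rule integral_unique)
    moreover have "V a s = \<Phi> a s" by (simp add: V_def)
    ultimately show ?thesis using 1 by simp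
  qed
  have W_t: "((\<lambda>s. W \<eta> s) has_vector_derivative act (N \<eta> s) (W \<eta> s) - integral {a..\<eta>} (\<lambda>\<eta>. act (N' \<eta> s) (W \<eta> s)))
      (at s within {0..T})" if s: "s \<in> {0..T}" and \<eta>: "\<eta> \<in> {a..b}" for s \<eta>
    using has_vector_derivative_diff[OF \<Phi>_t[OF s] V_t[OF s \<eta>]]
    unfolding W_def by (simp add: act.diff_right algebra_simps)
  have W0: "W \<eta> 0 = 0" if "\<eta> \<in> {a..b}" for \<eta>
  proof -
    have "((\<lambda>\<eta>. L\<Phi> \<eta> 0) has_integral \<Phi> \<eta> 0 - \<Phi> a 0) {a..\<eta>}"
      unfolding L\<Phi>_def using that
      by (intro fundamental_theorem_of_calculus has_vector_derivative_at_within[OF init]) auto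
    then show ?thesis by (simp add: W_def V_def integral_unique)
  qed
  obtain B1 where B1: "\<And>y t. y \<in> {a..b} \<Longrightarrow> t \<in> {0..T} \<Longrightarrow> norm (N y t) \<le> B1" "B1 > 0"
    by (rule compact_bound[OF N]) auto
  obtain B2 where B2: "\<And>y t. y \<in> {a..b} \<Longrightarrow> t \<in> {0..T} \<Longrightarrow> norm (N' y t) \<le> B2" "B2 > 0"
    by (rule compact_bound[OF N']) auto
  obtain B3 where B3: "\<And>y t. y \<in> {a..b} \<Longrightarrow> t \<in> {0..T} \<Longrightarrow> norm (\<Phi> y t) \<le> B3" "B3 > 0"
    by (rule compact_bound[OF \<Phi>]) auto
  obtain B4 where B4: "\<And>y t. y \<in> {a..b} \<Longrightarrow> t \<in> {0..T} \<Longrightarrow> norm (L\<Phi> y t) \<le> B4" "B4 > 0"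
    by (rule compact_bound[OF cL\<Phi>]) auto
  \<comment> \<open>One pass through the Volterra equation costs at most this factor: the local
    term, and the integral term over a distance of at most 2, the length of \<open>{a..b}\<close>.
    Iteration from the crude bound \<open>E\<close> gives the terms of an exponential series, which
    tend to 0.\<close>
  define R where "R = B1 * C + 2 * (B2 * C)"
  have R: "R > 0" using B1 B2 C by (simp add: R_def add_pos_pos)
  define E where "E = B3 + (B3 + 2 * B4)"
  have E: "E \<ge> 0" using B3 B4 by (simp add: E_def)
  have int_le: "norm (integral {a..\<eta>} f) \<le> 2 * M"
    if "\<eta> \<in> {a..b}" "continuous_on {a..\<eta>} f" "\<And>x. x \<in> {a..\<eta>} \<Longrightarrow> norm (f x) \<le> M" "M \<ge> 0" for f :: "real \<Rightarrow> 'v" and M \<eta>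
  proof -
    have "norm (integral {a..\<eta>} f) \<le> M * (\<eta> - a)"
      using that by (intro integral_bound) auto
    also have "\<dots> \<le> M * 2" using that by (intro mult_left_mono) (auto simp: a_def b_def)
    finally show ?thesis by simp
  qed
  have W_bound: "norm (W \<eta> s) \<le> E * ((R * s) ^ n / fact n)" if "s \<in> {0..T}" "\<eta> \<in> {a..b}" for s \<eta> n
    using that
  proof (induction n arbitrary: s \<eta>)
    case 0
    have "norm (integral {a..\<eta>} (\<lambda>\<eta>. L\<Phi> \<eta> s)) \<le> 2 * B4"
      using 0 B4 by (intro int_le continuous_on_slice1[OF cL\<Phi>]) auto
    then have "norm (V \<eta> s) \<le> B3 + 2 * B4"
      unfolding V_def using B3(1)[of a s] 0 by (intro order_trans[OF norm_triangle_ineq] add_mono) auto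
    then have "norm (W \<eta> s) \<le> B3 + (B3 + 2 * B4)"
      unfolding W_def using B3(1)[of \<eta> s] 0 by (intro order_trans[OF norm_triangle_ineq4] add_mono) auto
    then show ?case by (simp add: E_def)
  next
    case (Suc n)
    show ?case
    proof (cases "s = 0")
      case False
      let ?\<phi> = "\<lambda>r. E * ((R * r) ^ Suc n / fact (Suc n))"
      let ?\<phi>' = "\<lambda>r. R * (E * ((R * r) ^ n / fact n))"
      have d: "(?\<phi> has_vector_derivative ?\<phi>' r) (at r)" for r
      proof -
        have "((\<lambda>r. (R * r) ^ Suc n) has_real_derivative of_nat (Suc n) * (R * (R * r) ^ n)) (at r)"
          by (rule derivative_eq_intros refl)+ simp
        from DERIV_cmult[OF DERIV_cdivide[OF this, of "fact (Suc n)"], of E] show ?thesis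
          by (simp add: mult_ac has_real_derivative_iff_has_vector_derivative del: of_nat_Suc power_Suc)
      qed
      have "norm (W \<eta> s - W \<eta> 0) \<le> ?\<phi> s - ?\<phi> 0"
      proof (rule differentiable_bound_general[where f' = "\<lambda>r. act (N \<eta> r) (W \<eta> r) - integral {a..\<eta>} (\<lambda>\<xi>. act (N' \<xi> r) (W \<xi> r))"
            and \<phi>' = ?\<phi>'])
        show "0 < s" using False Suc.prems by auto
        show "continuous_on {0..s} (W \<eta>)"
          by (rule continuous_on_subset[of "{0..T}"])
            (use has_vector_derivative_continuous[OF W_t[OF _ Suc.prems(2)]] Suc.prems in
              \<open>auto simp: continuous_on_eq_continuous_within\<close>)
        show "continuous_on {0..s} ?\<phi>" by (intro continuous_intros) auto
        fix r assume r: "0 < r" "r < s"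
        then have rT: "r \<in> {0..T}" "0 < r" "r < T" using Suc.prems by auto
        show "(W \<eta> has_vector_derivative act (N \<eta> r) (W \<eta> r) - integral {a..\<eta>} (\<lambda>\<xi>. act (N' \<xi> r) (W \<xi> r))) (at r)"
          using W_t[OF rT(1) Suc.prems(2)] at_within_Icc_at[OF rT(2,3)] by simp
        show "(?\<phi> has_vector_derivative ?\<phi>' r) (at r)" by (rule d)
        let ?m = "E * ((R * r) ^ n / fact n)"
        have m: "?m \<ge> 0" using E R r by simp
        have 1: "norm (act (N \<xi> r) (W \<xi> r)) \<le> B1 * C * ?m" if "\<xi> \<in> {a..b}" for \<xi>
        proof -
          have "norm (act (N \<xi> r) (W \<xi> r)) \<le> norm (N \<xi> r) * norm (W \<xi> r) * C" by (rule C)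
          also have "\<dots> \<le> B1 * ?m * C"
            using Suc.IH[OF rT(1) that] B1(1)[OF that rT(1)] B1(2) C mult_nonneg_nonneg[OF less_imp_le[OF B1(2)] m]
            by (intro mult_mono) auto
          finally show ?thesis by (simp add: mult_ac)
        qed
        have 2: "norm (act (N' \<xi> r) (W \<xi> r)) \<le> B2 * C * ?m" if "\<xi> \<in> {a..b}" for \<xi>
        proof -
          have "norm (act (N' \<xi> r) (W \<xi> r)) \<le> norm (N' \<xi> r) * norm (W \<xi> r) * C" by (rule C)
          also have "\<dots> \<le> B2 * ?m * C"
            using Suc.IH[OF rT(1) that] B2(1)[OF that rT(1)] B2(2) C mult_nonneg_nonneg[OF less_imp_le[OF B2(2)] m]
            by (intro mult_mono) auto
          finally show ?thesis by (simp add: mult_ac)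
        qed
        have "norm (integral {a..\<eta>} (\<lambda>\<xi>. act (N' \<xi> r) (W \<xi> r))) \<le> 2 * (B2 * C * ?m)"
          using Suc.prems mult_nonneg_nonneg[OF mult_nonneg_nonneg[OF less_imp_le[OF B2(2)] less_imp_le[OF C(1)]] m]
          by (intro int_le 2 act.continuous_on continuous_on_slice1[OF N' rT(1)] continuous_on_subset[OF cW[OF rT(1)]]) auto
        then have "norm (act (N \<eta> r) (W \<eta> r) - integral {a..\<eta>} (\<lambda>\<xi>. act (N' \<xi> r) (W \<xi> r))) \<le> B1 * C * ?m + 2 * (B2 * C * ?m)"
          by (intro order_trans[OF norm_triangle_ineq4] add_mono 1 Suc.prems)
        then show "norm (act (N \<eta> r) (W \<eta> r) - integral {a..\<eta>} (\<lambda>\<xi>. act (N' \<xi> r) (W \<xi> r))) \<le> ?\<phi>' r"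
          by (simp add: R_def algebra_simps add_divide_distrib)
      qed
      then show ?thesis using W0[OF Suc.prems(2)] by simp
    qed (use W0 Suc.prems in simp)
  qed
  have "W \<eta> t = 0" if "\<eta> \<in> {a..b}" for \<eta>
  proof -
    have "(\<lambda>n. E * ((R * t) ^ n / fact n)) \<longlonglongrightarrow> E * 0"
      using summable_LIMSEQ_zero[OF summable_exp[of "R * t"]] by (intro tendsto_mult) (auto simp: divide_inverse mult.commute)
    then have "norm (W \<eta> t) \<le> E * 0"
      by (rule LIMSEQ_le_const) (use W_bound[OF t that] in auto)
    then show ?thesis by simp
  qed
  then have V\<Phi>: "V \<eta> t = \<Phi> \<eta> t" if "\<eta> \<in> {a..b}" for \<eta> using that by (simp add: W_def)
  have "((\<lambda>\<eta>. V \<eta> t) has_vector_derivative L\<Phi> y t) (at y within {a..b})"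
    using V_y[OF t, of y] by (simp add: a_def b_def)
  then have "((\<lambda>\<eta>. \<Phi> \<eta> t) has_vector_derivative L\<Phi> y t) (at y within {a..b})"
    by (rule has_vector_derivative_transform[rotated 2]) (auto simp: V\<Phi> a_def b_def)
  moreover have "at y within {a..b} = at y"
    by (rule at_within_Icc_at) (auto simp: a_def b_def)
  ultimately show ?thesis by (simp add: L\<Phi>_def)
qed

section \<open>The solution and its characteristics\<close>

lemma at_within_atLeastAtMost_atLeast:
  fixes t T :: real
  assumes "0 \<le> t" "t < T"
  shows "at t within {0..T} = at t within {0..}"
  using assms by (intro at_within_nhd[of t "{..<T}"]) auto

lemma has_dx: "(\<lambda>\<xi>. f \<xi> t) differentiable (at x) \<Longrightarrow> ((\<lambda>\<xi>. f \<xi> t) has_real_derivative dx f x t) (at x)"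
  unfolding dx_def by (metis DERIV_deriv_iff_real_differentiable)

lemma has_dt:
  assumes "(\<lambda>\<tau>. f x \<tau>) differentiable (at t within {0..})"
  shows "((\<lambda>\<tau>. f x \<tau>) has_real_derivative dt f x t) (at t within {0..})"
  unfolding dt_def has_real_derivative_iff_has_vector_derivative
  using assms vector_derivative_works by blast

text \<open>At t = 0 the time derivative is one-sided. The function is therefore recovered from
  \<open>g\<close> by integration in time, differentiated in space under the integral sign, and
  differentiated back in time by the fundamental theorem.\<close>

lemma mixed_partials:
  fixes f g :: "real \<Rightarrow> real \<Rightarrow> real"
  assumes g: "\<And>x t. t \<ge> 0 \<Longrightarrow> ((\<lambda>\<tau>. f x \<tau>) has_real_derivative g x t) (at t within {0..})"
    and g_cont: "continuous_on (UNIV \<times> {0..}) (\<lambda>(x, t). g x t)"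
    and fx: "\<And>x t. t \<ge> 0 \<Longrightarrow> ((\<lambda>\<xi>. f \<xi> t) has_real_derivative f' x t) (at x)"
    and gx: "\<And>x t. t \<ge> 0 \<Longrightarrow> ((\<lambda>\<xi>. g \<xi> t) has_real_derivative g' x t) (at x)"
    and g'_cont: "continuous_on (UNIV \<times> {0..}) (\<lambda>(x, t). g' x t)"
    and t: "t \<ge> 0"
  shows "((\<lambda>\<tau>. f' x \<tau>) has_real_derivative g' x t) (at t within {0..})"
proof -
  have slice: "continuous_on {0..\<tau>} (h x)"
    if "continuous_on (UNIV \<times> {0..}) (\<lambda>(x, t). h x t)" for h :: "real \<Rightarrow> real \<Rightarrow> real" and x \<tau>
  proof -
    have "continuous_on {0..\<tau>} ((\<lambda>(x, t). h x t) \<circ> (\<lambda>t. (x, t)))"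
      by (intro continuous_on_compose continuous_on_subset[OF that] continuous_intros) auto
    then show ?thesis by (simp add: o_def)
  qed
  have eq: "f' x \<tau> = f' x 0 + integral {0..\<tau>} (g' x)" if \<tau>: "\<tau> \<ge> 0" for \<tau>
  proof -
    have I: "f x \<tau> = f x 0 + integral {0..\<tau>} (g x)" for x
    proof -
      have "(g x has_integral f x \<tau> - f x 0) {0..\<tau>}"
      proof (rule fundamental_theorem_of_calculus)
        fix s assume "s \<in> {0..\<tau>}"
        then have "((\<lambda>\<tau>. f x \<tau>) has_vector_derivative g x s) (at s within {0..})"
          using g by (auto simp: has_real_derivative_iff_has_vector_derivative)
        then show "(f x has_vector_derivative g x s) (at s within {0..\<tau>})"
          by (rule has_vector_derivative_within_subset) auto
      qed (use \<tau> in auto)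
      then show ?thesis by (simp add: integral_unique)
    qed
    have "((\<lambda>x. integral (cbox 0 \<tau>) (g x)) has_real_derivative integral (cbox 0 \<tau>) (g' x)) (at x within UNIV)"
    proof (rule leibniz_rule_field_derivative)
      show "((\<lambda>x. g x s) has_real_derivative g' x s) (at x within UNIV)" if "s \<in> cbox 0 \<tau>" for x s
        using that gx by auto
      show "g x integrable_on cbox 0 \<tau>" for x
        unfolding cbox_interval by (intro integrable_continuous_real slice[OF g_cont])
      show "continuous_on (UNIV \<times> cbox 0 \<tau>) (\<lambda>(x, t). g' x t)"
        by (rule continuous_on_subset[OF g'_cont]) auto
    qed auto
    then have "((\<lambda>x. f x 0 + integral {0..\<tau>} (g x)) has_real_derivative f' x 0 + integral {0..\<tau>} (g' x)) (at x)"
      using fx[of 0 x] by (intro DERIV_add) auto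
    then have "((\<lambda>x. f x \<tau>) has_real_derivative f' x 0 + integral {0..\<tau>} (g' x)) (at x)"
      using I by simp
    then show ?thesis using fx[OF \<tau>] DERIV_unique by blast
  qed
  have "((\<lambda>\<tau>. integral {0..\<tau>} (g' x)) has_vector_derivative g' x t) (at t within {0..t+1})"
    by (rule integral_has_vector_derivative[OF slice[OF g'_cont]]) (use t in auto)
  then have "((\<lambda>\<tau>. integral {0..\<tau>} (g' x)) has_real_derivative g' x t) (at t within {0..})"
    using t at_within_atLeastAtMost_atLeast[of t "t + 1"]
    by (simp add: has_real_derivative_iff_has_vector_derivative)
  then have "((\<lambda>\<tau>. f' x 0 + integral {0..\<tau>} (g' x)) has_real_derivative 0 + g' x t) (at t within {0..})"
    by (rule DERIV_add[OF DERIV_const])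
  then have "((\<lambda>\<tau>. f' x \<tau>) has_real_derivative 0 + g' x t) (at t within {0..})"
    by (rule has_field_derivative_transform_within[OF _ zero_less_one]) (use t in \<open>simp_all add: eq[symmetric]\<close>)
  then show ?thesis by simp
qed

text \<open>Continuity of one partial derivative together with existence of the other at the point
  gives a total derivative within the half-plane, which is then composed with the curve.\<close>

lemma chain_rule_halfplane:
  fixes f fx :: "real \<Rightarrow> real \<Rightarrow> real"
  assumes x: "\<And>x t. t \<ge> 0 \<Longrightarrow> ((\<lambda>\<xi>. f \<xi> t) has_real_derivative fx x t) (at x)"
    and fx_cont: "continuous_on (UNIV \<times> {0..}) (\<lambda>(x, t). fx x t)"
    and t: "((\<lambda>\<tau>. f (X t) \<tau>) has_real_derivative ft) (at t within {0..})"
    and X: "(X has_real_derivative X') (at t within {0..})" and t0: "t \<ge> 0"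
  shows "((\<lambda>\<tau>. f (X \<tau>) \<tau>) has_real_derivative fx (X t) t * X' + ft) (at t within {0..})"
proof -
  have "((\<lambda>(\<tau>, \<xi>). f \<xi> \<tau>) has_derivative (\<lambda>(a, b). ft * a + blinfun_mult_left (fx (X t) t) b)) (at (t, X t) within {0..} \<times> UNIV)"
  proof (rule has_derivative_partialsI)
    show "((\<lambda>\<tau>. f (X t) \<tau>) has_derivative (\<lambda>h. ft * h)) (at t within {0..})"
      using t by (simp add: has_field_derivative_def)
    show "((\<lambda>\<xi>. f \<xi> \<tau>) has_derivative blinfun_apply (blinfun_mult_left (fx \<xi> \<tau>))) (at \<xi> within UNIV)"
      if "\<tau> \<in> {0..}" for \<tau> \<xi>
      using x[of \<tau> \<xi>] that by (simp add: has_field_derivative_def mult.commute[of _ "fx \<xi> \<tau>"] blinfun_mult_left.rep_eq)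
    have "continuous (at (t, X t) within {0..} \<times> UNIV) (\<lambda>(\<tau>, \<xi>). fx \<xi> \<tau>)"
      using continuous_on_swap[OF fx_cont] t0 by (auto simp: continuous_on_eq_continuous_within)
    then show "continuous (at (t, X t) within {0..} \<times> UNIV) (\<lambda>(\<tau>, \<xi>). blinfun_mult_left (fx \<xi> \<tau>))"
      unfolding continuous_within case_prod_unfold
      by (intro bounded_linear.tendsto[OF bounded_linear_blinfun_mult_left]) auto
  qed (use t0 in auto)
  then have "((\<lambda>(\<tau>, \<xi>). f \<xi> \<tau>) has_derivative (\<lambda>(a, b). ft * a + blinfun_mult_left (fx (X t) t) b))
      (at ((\<lambda>\<tau>. (\<tau>, X \<tau>)) t) within (\<lambda>\<tau>. (\<tau>, X \<tau>)) ` {0..})"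
    by (auto intro: has_derivative_subset)
  moreover have "((\<lambda>\<tau>. (\<tau>, X \<tau>)) has_derivative (\<lambda>h. (h, X' * h))) (at t within {0..})"
    using X by (intro has_derivative_Pair has_derivative_ident) (simp add: has_field_derivative_def)
  ultimately have "((\<lambda>(\<tau>, \<xi>). f \<xi> \<tau>) \<circ> (\<lambda>\<tau>. (\<tau>, X \<tau>)) has_derivative
      (\<lambda>(a, b). ft * a + blinfun_mult_left (fx (X t) t) b) \<circ> (\<lambda>h. (h, X' * h))) (at t within {0..})"
    by (intro diff_chain_within)
  moreover have "(\<lambda>(a, b). ft * a + blinfun_mult_left (fx (X t) t) b) \<circ> (\<lambda>h. (h, X' * h)) = (\<lambda>h. (fx (X t) t * X' + ft) * h)"
    by (auto simp: blinfun_mult_left.rep_eq algebra_simps)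
  ultimately show ?thesis
    by (simp add: has_field_derivative_def o_def)
qed

section \<open>Integrable decay weights\<close>

definition decay_weight :: "real \<Rightarrow> real \<Rightarrow> real" where
  "decay_weight p x = (1 + \<bar>x\<bar>) powr (- p)"

text \<open>The odd antiderivative of \<open>decay_weight p\<close>. For p > 1 it runs from -1/(p -
  1) to 1/(p - 1); this makes the integrals over half-lines explicit and provides a bounded
  comparison function for the differential equations below.\<close>

definition weight_primitive :: "real \<Rightarrow> real \<Rightarrow> real" where
  "weight_primitive p x = sgn x * ((1 - (1 + \<bar>x\<bar>) powr (1 - p)) / (p - 1))"

lemma decay_weight_pos [simp]: "decay_weight p x > 0"
  by (simp add: decay_weight_def)

lemma decay_weight_nonneg [simp]: "decay_weight p x \<ge> 0"
  by (simp add: decay_weight_def)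

lemma continuous_decay_weight: "continuous_on S (decay_weight p)"
  unfolding decay_weight_def by (intro continuous_intros) auto

lemma decay_weight_le_one: "p > 0 \<Longrightarrow> decay_weight p x \<le> 1"
  unfolding decay_weight_def using powr_mono[of "-p" 0 "1 + \<bar>x\<bar>"] by (simp split: if_splits)

lemma decay_weight_at_top: "p > 0 \<Longrightarrow> (decay_weight p \<longlongrightarrow> 0) at_top"
  unfolding decay_weight_def
  by (rule tendsto_neg_powr) (auto intro!: filterlim_tendsto_add_at_top[OF tendsto_const] filterlim_abs_real)

lemma decay_weight_minus: "decay_weight p (- x) = decay_weight p x"
  by (simp add: decay_weight_def)

lemma decay_weight_at_bot: "p > 0 \<Longrightarrow> (decay_weight p \<longlongrightarrow> 0) at_bot"
  unfolding filterlim_at_bot_mirror decay_weight_minus by (rule decay_weight_at_top)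

context
  fixes p :: real assumes p: "p > 1"
begin

lemma weight_primitive_bound: "\<bar>weight_primitive p x\<bar> \<le> 1 / (p - 1)"
proof -
  have "(1 + \<bar>x\<bar>) powr (1 - p) \<le> 1"
    using powr_mono[of "1 - p" 0 "1 + \<bar>x\<bar>"] p by (simp split: if_splits)
  moreover have "(1 + \<bar>x\<bar>) powr (1 - p) \<ge> 0" by simp
  ultimately have "\<bar>(1 - (1 + \<bar>x\<bar>) powr (1 - p)) / (p - 1)\<bar> \<le> 1 / (p - 1)"
    using p by (simp add: divide_right_mono)
  then show ?thesis
    using p unfolding weight_primitive_def abs_mult by (cases "x = 0") (auto simp: abs_sgn_eq)
qed

lemma weight_primitive_deriv: "(weight_primitive p has_real_derivative decay_weight p x) (at x)"
proof -
  define g where "g r = (1 - (1 + r) powr (1 - p)) / (p - 1)" for r :: real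
  have g: "(g has_real_derivative (1 + r) powr (- p)) (at r)" if "r > -1" for r
  proof -
    have "((\<lambda>r. (1 + r) powr (1 - p)) has_real_derivative (1 - p) * (1 + r) powr (1 - p - 1)) (at r)"
      using that by (auto intro!: derivative_eq_intros)
    then have "((\<lambda>r. (1 + r) powr (1 - p)) has_real_derivative (1 - p) * (1 + r) powr (- p)) (at r)" by simp
    from DERIV_cdivide[OF DERIV_diff[OF DERIV_const this], of 1 "p - 1"]
    have "(g has_real_derivative (0 - (1 - p) * (1 + r) powr (- p)) / (p - 1)) (at r)"
      unfolding g_def .
    also have "0 - (1 - p) * (1 + r) powr (- p) = (p - 1) * (1 + r) powr (- p)"
      by (simp add: algebra_simps)
    finally show ?thesis using p by simp
  qed
  have w: "weight_primitive p x = sgn x * g \<bar>x\<bar>" for x by (simp add: weight_primitive_def g_def)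
  consider "x > 0" | "x < 0" | "x = 0" by linarith
  then show ?thesis
  proof cases
    case 1
    have "(g has_real_derivative decay_weight p x) (at x)"
      using g[of x] 1 by (simp add: decay_weight_def)
    then show ?thesis
      by (rule has_field_derivative_transform_within_open[where S = "{0<..}"]) (use 1 in \<open>auto simp: w\<close>)
  next
    case 2
    have "(g has_real_derivative decay_weight p x) (at (- x))"
      using g[of "- x"] 2 by (simp add: decay_weight_def)
    then have "((\<lambda>x. g (- x)) has_real_derivative decay_weight p x * - 1) (at x)"
      by (rule DERIV_chain2) (auto intro!: derivative_eq_intros)
    from DERIV_minus[OF this] have "((\<lambda>x. - g (- x)) has_real_derivative decay_weight p x) (at x)"
      by simp
    then show ?thesis
      by (rule has_field_derivative_transform_within_open[where S = "{..<0}"]) (use 2 in \<open>auto simp: w\<close>)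
  next
    \<comment> \<open>At the origin the sign function jumps while \<open>g\<close> vanishes; the
      difference quotient of the odd extension at \<open>h\<close> is that of \<open>g\<close> at
      \<open>\<bar>h\<bar>\<close>.\<close>
    case 3
    have "(g has_real_derivative 1) (at 0)" using g[of 0] by simp
    then have lim: "((\<lambda>h. g h / h) \<longlongrightarrow> 1) (at 0)"
      by (simp add: has_field_derivative_iff g_def)
    have "((\<lambda>h. weight_primitive p h / h) \<longlongrightarrow> 1) (at 0)"
    proof (rule Lim_transform_eventually)
      show "((\<lambda>h. g \<bar>h\<bar> / \<bar>h\<bar>) \<longlongrightarrow> 1) (at 0)"
        by (rule filterlim_compose[OF lim]) (auto simp: filterlim_at eventually_at_filter intro!: tendsto_eq_intros)
      show "\<forall>\<^sub>F h in at 0. g \<bar>h\<bar> / \<bar>h\<bar> = weight_primitive p h / h"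
        by (auto simp: eventually_at_filter w sgn_if)
    qed
    then show ?thesis using 3 by (simp add: has_field_derivative_iff weight_primitive_def decay_weight_def)
  qed
qed

lemma weight_primitive_at_top: "(weight_primitive p \<longlongrightarrow> 1 / (p - 1)) at_top"
proof -
  have "((\<lambda>x. (1 + \<bar>x\<bar>) powr (1 - p)) \<longlongrightarrow> 0) at_top"
    using p decay_weight_at_top[of "p - 1"] unfolding decay_weight_def by simp
  then have "((\<lambda>x. (1 - (1 + \<bar>x\<bar>) powr (1 - p)) / (p - 1)) \<longlongrightarrow> (1 - 0) / (p - 1)) at_top"
    using p by (intro tendsto_intros) auto
  then have "((\<lambda>x. (1 - (1 + \<bar>x\<bar>) powr (1 - p)) / (p - 1)) \<longlongrightarrow> 1 / (p - 1)) at_top" by simp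
  then show ?thesis
    by (rule Lim_transform_eventually)
      (use eventually_gt_at_top[of 0] in \<open>eventually_elim; simp add: weight_primitive_def\<close>)
qed

lemma weight_primitive_minus: "weight_primitive p (- x) = - weight_primitive p x"
  by (simp add: weight_primitive_def)

lemma weight_primitive_at_bot: "(weight_primitive p \<longlongrightarrow> - (1 / (p - 1))) at_bot"
  unfolding filterlim_at_bot_mirror weight_primitive_minus
  by (intro tendsto_minus weight_primitive_at_top)

lemma weight_integral:
  "set_integrable lborel (einterval (ereal x) \<infinity>) (decay_weight p)"
  "(LBINT \<xi>=ereal x..\<infinity>. decay_weight p \<xi>) = 1 / (p - 1) - weight_primitive p x"
  "set_integrable lborel (einterval (-\<infinity>) (ereal x)) (decay_weight p)"
  "(LBINT \<xi>=-\<infinity>..ereal x. decay_weight p \<xi>) = weight_primitive p x + 1 / (p - 1)"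
proof -
  have c: "isCont (decay_weight p) y" for y
    using continuous_decay_weight[of UNIV p] by (simp add: continuous_on_eq_continuous_at)
  have i: "isCont (weight_primitive p) x"
    using weight_primitive_deriv DERIV_isCont by blast
  have r: "((weight_primitive p \<circ> real_of_ereal) \<longlongrightarrow> weight_primitive p x) (at_right (ereal x))"
    "((weight_primitive p \<circ> real_of_ereal) \<longlongrightarrow> weight_primitive p x) (at_left (ereal x))"
    using i by (auto simp: ereal_tendsto_simps1 isCont_def intro: Lim_at_imp_Lim_at_within)
  have l: "((weight_primitive p \<circ> real_of_ereal) \<longlongrightarrow> 1 / (p - 1)) (at_left \<infinity>)"
    "((weight_primitive p \<circ> real_of_ereal) \<longlongrightarrow> - (1 / (p - 1))) (at_right (-\<infinity>))"
    using weight_primitive_at_top weight_primitive_at_bot by (auto simp: ereal_tendsto_simps1)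
  show "set_integrable lborel (einterval (ereal x) \<infinity>) (decay_weight p)"
    "(LBINT \<xi>=ereal x..\<infinity>. decay_weight p \<xi>) = 1 / (p - 1) - weight_primitive p x"
    by (rule interval_integral_FTC_nonneg[OF _ weight_primitive_deriv c _ r(1) l(1)]; simp)+
  show "set_integrable lborel (einterval (-\<infinity>) (ereal x)) (decay_weight p)"
    using interval_integral_FTC_nonneg(1)[OF _ weight_primitive_deriv c _ l(2) r(2)] by simp
  show "(LBINT \<xi>=-\<infinity>..ereal x. decay_weight p \<xi>) = weight_primitive p x + 1 / (p - 1)"
    using interval_integral_FTC_nonneg(2)[OF _ weight_primitive_deriv c _ l(2) r(2)] by simp
qed

lemma weighted_integral_bound:
  fixes f :: "real \<Rightarrow> 'a::{banach, second_countable_topology}"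
  assumes f: "set_integrable lborel E f" and E: "E = einterval (ereal x) \<infinity> \<or> E = einterval (-\<infinity>) (ereal x)"
    and b: "\<And>\<xi>. \<xi> \<in> E \<Longrightarrow> norm (f \<xi>) \<le> C * decay_weight p \<xi>"
  shows "norm (LBINT \<xi>:E. f \<xi>) \<le> C * (LBINT \<xi>:E. decay_weight p \<xi>)"
proof -
  have w: "set_integrable lborel E (decay_weight p)" using E weight_integral by auto
  have "norm (LBINT \<xi>:E. f \<xi>) \<le> (LBINT \<xi>:E. norm (f \<xi>))"
    by (rule set_integral_norm_bound[OF f])
  also have "\<dots> \<le> (LBINT \<xi>:E. C * decay_weight p \<xi>)"
    by (rule set_integral_mono[OF set_integrable_norm[OF f]]) (use w b in auto)
  finally show ?thesis by simp
qed

lemma right_integral_bound: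
  fixes f :: "real \<Rightarrow> 'a::{banach, second_countable_topology}"
  assumes "set_integrable lborel (einterval (ereal x) \<infinity>) f"
    and "\<And>\<xi>. \<xi> > x \<Longrightarrow> norm (f \<xi>) \<le> C * decay_weight p \<xi>"
  shows "norm (LBINT \<xi>=ereal x..\<infinity>. f \<xi>) \<le> C * (1 / (p - 1) - weight_primitive p x)"
  using weighted_integral_bound[OF assms(1), of x C] assms(2) weight_integral(2)[of x]
  by (simp add: interval_lebesgue_integral_def einterval_def)

lemma left_integral_bound:
  fixes f :: "real \<Rightarrow> 'a::{banach, second_countable_topology}"
  assumes "set_integrable lborel (einterval (-\<infinity>) (ereal x)) f"
    and "\<And>\<xi>. \<xi> < x \<Longrightarrow> norm (f \<xi>) \<le> C * decay_weight p \<xi>"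
  shows "norm (LBINT \<xi>=-\<infinity>..ereal x. f \<xi>) \<le> C * (weight_primitive p x + 1 / (p - 1))"
  using weighted_integral_bound[OF assms(1), of x C] assms(2) weight_integral(4)[of x]
  by (simp add: interval_lebesgue_integral_def einterval_def)

lemma weighted_integrable_right:
  fixes f :: "real \<Rightarrow> real"
  assumes "continuous_on UNIV f" "\<And>\<xi>. \<bar>f \<xi>\<bar> \<le> C * decay_weight p \<xi>"
  shows "set_integrable lborel (einterval (ereal x) \<infinity>) f"
proof (rule set_integrable_bound)
  show "set_integrable lborel (einterval (ereal x) \<infinity>) (\<lambda>\<xi>. C * decay_weight p \<xi>)"
    using weight_integral(1) by simp
  show "set_borel_measurable lborel (einterval (ereal x) \<infinity>) f"
    unfolding set_borel_measurable_def
    using borel_measurable_continuous_onI[OF assms(1)] by simp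
  show "AE \<xi> in lborel. \<xi> \<in> einterval (ereal x) \<infinity> \<longrightarrow> norm (f \<xi>) \<le> norm (C * decay_weight p \<xi>)"
    using assms(2) by (auto intro!: always_eventually order_trans[OF _ abs_ge_self])
qed

lemma tail_integral_deriv:
  fixes f :: "real \<Rightarrow> real"
  assumes f: "continuous_on UNIV f" "\<And>\<xi>. \<bar>f \<xi>\<bar> \<le> C * decay_weight p \<xi>"
  shows "((\<lambda>x. LBINT \<xi>=ereal x..\<infinity>. f \<xi>) has_real_derivative - f x) (at x)"
proof -
  define a where "a = x - 1"
  define F where "F x = (LBINT \<xi>=ereal x..\<infinity>. f \<xi>)" for x
  have eq: "F x = F a - integral {a..x} f" if "a \<le> x" for x
  proof -
    have "(LBINT \<xi>=ereal a..ereal x. f \<xi>) + F x = F a"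
      unfolding F_def
      by (rule interval_integral_sum)
        (use that weighted_integrable_right[OF f, of a] in \<open>auto simp: interval_lebesgue_integrable_def min_def max_def\<close>)
    moreover have "(LBINT \<xi>=ereal a..ereal x. f \<xi>) = integral {a..x} f"
      using that interval_integral_eq_integral[OF that, of f] borel_integrable_atLeastAtMost'[OF continuous_on_subset[OF f(1)]] by simp
    ultimately show ?thesis by simp
  qed
  have "((\<lambda>x. integral {a..x} f) has_vector_derivative f x) (at x within {a..x+1})"
    by (rule integral_has_vector_derivative[OF continuous_on_subset[OF f(1)]]) (auto simp: a_def)
  moreover have "at x within {a..x+1} = at x"
    by (rule at_within_Icc_at) (auto simp: a_def)
  ultimately have "((\<lambda>x. integral {a..x} f) has_real_derivative f x) (at x)"
    by (simp add: has_real_derivative_iff_has_vector_derivative)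
  then have "((\<lambda>x. F a - integral {a..x} f) has_real_derivative - f x) (at x)"
    by (auto intro!: derivative_eq_intros)
  then have "(F has_real_derivative - f x) (at x)"
    by (rule has_field_derivative_transform_within_open[where S = "{a<..}"]) (auto simp: a_def intro: eq[unfolded a_def, symmetric])
  then show ?thesis unfolding F_def .
qed

end

section \<open>The wave, its decay, and the function \<open>q\<close>\<close>

locale wave_solution =
  fixes u :: "real \<Rightarrow> real \<Rightarrow> real"
  assumes reg: "smooth_halfplane u" and decay: "decays_halfplane u"
    and pos: "\<And>x t. t \<ge> 0 \<Longrightarrow> 1 - dx (dx u) x t > 0"
    and pde: "\<And>x t. t > 0 \<Longrightarrow> dx (dx (dt u)) x t - 3 * dx u x t + 3 * dx u x t * dx (dx u) x t
                 + u x t * dx (dx (dx u)) x t = 0"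
begin

abbreviation "D n \<equiv> (dx ^^ n) u"

lemma smooth:
  "continuous_on (UNIV \<times> {0..}) (\<lambda>(x, t). (dx ^^ a) ((dt ^^ b) u) x t)"
  "t \<ge> 0 \<Longrightarrow> (\<lambda>\<xi>. (dx ^^ a) ((dt ^^ b) u) \<xi> t) differentiable (at x)"
  "t \<ge> 0 \<Longrightarrow> (\<lambda>\<tau>. (dx ^^ a) ((dt ^^ b) u) x \<tau>) differentiable (at t within {0..})"
  using reg unfolding smooth_halfplane_def Let_def by auto

lemma D_deriv: "t \<ge> 0 \<Longrightarrow> ((\<lambda>\<xi>. D n \<xi> t) has_real_derivative D (Suc n) x t) (at x)"
  using has_dx[OF smooth(2)[where b = 0 and a = n]] by simp

lemma D_cont: "continuous_on (UNIV \<times> {0..}) (\<lambda>(x, t). D n x t)"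
  using smooth(1)[where b = 0 and a = n] by simp

lemma E_deriv: "t \<ge> 0 \<Longrightarrow> ((\<lambda>\<xi>. (dx ^^ n) (dt u) \<xi> t) has_real_derivative (dx ^^ Suc n) (dt u) x t) (at x)"
  using has_dx[OF smooth(2)[where b = 1 and a = n]] by simp

lemma E_cont: "continuous_on (UNIV \<times> {0..}) (\<lambda>(x, t). (dx ^^ n) (dt u) x t)"
  using smooth(1)[where b = 1 and a = n] by simp

lemma u_t: "t \<ge> 0 \<Longrightarrow> ((\<lambda>\<tau>. u x \<tau>) has_real_derivative dt u x t) (at t within {0..})"
  using has_dt[OF smooth(3)[where b = 0 and a = 0]] by simp

lemma D_t: "t \<ge> 0 \<Longrightarrow> ((\<lambda>\<tau>. D n x \<tau>) has_real_derivative (dx ^^ n) (dt u) x t) (at t within {0..})"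
proof (induction n arbitrary: x t)
  case (Suc n)
  show ?case
    by (rule mixed_partials[OF Suc.IH E_cont D_deriv E_deriv E_cont Suc.prems])
qed (use u_t in simp)

lemma slice_isCont:
  assumes "continuous_on (UNIV \<times> {0..}) (\<lambda>(x, t). h x t)" "t \<ge> 0"
  shows "((\<lambda>\<tau>. h x \<tau>) \<longlongrightarrow> h x t) (at t within {0..})"
proof -
  have "continuous_on {0..} ((\<lambda>(x, t). h x t) \<circ> (\<lambda>t. (x, t)))"
    by (intro continuous_on_compose continuous_on_subset[OF assms(1)] continuous_intros) auto
  then show ?thesis using assms(2) by (auto simp: o_def continuous_on_def)
qed

text \<open>The equation holds for positive times; continuity of all terms extends it to t = 0,
  where the one-sided derivatives of \<open>q\<close> and of the characteristics are needed.\<close>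

lemma flow_equation:
  assumes t: "t \<ge> 0"
  shows "(dx ^^ 2) (dt u) x t = 3 * D 1 x t - 3 * D 1 x t * D 2 x t - u x t * D 3 x t"
proof -
  let ?h = "\<lambda>\<tau>. (dx ^^ 2) (dt u) x \<tau> - (3 * D 1 x \<tau> - 3 * D 1 x \<tau> * D 2 x \<tau> - D 0 x \<tau> * D 3 x \<tau>)"
  have pde': "?h \<tau> = 0" if "\<tau> > 0" for \<tau>
    using pde[OF that, of x] by (simp add: numeral_2_eq_2 numeral_3_eq_3)
  have "(?h \<longlongrightarrow> ?h t) (at t within {0..})"
    by (intro tendsto_intros slice_isCont E_cont D_cont t)
  then have "(?h \<longlongrightarrow> ?h t) (at t within {0<..})"
    by (rule tendsto_within_subset) auto
  moreover have "(?h \<longlongrightarrow> 0) (at t within {0<..})"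
    by (rule Lim_transform_eventually[OF tendsto_const]) (use pde' in \<open>auto simp only: eventually_at_filter greaterThan_iff intro!: always_eventually\<close>)
  moreover have "at t within {0<..} \<noteq> bot"
    using at_le[of "{t<..}" "{0<..}" t] t trivial_limit_at_right_real[of t] by (auto simp: bot_unique)
  ultimately show ?thesis using tendsto_unique by fastforce
qed

text \<open>A single exponent serves all derivatives and all time intervals, so one weight
  \<open>wt\<close> can be fixed throughout; only the constants depend on the derivative and on the
  interval.\<close>

definition "decay_exponent = (SOME p. p > 1 \<and>
  (\<forall>a T. \<exists>C. \<forall>x. \<forall>t\<in>{0..T}. \<bar>(dx ^^ a) u x t\<bar> \<le> C * (1 + \<bar>x\<bar>) powr (- p)))"

abbreviation "wt \<equiv> decay_weight decay_exponent"

lemma decay_exponent: "decay_exponent > 1"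
  "\<exists>C. \<forall>x. \<forall>t\<in>{0..T}. \<bar>D n x t\<bar> \<le> C * wt x"
proof -
  have *: "\<exists>p>1. \<forall>a T. \<exists>C. \<forall>x. \<forall>t\<in>{0..T}. \<bar>(dx ^^ a) u x t\<bar> \<le> C * (1 + \<bar>x\<bar>) powr (- p)"
    using decay unfolding decays_halfplane_def .
  have "decay_exponent > 1 \<and> (\<forall>a T. \<exists>C. \<forall>x. \<forall>t\<in>{0..T}. \<bar>(dx ^^ a) u x t\<bar> \<le> C * (1 + \<bar>x\<bar>) powr (- decay_exponent))"
    unfolding decay_exponent_def using * by (rule someI_ex)
  then show "decay_exponent > 1" "\<exists>C. \<forall>x. \<forall>t\<in>{0..T}. \<bar>D n x t\<bar> \<le> C * wt x"
    by (auto simp: decay_weight_def)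
qed

lemma D_bound:
  obtains C where "C \<ge> 0" "\<And>x t. t \<in> {0..T} \<Longrightarrow> \<bar>D n x t\<bar> \<le> C * wt x"
proof -
  obtain C where C: "\<And>x t. t \<in> {0..T} \<Longrightarrow> \<bar>D n x t\<bar> \<le> C * wt x"
    using decay_exponent(2) by blast
  have "\<bar>D n x t\<bar> \<le> \<bar>C\<bar> * wt x" if "t \<in> {0..T}" for x t
    using C[OF that, of x] by (rule order_trans) (auto intro!: mult_right_mono)
  then show ?thesis using that[of "\<bar>C\<bar>"] by auto
qed

lemma D_bound_const:
  obtains C where "C \<ge> 0" "\<And>x t. t \<in> {0..T} \<Longrightarrow> \<bar>D n x t\<bar> \<le> C"
proof -
  obtain C where C: "C \<ge> 0" "\<And>x t. t \<in> {0..T} \<Longrightarrow> \<bar>D n x t\<bar> \<le> C * wt x"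
    by (rule D_bound) blast
  have "\<bar>D n x t\<bar> \<le> C" if "t \<in> {0..T}" for x t
    using C(2)[OF that, of x] mult_left_mono[OF decay_weight_le_one[of decay_exponent x] C(1)] decay_exponent(1)
    by linarith
  then show ?thesis using that C(1) by blast
qed

definition "q x t = root 3 (1 - D 2 x t)"

definition "q' x t = - D 3 x t / (3 * (q x t)\<^sup>2)"

lemma q_qfun: "qfun (\<lambda>\<xi>. u \<xi> t) x = q x t"
  unfolding qfun_def q_def by (simp add: numeral_2_eq_2 dx_def)

lemma m_pos: "t \<ge> 0 \<Longrightarrow> 1 - D 2 x t > 0"
  using pos by (simp add: numeral_2_eq_2)

lemma q_pos: "t \<ge> 0 \<Longrightarrow> q x t > 0"
  unfolding q_def using m_pos by simp

lemma q_cube: "t \<ge> 0 \<Longrightarrow> q x t ^ 3 = 1 - D 2 x t"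
  unfolding q_def using m_pos[of t x] by simp

lemma q_deriv: "t \<ge> 0 \<Longrightarrow> ((\<lambda>\<xi>. q \<xi> t) has_real_derivative q' x t) (at x)"
proof -
  assume t: "t \<ge> 0"
  have "((\<lambda>\<xi>. 1 - D 2 \<xi> t) has_real_derivative - D 3 x t) (at x)"
    using D_deriv[OF t, of 2] by (auto intro!: derivative_eq_intros simp: numeral_3_eq_3 numeral_2_eq_2)
  then have "((\<lambda>\<xi>. root 3 (1 - D 2 \<xi> t)) has_real_derivative
      inverse (real 3 * root 3 (1 - D 2 x t) ^ (3 - Suc 0)) * - D 3 x t) (at x)"
    using m_pos[OF t, of x] by (intro DERIV_chain2[OF DERIV_real_root]) auto
  then show ?thesis by (simp add: q_def q'_def field_simps)
qed

text \<open>With m = 1 - u_xx the flow reads m_t + u m_x + 3 u_x m = 0. Passing to the cube root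
  turns the factor 3 into 1, which is the conservation form.\<close>

lemma q_t: "t \<ge> 0 \<Longrightarrow> ((\<lambda>\<tau>. q x \<tau>) has_real_derivative - (D 1 x t * q x t + u x t * q' x t)) (at t within {0..})"
proof -
  assume t: "t \<ge> 0"
  let ?E = "- (dx ^^ 2) (dt u) x t"
  have "((\<lambda>\<tau>. 1 - D 2 x \<tau>) has_real_derivative ?E) (at t within {0..})"
    using D_t[OF t, of 2 x] by (auto intro!: derivative_eq_intros)
  then have "((\<lambda>\<tau>. root 3 (1 - D 2 x \<tau>)) has_real_derivative
      inverse (real 3 * root 3 (1 - D 2 x t) ^ (3 - Suc 0)) * ?E) (at t within {0..})"
    using m_pos[OF t, of x] by (intro DERIV_chain2[OF DERIV_real_root]) auto
  moreover have "inverse (real 3 * root 3 (1 - D 2 x t) ^ (3 - Suc 0)) * ?E = - (D 1 x t * q x t + u x t * q' x t)"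
  proof -
    have "?E = - (3 * D 1 x t * q x t ^ 3 - u x t * D 3 x t)"
      unfolding flow_equation[OF t] q_cube[OF t] by (simp add: algebra_simps)
    then show ?thesis
      using q_pos[OF t, of x] unfolding q_def[symmetric] q'_def
      by (simp add: field_simps power2_eq_square power3_eq_cube)
  qed
  ultimately show ?thesis by (simp add: q_def)
qed

lemma q_cont: "continuous_on (UNIV \<times> {0..}) (\<lambda>(x, t). q x t)"
  using D_cont[of 2] unfolding q_def by (auto simp: case_prod_unfold intro!: continuous_intros)

lemma q'_cont: "continuous_on (UNIV \<times> {0..}) (\<lambda>(x, t). q' x t)"
  using D_cont[of 3] q_cont q_pos unfolding q'_def
  by (auto simp: case_prod_unfold intro!: continuous_intros simp: less_imp_neq[symmetric])

lemma q_minus_one: "t \<ge> 0 \<Longrightarrow> \<bar>q x t - 1\<bar> \<le> \<bar>D 2 x t\<bar>"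
proof -
  assume t: "t \<ge> 0"
  have "D 2 x t = - ((q x t - 1) * ((q x t)\<^sup>2 + q x t + 1))"
    using q_cube[OF t, of x] by (simp add: algebra_simps power2_eq_square power3_eq_cube)
  then have "\<bar>D 2 x t\<bar> = \<bar>q x t - 1\<bar> * \<bar>(q x t)\<^sup>2 + q x t + 1\<bar>" by (simp add: abs_mult)
  moreover have "1 \<le> \<bar>(q x t)\<^sup>2 + q x t + 1\<bar>" using q_pos[OF t, of x] by simp
  ultimately show ?thesis using mult_left_mono[of 1 _ "\<bar>q x t - 1\<bar>"] by fastforce
qed

lemma wt_small:
  assumes "e > 0"
  obtains R where "R > 0" "\<And>x. \<bar>x\<bar> \<ge> R \<Longrightarrow> C * wt x < e"
proof -
  have "((\<lambda>x. C * wt x) \<longlongrightarrow> C * 0) at_top"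
    using decay_exponent(1) by (intro tendsto_intros decay_weight_at_top) auto
  then have "\<forall>\<^sub>F x in at_top. C * wt x < e"
    using assms by (auto dest: order_tendstoD(2))
  then obtain R where R: "\<And>x. x \<ge> R \<Longrightarrow> C * wt x < e"
    by (auto simp: eventually_at_top_linorder)
  show ?thesis
  proof (rule that[of "max R 1"])
    fix x :: real assume "\<bar>x\<bar> \<ge> max R 1"
    then have "C * wt \<bar>x\<bar> < e" by (intro R) auto
    then show "C * wt x < e" by (simp add: decay_weight_def)
  qed auto
qed

text \<open>Decay keeps \<open>q\<close> above 1/2 outside a compact set, continuity and positivity
  bound it below inside. For negative \<open>T\<close> the time interval is empty and any positive
  constant will do.\<close>

lemma q_lower:
  obtains c where "c > 0" "\<And>x t. t \<in> {0..T} \<Longrightarrow> q x t \<ge> c"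
proof -
  obtain C where C: "C \<ge> 0" "\<And>x t. t \<in> {0..T} \<Longrightarrow> \<bar>D 2 x t\<bar> \<le> C * wt x"
    by (rule D_bound) blast
  obtain R where R: "R > 0" "\<And>x. \<bar>x\<bar> \<ge> R \<Longrightarrow> C * wt x < 1/2"
    by (rule wt_small[of "1/2" C]) auto
  have far: "q x t \<ge> 1/2" if "\<bar>x\<bar> \<ge> R" "t \<in> {0..T}" for x t
    using q_minus_one[of t x] C(2)[OF that(2), of x] R(2)[OF that(1)] that by auto
  show ?thesis
  proof (cases "T \<ge> 0")
    case True
    have "compact ({-R..R} \<times> {0..T})" by (intro compact_Times) auto
    moreover have "{-R..R} \<times> {0..T} \<noteq> {}" using R True by auto
    moreover have "continuous_on ({-R..R} \<times> {0..T}) (\<lambda>(x, t). q x t)"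
      by (rule continuous_on_subset[OF q_cont]) auto
    ultimately have "\<exists>p\<in>{-R..R} \<times> {0..T}. \<forall>r\<in>{-R..R} \<times> {0..T}. (\<lambda>(x, t). q x t) p \<le> (\<lambda>(x, t). q x t) r"
      by (rule continuous_attains_inf)
    then obtain p where p: "p \<in> {-R..R} \<times> {0..T}"
      "\<And>x t. x \<in> {-R..R} \<Longrightarrow> t \<in> {0..T} \<Longrightarrow> q (fst p) (snd p) \<le> q x t"
      by (auto simp: case_prod_unfold)
    define c where "c = min (1/2) (q (fst p) (snd p))"
    show ?thesis
    proof (rule that[of c])
      show "c > 0" using p(1) q_pos by (auto simp: c_def)
      fix x t assume t: "t \<in> {0..T}"
      show "q x t \<ge> c"
      proof (cases "\<bar>x\<bar> \<ge> R")
        case True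
        from far[OF this t] show ?thesis by (simp add: c_def)
      next
        case False
        then have "x \<in> {-R..R}" by auto
        from p(2)[OF this t] show ?thesis by (simp add: c_def min.coboundedI2)
      qed
    qed
  qed (use that[of 1] in auto)
qed

lemma q_upper:
  obtains C where "C \<ge> 1" "\<And>x t. t \<in> {0..T} \<Longrightarrow> q x t \<le> C"
proof -
  obtain C where C: "C \<ge> 0" "\<And>x t. t \<in> {0..T} \<Longrightarrow> \<bar>D 2 x t\<bar> \<le> C"
    by (rule D_bound_const) blast
  have "q x t \<le> 1 + C" if "t \<in> {0..T}" for x t
    using q_minus_one[of t x] C(2)[OF that, of x] that by auto
  then show ?thesis using that[of "1 + C"] C(1) by auto
qed

section \<open>The coordinate \<open>y\<close> and the characteristics\<close>

definition "Y x t = yfun (\<lambda>\<xi>. u \<xi> t) x"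

text \<open>This is the candidate for x(y,t), defined from the wave alone; its relation to the limit
  formula is established at the very end.\<close>

definition "X y t = inv (\<lambda>x. Y x t) y"

lemma Y_eq: "Y x t = x - (LBINT \<xi>=ereal x..\<infinity>. q \<xi> t - 1)"
  by (simp add: Y_def yfun_def q_qfun)

lemma q_slice_cont: "t \<ge> 0 \<Longrightarrow> continuous_on S (\<lambda>x. q x t)"
  using continuous_on_slice1[OF q_cont, of t S] by simp

lemma q_minus_one_bound:
  obtains C where "C \<ge> 0" "\<And>x t. t \<in> {0..T} \<Longrightarrow> \<bar>q x t - 1\<bar> \<le> C * wt x"
proof -
  obtain C where C: "C \<ge> 0" "\<And>x t. t \<in> {0..T} \<Longrightarrow> \<bar>D 2 x t\<bar> \<le> C * wt x"
    by (rule D_bound) blast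
  have "\<bar>q x t - 1\<bar> \<le> C * wt x" if "t \<in> {0..T}" for x t
    using q_minus_one[of t x] C(2)[OF that, of x] that by auto
  then show ?thesis using that C(1) by blast
qed

lemma Y_deriv:
  assumes t: "t \<ge> 0"
  shows "((\<lambda>x. Y x t) has_real_derivative q x t) (at x)"
proof -
  obtain C where C: "C \<ge> 0" "\<And>x s. s \<in> {0..t} \<Longrightarrow> \<bar>q x s - 1\<bar> \<le> C * wt x"
    by (rule q_minus_one_bound) blast
  have "((\<lambda>x. LBINT \<xi>=ereal x..\<infinity>. q \<xi> t - 1) has_real_derivative - (q x t - 1)) (at x)"
    using t C(2)[of t] by (intro tail_integral_deriv[OF decay_exponent(1)] continuous_intros q_slice_cont) auto
  from DERIV_diff[OF DERIV_ident this] show ?thesis by (simp add: Y_eq)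
qed

lemma Y_near_identity:
  obtains C where "C \<ge> 0"
    "\<And>x t. t \<in> {0..T} \<Longrightarrow> \<bar>Y x t - x\<bar> \<le> C * (1 / (decay_exponent - 1) - weight_primitive decay_exponent x)"
proof -
  obtain C where C: "C \<ge> 0" "\<And>x s. s \<in> {0..T} \<Longrightarrow> \<bar>q x s - 1\<bar> \<le> C * wt x"
    by (rule q_minus_one_bound) blast
  have "\<bar>Y x t - x\<bar> \<le> C * (1 / (decay_exponent - 1) - weight_primitive decay_exponent x)" if t: "t \<in> {0..T}" for x t
  proof -
    have "set_integrable lborel (einterval (ereal x) \<infinity>) (\<lambda>\<xi>. q \<xi> t - 1)"
      using t C(2)[of t] by (intro weighted_integrable_right[OF decay_exponent(1)] continuous_intros q_slice_cont) auto
    from right_integral_bound[OF decay_exponent(1) this, of C] C(2)[OF t]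
    show ?thesis by (simp add: Y_eq)
  qed
  then show ?thesis using that C(1) by blast
qed

lemma Y_bound:
  obtains C where "C > 0" "\<And>x t. t \<in> {0..T} \<Longrightarrow> \<bar>Y x t - x\<bar> \<le> C"
proof -
  obtain C where C: "C \<ge> 0"
    "\<And>x t. t \<in> {0..T} \<Longrightarrow> \<bar>Y x t - x\<bar> \<le> C * (1 / (decay_exponent - 1) - weight_primitive decay_exponent x)"
    by (rule Y_near_identity) blast
  have "\<bar>Y x t - x\<bar> \<le> C * (2 / (decay_exponent - 1)) + 1" if "t \<in> {0..T}" for x t
  proof -
    have "1 / (decay_exponent - 1) - weight_primitive decay_exponent x \<le> 2 / (decay_exponent - 1)"
      using weight_primitive_bound[OF decay_exponent(1), of x] by (simp add: abs_le_iff)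
    from mult_left_mono[OF this C(1)] C(2)[OF that, of x] show ?thesis by linarith
  qed
  moreover have "C * (2 / (decay_exponent - 1)) + 1 > 0"
    using C(1) decay_exponent(1) by (intro add_nonneg_pos mult_nonneg_nonneg) auto
  ultimately show ?thesis using that by blast
qed

lemma Y_at_top:
  assumes "t \<ge> 0"
  shows "((\<lambda>x. Y x t - x) \<longlongrightarrow> 0) at_top"
proof -
  obtain C where C: "C \<ge> 0"
    "\<And>x s. s \<in> {0..t} \<Longrightarrow> \<bar>Y x s - x\<bar> \<le> C * (1 / (decay_exponent - 1) - weight_primitive decay_exponent x)"
    by (rule Y_near_identity) blast
  have "((\<lambda>x. C * (1 / (decay_exponent - 1) - weight_primitive decay_exponent x)) \<longlongrightarrow> C * (1 / (decay_exponent - 1) - 1 / (decay_exponent - 1))) at_top"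
    by (intro tendsto_intros weight_primitive_at_top decay_exponent(1))
  then have "((\<lambda>x. C * (1 / (decay_exponent - 1) - weight_primitive decay_exponent x)) \<longlongrightarrow> 0) at_top" by simp
  then show ?thesis
    by (rule Lim_null_comparison[rotated]) (use C(2)[of t] assms in auto)
qed

lemma Y_strict_mono: "t \<ge> 0 \<Longrightarrow> x < x' \<Longrightarrow> Y x t < Y x' t"
  by (rule DERIV_pos_imp_increasing) (auto intro: Y_deriv q_pos)

lemma Y_bij:
  assumes t: "t \<ge> 0"
  shows "bij (\<lambda>x. Y x t)"
proof (rule bijI)
  show "inj (\<lambda>x. Y x t)"
    using Y_strict_mono[OF t] by (metis injI less_irrefl linorder_neqE)
  have "\<exists>x. Y x t = y" for y
  proof -
    obtain C where C: "C > 0" "\<And>x s. s \<in> {0..t} \<Longrightarrow> \<bar>Y x s - x\<bar> \<le> C"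
      by (rule Y_bound) blast
    have "Y (y - C) t \<le> y" "y \<le> Y (y + C) t"
      using C(2)[of t "y - C"] C(2)[of t "y + C"] t by auto
    then have "\<exists>x\<ge>y - C. x \<le> y + C \<and> Y x t = y"
      by (intro IVT') (use C(1) Y_deriv[OF t] in \<open>auto intro!: DERIV_isCont continuous_at_imp_continuous_on\<close>)
    then show ?thesis by blast
  qed
  then show "surj (\<lambda>x. Y x t)" by (metis surj_def)
qed

lemma Y_X [simp]: "t \<ge> 0 \<Longrightarrow> Y (X y t) t = y"
  unfolding X_def using surj_f_inv_f[OF bij_is_surj[OF Y_bij]] by blast

lemma X_Y [simp]: "t \<ge> 0 \<Longrightarrow> X (Y x t) t = x"
  unfolding X_def using inv_f_f[OF bij_is_inj[OF Y_bij]] by blast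

lemma X_bij: "t \<ge> 0 \<Longrightarrow> bij (\<lambda>y. X y t)"
  unfolding X_def[abs_def] by (simp add: bij_imp_bij_inv Y_bij)

lemma inv_X: "t \<ge> 0 \<Longrightarrow> inv (\<lambda>y. X y t) x = Y x t"
  using inv_f_eq[OF bij_is_inj[OF X_bij], of t "Y x t" x] by simp

lemma X_deriv:
  assumes t: "t \<ge> 0"
  shows "((\<lambda>y. X y t) has_real_derivative 1 / q (X y t) t) (at y)"
proof -
  have "((\<lambda>y. X y t) has_real_derivative inverse (q (X y t) t)) (at y)"
  proof (rule DERIV_inverse_function[where f = "\<lambda>x. Y x t" and a = "y - 1" and b = "y + 1"])
    show "((\<lambda>x. Y x t) has_real_derivative q (X y t) t) (at (X y t))" by (rule Y_deriv[OF t])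
    show "q (X y t) t \<noteq> 0" using q_pos[OF t, of "X y t"] by simp
    have "isCont (\<lambda>y. X y t) (Y (X y t) t)"
      by (rule isCont_inverse_function[of 1 "X y t" "\<lambda>y. X y t" "\<lambda>x. Y x t"])
        (use t Y_deriv[OF t] DERIV_isCont in \<open>auto\<close>)
    then show "isCont (\<lambda>y. X y t) y" using t by simp
  qed (use t in auto)
  then show ?thesis by (simp add: divide_inverse)
qed

text \<open>The conservation law is integrated over a rectangle from \<open>x\<close> to
  \<open>x'\<close>, and \<open>x'\<close> is sent to infinity: the flux there vanishes by decay,
  and \<open>Y x' t - x'\<close> tends to 0 at every time. Bounded rectangles avoid differentiating
  an improper integral in time.\<close>

lemma Y_difference:
  assumes t: "t \<ge> 0"
  shows "Y x t = Y x 0 - integral {0..t} (\<lambda>s. u x s * q x s)"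
proof -
  have slice: "continuous_on S (h \<xi>)"
    if "continuous_on (UNIV \<times> {0..}) (\<lambda>(x, t). h x t)" "S \<subseteq> {0..}" for h :: "real \<Rightarrow> real \<Rightarrow> real" and \<xi> S
  proof -
    have "continuous_on S ((\<lambda>(x, t). h x t) \<circ> (\<lambda>t. (\<xi>, t)))"
      using that by (intro continuous_on_compose continuous_on_subset[OF that(1)] continuous_intros) auto
    then show ?thesis by (simp add: o_def)
  qed
  define g where "g \<xi> s = - (D 1 \<xi> s * q \<xi> s + u \<xi> s * q' \<xi> s)" for \<xi> s
  have gc: "continuous_on (UNIV \<times> {0..}) (\<lambda>(x, t). g x t)"
    using D_cont[of 0] D_cont[of 1] q_cont q'_cont unfolding g_def
    by (auto simp: case_prod_unfold intro!: continuous_intros)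
  have uqc: "continuous_on (UNIV \<times> {0..}) (\<lambda>(x, t). u x t * q x t)"
    using D_cont[of 0] q_cont by (auto simp: case_prod_unfold intro!: continuous_intros)
  have int_q: "integral {x..x'} (\<lambda>\<xi>. q \<xi> s) = Y x' s - Y x s" if "s \<ge> 0" "x \<le> x'" for s x'
    by (rule integral_unique, rule fundamental_theorem_of_calculus)
      (use that Y_deriv in \<open>auto intro: has_vector_derivative_at_within simp: has_real_derivative_iff_has_vector_derivative\<close>)
  have int_g: "integral {x..x'} (\<lambda>\<xi>. g \<xi> s) = u x s * q x s - u x' s * q x' s" if "s \<ge> 0" "x \<le> x'" for s x'
  proof -
    have "((\<lambda>\<xi>. - (u \<xi> s * q \<xi> s)) has_real_derivative g \<xi> s) (at \<xi>)" for \<xi>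
      using D_deriv[OF that(1), of 0 \<xi>] q_deriv[OF that(1), of \<xi>] unfolding g_def
      by (auto intro!: derivative_eq_intros)
    then have "((\<lambda>\<xi>. g \<xi> s) has_integral - (u x' s * q x' s) - - (u x s * q x s)) {x..x'}"
      using that by (intro fundamental_theorem_of_calculus)
        (auto intro: has_vector_derivative_at_within simp: has_real_derivative_iff_has_vector_derivative)
    then show ?thesis by (simp add: integral_unique)
  qed
  have diff: "(Y x' t - Y x t) - (Y x' 0 - Y x 0) = integral {0..t} (\<lambda>s. u x s * q x s) - integral {0..t} (\<lambda>s. u x' s * q x' s)"
    if x: "x \<le> x'" for x'
  proof -
    have "((\<lambda>s. Y x' s - Y x s) has_vector_derivative u x s * q x s - u x' s * q x' s) (at s within {0..t})"
      if s: "s \<in> {0..t}" for s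
    proof -
      have "((\<lambda>s. integral (cbox x x') (\<lambda>\<xi>. q \<xi> s)) has_vector_derivative integral (cbox x x') (\<lambda>\<xi>. g \<xi> s)) (at s within {0..t})"
      proof (rule leibniz_rule_vector_derivative)
        show "((\<lambda>s. q \<xi> s) has_vector_derivative g \<xi> s) (at s within {0..t})" if "s \<in> {0..t}" for \<xi> s
          using DERIV_subset[OF q_t[of s \<xi>], of "{0..t}"] that
          by (auto simp: g_def has_real_derivative_iff_has_vector_derivative)
        show "(\<lambda>\<xi>. q \<xi> s) integrable_on cbox x x'" if "s \<in> {0..t}" for s
          using that by (intro integrable_continuous q_slice_cont) auto
        show "continuous_on ({0..t} \<times> cbox x x') (\<lambda>(s, \<xi>). g \<xi> s)"
          by (rule continuous_on_subset[OF continuous_on_swap[OF gc]]) auto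
      qed (use s in auto)
      then have *: "((\<lambda>s. integral {x..x'} (\<lambda>\<xi>. q \<xi> s)) has_vector_derivative u x s * q x s - u x' s * q x' s) (at s within {0..t})"
        using int_g[of s x'] s x by simp
      show ?thesis
        by (rule has_vector_derivative_transform[OF s _ *]) (use int_q x in auto)
    qed
    then have "((\<lambda>s. u x s * q x s - u x' s * q x' s) has_integral (Y x' t - Y x t) - (Y x' 0 - Y x 0)) {0..t}"
      by (intro fundamental_theorem_of_calculus t)
    moreover have "integral {0..t} (\<lambda>s. u x s * q x s - u x' s * q x' s)
        = integral {0..t} (\<lambda>s. u x s * q x s) - integral {0..t} (\<lambda>s. u x' s * q x' s)"
      by (intro Henstock_Kurzweil_Integration.integral_diff integrable_continuous_real slice[OF uqc]) auto
    ultimately show ?thesis by (simp add: integral_unique)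
  qed
  obtain C where C: "C \<ge> 0" "\<And>x s. s \<in> {0..t} \<Longrightarrow> \<bar>D 0 x s\<bar> \<le> C * wt x"
    by (rule D_bound) blast
  obtain B where B: "B \<ge> 1" "\<And>x s. s \<in> {0..t} \<Longrightarrow> q x s \<le> B"
    by (rule q_upper) blast
  have "((\<lambda>x'. integral {0..t} (\<lambda>s. u x' s * q x' s)) \<longlongrightarrow> 0) at_top"
  proof (rule Lim_null_comparison[OF always_eventually])
    show "\<forall>x'. norm (integral {0..t} (\<lambda>s. u x' s * q x' s)) \<le> C * wt x' * B * (t - 0)"
    proof
      fix x'
      show "norm (integral {0..t} (\<lambda>s. u x' s * q x' s)) \<le> C * wt x' * B * (t - 0)"
      proof (rule integral_bound[OF t slice[OF uqc]])
        fix s assume s: "s \<in> {0..t}"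
        show "norm (u x' s * q x' s) \<le> C * wt x' * B"
          unfolding real_norm_def abs_mult
          using C(2)[OF s, of x'] B(2)[OF s, of x'] q_pos[of s x'] s C(1) by (intro mult_mono) auto
      qed auto
    qed
    have "((\<lambda>x'. C * wt x' * B * (t - 0)) \<longlongrightarrow> C * 0 * B * (t - 0)) at_top"
      using decay_exponent(1) by (intro tendsto_intros decay_weight_at_top) auto
    then show "((\<lambda>x'. C * wt x' * B * (t - 0)) \<longlongrightarrow> 0) at_top" by simp
  qed
  then have "((\<lambda>x'. integral {0..t} (\<lambda>s. u x s * q x s) - integral {0..t} (\<lambda>s. u x' s * q x' s)) \<longlongrightarrow> integral {0..t} (\<lambda>s. u x s * q x s) - 0) at_top"
    by (intro tendsto_intros)
  moreover have "((\<lambda>x'. (Y x' t - x' - Y x t) - (Y x' 0 - x' - Y x 0)) \<longlongrightarrow> (0 - Y x t) - (0 - Y x 0)) at_top"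
    using t by (intro tendsto_intros Y_at_top) auto
  then have "((\<lambda>x'. integral {0..t} (\<lambda>s. u x s * q x s) - integral {0..t} (\<lambda>s. u x' s * q x' s)) \<longlongrightarrow> (0 - Y x t) - (0 - Y x 0)) at_top"
    by (rule Lim_transform_eventually)
      (use eventually_ge_at_top[of x] in \<open>eventually_elim; simp flip: diff\<close>)
  ultimately have "integral {0..t} (\<lambda>s. u x s * q x s) - 0 = (0 - Y x t) - (0 - Y x 0)"
    by (intro tendsto_unique) auto
  then show ?thesis by simp
qed

lemma Y_t:
  assumes t: "t \<ge> 0"
  shows "((\<lambda>s. Y x s) has_real_derivative - (u x t * q x t)) (at t within {0..})"
proof -
  have "continuous_on {0..t+1} ((\<lambda>(x, t). u x t * q x t) \<circ> (\<lambda>t. (x, t)))"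
    using D_cont[of 0] q_cont
    by (intro continuous_on_compose) (auto simp: case_prod_unfold intro!: continuous_intros elim: continuous_on_subset)
  then have "((\<lambda>s. integral {0..s} (\<lambda>s. u x s * q x s)) has_vector_derivative u x t * q x t) (at t within {0..t+1})"
    using t by (intro integral_has_vector_derivative) (auto simp: o_def)
  then have "((\<lambda>s. integral {0..s} (\<lambda>s. u x s * q x s)) has_real_derivative u x t * q x t) (at t within {0..})"
    using t at_within_atLeastAtMost_atLeast[of t "t + 1"]
    by (simp add: has_real_derivative_iff_has_vector_derivative)
  from DERIV_diff[OF DERIV_const this, of "Y x 0"]
  have "((\<lambda>s. Y x 0 - integral {0..s} (\<lambda>s. u x s * q x s)) has_real_derivative - (u x t * q x t)) (at t within {0..})"
    by simp
  then show ?thesis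
    by (rule has_field_derivative_transform_within[OF _ zero_less_one]) (use t in \<open>simp_all add: Y_difference[symmetric]\<close>)
qed

text \<open>The mean value theorem in \<open>x\<close> at time \<open>t'\<close>, with slope at
  least \<open>c\<close>, converts increments of \<open>Y\<close> into increments of its inverse.
  Joint continuity of \<open>X\<close> follows from this.\<close>

lemma X_increment:
  assumes t: "t \<in> {0..T}" and t': "t' \<in> {0..T}" and c: "\<And>x t. t \<in> {0..T} \<Longrightarrow> q x t \<ge> c" "c > 0"
  shows "\<bar>X y' t' - X y t\<bar> \<le> (\<bar>y' - y\<bar> + \<bar>Y (X y t) t' - y\<bar>) / c"
proof -
  let ?x = "X y t" and ?x' = "X y' t'"
  have mvt: "c * \<bar>?x' - ?x\<bar> \<le> \<bar>Y ?x' t' - Y ?x t'\<bar>"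
  proof -
    have *: "c * (b - a) \<le> Y b t' - Y a t'" if ab: "a < b" for a b
    proof -
      obtain \<xi> where "Y b t' - Y a t' = (b - a) * q \<xi> t'"
        using MVT2[OF ab, of "\<lambda>x. Y x t'" "\<lambda>x. q x t'"] Y_deriv t' by auto
      then show ?thesis using c(1)[OF t', of \<xi>] ab by (simp add: mult.commute)
    qed
    show ?thesis
      using *[of ?x ?x'] *[of ?x' ?x] by (cases ?x ?x' rule: linorder_cases) (auto simp: abs_if)
  qed
  also have "Y ?x' t' - Y ?x t' = (y' - y) - (Y ?x t' - y)" using t' by simp
  also have "\<bar>\<dots>\<bar> \<le> \<bar>y' - y\<bar> + \<bar>Y ?x t' - y\<bar>" by (rule abs_triangle_ineq4)
  finally show ?thesis using c(2) by (simp add: field_simps)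
qed

lemma X_cont: "continuous_on (UNIV \<times> {0..}) (\<lambda>(y, t). X y t)"
  unfolding continuous_on_def
proof (intro ballI)
  fix p :: "real \<times> real" assume "p \<in> UNIV \<times> {0..}"
  then obtain y t where p: "p = (y, t)" and t: "t \<ge> 0" by auto
  obtain c where c: "c > 0" "\<And>x s. s \<in> {0..t+1} \<Longrightarrow> q x s \<ge> c" by (rule q_lower) blast
  have "continuous_on {0..} (\<lambda>s. Y (X y t) s)"
    using DERIV_continuous[OF Y_t] by (auto simp: continuous_on_eq_continuous_within)
  then have "((\<lambda>p. Y (X y t) (snd p)) \<longlongrightarrow> Y (X y t) t) (at (y, t) within UNIV \<times> {0..})"
    by (rule continuous_on_tendsto_compose)
      (use t in \<open>auto simp: eventually_at_filter intro!: tendsto_eq_intros always_eventually\<close>)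
  then have "((\<lambda>p. (\<bar>fst p - y\<bar> + \<bar>Y (X y t) (snd p) - y\<bar>) / c) \<longlongrightarrow> (\<bar>y - y\<bar> + \<bar>Y (X y t) t - y\<bar>) / c) (at (y, t) within UNIV \<times> {0..})"
    using c(1) by (intro tendsto_intros) (auto intro!: tendsto_eq_intros)
  then have lim: "((\<lambda>p. (\<bar>fst p - y\<bar> + \<bar>Y (X y t) (snd p) - y\<bar>) / c) \<longlongrightarrow> 0) (at (y, t) within UNIV \<times> {0..})"
    using t by simp
  have "\<forall>\<^sub>F p in at (y, t) within UNIV \<times> {0..}. dist p (y, t) < 1 \<and> snd p \<ge> 0"
    unfolding eventually_at by (intro exI[of _ 1]) auto
  then have "\<forall>\<^sub>F p in at (y, t) within UNIV \<times> {0..}. norm (X (fst p) (snd p) - X y t) \<le> (\<bar>fst p - y\<bar> + \<bar>Y (X y t) (snd p) - y\<bar>) / c"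
  proof eventually_elim
    case (elim p)
    have "dist (snd p) t < 1" using elim dist_snd_le[of p "(y, t)"] by simp
    then show ?case
      using elim t X_increment[of t "t + 1" "snd p" c "fst p" y] c by (auto simp: dist_real_def)
  qed
  then have "((\<lambda>p. X (fst p) (snd p) - X y t) \<longlongrightarrow> 0) (at (y, t) within UNIV \<times> {0..})"
    by (rule Lim_null_comparison[OF _ lim])
  then show "((\<lambda>(y, t). X y t) \<longlongrightarrow> (case p of (y, t) \<Rightarrow> X y t)) (at p within UNIV \<times> {0..})"
    by (simp add: LIM_zero_iff case_prod_unfold p)
qed

text \<open>Differentiation of the implicit relation Y(X(y,t),t) = y: the mean value theorem in
  \<open>x\<close> writes the increment of \<open>X\<close> as minus the time increment of
  \<open>Y\<close>, divided by \<open>q\<close> at an intermediate point. Since Y_t = - u q, the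
  factor \<open>q\<close> cancels in the limit.\<close>

lemma X_t:
  assumes t: "t \<ge> 0"
  shows "((\<lambda>s. X y s) has_real_derivative u (X y t) t) (at t within {0..})"
proof -
  let ?F = "at t within {0..}" and ?x = "X y t"
  have "\<exists>\<xi>. \<bar>\<xi> - ?x\<bar> \<le> \<bar>X y s - ?x\<bar> \<and> (X y s - ?x) * q \<xi> s = - (Y ?x s - Y ?x t)" if s: "s \<ge> 0" for s
  proof -
    have *: "\<exists>\<xi>. a < \<xi> \<and> \<xi> < b \<and> Y b s - Y a s = (b - a) * q \<xi> s" if "a < b" for a b
      using MVT2[OF that, of "\<lambda>x. Y x s" "\<lambda>x. q x s"] Y_deriv s by auto
    consider "?x < X y s" | "X y s < ?x" | "X y s = ?x" by linarith
    then show ?thesis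
    proof cases
      case 1
      from *[OF this] obtain \<xi> where \<xi>: "?x < \<xi>" "\<xi> < X y s" "Y (X y s) s - Y ?x s = (X y s - ?x) * q \<xi> s" by blast
      then have "(X y s - ?x) * q \<xi> s = - (Y ?x s - Y ?x t)" using s t by (simp add: algebra_simps)
      then show ?thesis using \<xi> by (intro exI[of _ \<xi>]) auto
    next
      case 2
      from *[OF this] obtain \<xi> where \<xi>: "X y s < \<xi>" "\<xi> < ?x" "Y ?x s - Y (X y s) s = (?x - X y s) * q \<xi> s" by blast
      then have "(X y s - ?x) * q \<xi> s = - (Y ?x s - Y ?x t)" using s t by (simp add: algebra_simps)
      then show ?thesis using \<xi> by (intro exI[of _ \<xi>]) auto
    next
      case 3
      then have "Y ?x s = y" using s Y_X[of s y] by simp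
      then show ?thesis using 3 t by auto
    qed
  qed
  then obtain \<xi> where \<xi>: "\<And>s. s \<ge> 0 \<Longrightarrow> \<bar>\<xi> s - ?x\<bar> \<le> \<bar>X y s - ?x\<bar>"
    "\<And>s. s \<ge> 0 \<Longrightarrow> (X y s - ?x) * q (\<xi> s) s = - (Y ?x s - Y ?x t)" by metis
  have ge: "\<forall>\<^sub>F s in ?F. s \<ge> 0" by (auto simp: eventually_at_filter)
  have X: "((\<lambda>s. X y s) \<longlongrightarrow> ?x) ?F"
    by (rule slice_isCont[OF X_cont t])
  have "((\<lambda>s. \<bar>X y s - ?x\<bar>) \<longlongrightarrow> \<bar>?x - ?x\<bar>) ?F" by (intro tendsto_intros X)
  then have "((\<lambda>s. \<xi> s - ?x) \<longlongrightarrow> 0) ?F"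
    by (intro Lim_null_comparison[of "\<lambda>s. \<xi> s - ?x" "\<lambda>s. \<bar>X y s - ?x\<bar>"])
      (use ge \<xi>(1) in \<open>auto elim!: eventually_mono\<close>)
  then have \<xi>lim: "(\<xi> \<longlongrightarrow> ?x) ?F" by (simp add: LIM_zero_iff)
  have "((\<lambda>s. (\<lambda>(x, t). q x t) (\<xi> s, s)) \<longlongrightarrow> (\<lambda>(x, t). q x t) (?x, t)) ?F"
    by (rule continuous_on_tendsto_compose[OF q_cont])
      (use \<xi>lim t ge in \<open>auto intro!: tendsto_intros elim!: eventually_mono\<close>)
  then have qlim: "((\<lambda>s. q (\<xi> s) s) \<longlongrightarrow> q ?x t) ?F" by simp
  have "((\<lambda>s. (Y ?x s - Y ?x t) / (s - t)) \<longlongrightarrow> - (u ?x t * q ?x t)) ?F"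
    using Y_t[OF t, of ?x] by (simp add: has_field_derivative_iff)
  then have "((\<lambda>s. - ((Y ?x s - Y ?x t) / (s - t)) / q (\<xi> s) s) \<longlongrightarrow> - (- (u ?x t * q ?x t)) / q ?x t) ?F"
    using q_pos[OF t, of ?x] by (intro tendsto_intros qlim) auto
  then have "((\<lambda>s. - ((Y ?x s - Y ?x t) / (s - t)) / q (\<xi> s) s) \<longlongrightarrow> u ?x t) ?F"
    using q_pos[OF t, of ?x] by simp
  moreover have "\<forall>\<^sub>F s in ?F. - ((Y ?x s - Y ?x t) / (s - t)) / q (\<xi> s) s = (X y s - ?x) / (s - t)"
    using ge
  proof eventually_elim
    case (elim s)
    have "- ((Y ?x s - Y ?x t) / (s - t)) / q (\<xi> s) s = (- (Y ?x s - Y ?x t)) / (s - t) / q (\<xi> s) s"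
      by (simp only: minus_divide_left)
    also have "\<dots> = (X y s - ?x) / (s - t)"
      unfolding \<xi>(2)[OF elim, symmetric] using q_pos[OF elim, of "\<xi> s"] by simp
    finally show ?case .
  qed
  ultimately have "((\<lambda>s. (X y s - ?x) / (s - t)) \<longlongrightarrow> u ?x t) ?F"
    by (rule Lim_transform_eventually)
  then show ?thesis by (simp add: has_field_derivative_iff)
qed

end

section \<open>Eigenfunctions at the initial time\<close>

text \<open>The end of the line at which \<open>e\<^bsup>\<mu>\<phi>\<^esup>\<close> does not decay, for increasing \<open>\<phi>\<close>.\<close>

definition far_end :: "complex \<Rightarrow> real filter" where
  "far_end \<mu> = (if Re \<mu> \<ge> 0 then at_top else at_bot)"

text \<open>Multiplication by exp(- \<mu> \<phi>) removes the homogeneous term. For Re \<mu> \<ge> 0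
  the modulus of this factor decreases to the right, so integrating inwards from +\<infinity>, where
  \<open>g\<close> vanishes, costs no exponential: the bound is the variation of \<psi>, at most
  \<open>2 * K\<close>, and is independent of \<mu>.\<close>

lemma ode_bound_at_top:
  fixes g h :: "real \<Rightarrow> complex" and \<phi> \<psi> :: "real \<Rightarrow> real"
  assumes g: "\<And>x. (g has_vector_derivative \<mu> * of_real (\<phi>' x) * g x + h x) (at x)"
    and \<phi>: "\<And>x. (\<phi> has_real_derivative \<phi>' x) (at x)" "\<And>x. \<phi>' x \<ge> 0"
    and \<psi>: "\<And>x. (\<psi> has_real_derivative \<psi>' x) (at x)" "\<And>x. \<bar>\<psi> x\<bar> \<le> K" "\<And>x. norm (h x) \<le> \<psi>' x"
    and \<mu>: "Re \<mu> \<ge> 0" and lim: "(g \<longlongrightarrow> 0) at_top"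
  shows "norm (g x) \<le> 2 * K"
proof -
  define G where "G x = exp (- \<mu> * of_real (\<phi> x)) * g x" for x
  have mono: "\<phi> a \<le> \<phi> b" if "a \<le> b" for a b
    by (rule DERIV_nonneg_imp_nondecreasing[OF that]) (use \<phi> in blast)
  have G: "(G has_vector_derivative exp (- \<mu> * of_real (\<phi> x)) * h x) (at x)" for x
  proof -
    have "((\<lambda>x. - \<mu> * of_real (\<phi> x)) has_vector_derivative - \<mu> * of_real (\<phi>' x)) (at x)"
      using \<phi>(1)[of x]
      by (intro has_vector_derivative_mult_right has_vector_derivative_of_real)
        (simp add: has_real_derivative_iff_has_vector_derivative)
    then have "((\<lambda>x. exp (- \<mu> * of_real (\<phi> x))) has_vector_derivative (- \<mu> * of_real (\<phi>' x)) * exp (- \<mu> * of_real (\<phi> x))) (at x)"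
      by (rule field_vector_diff_chain_at[unfolded o_def]) (auto intro: DERIV_exp)
    from has_vector_derivative_mult[OF this g] show ?thesis
      unfolding G_def by (simp add: algebra_simps)
  qed
  have "norm (g x) \<le> norm (g y) + 2 * K" if "y > x" for y
  proof -
    let ?e = "exp (- (Re \<mu> * \<phi> x))"
    have "norm (G y - G x) \<le> ?e * \<psi> y - ?e * \<psi> x"
    proof (rule differentiable_bound_general[OF that])
      show "continuous_on {x..y} G"
        using G by (meson continuous_at_imp_continuous_on has_vector_derivative_continuous)
      have "continuous_on {x..y} \<psi>"
        using \<psi>(1) by (meson continuous_at_imp_continuous_on DERIV_isCont)
      then show "continuous_on {x..y} (\<lambda>y. ?e * \<psi> y)" by (intro continuous_intros)
      fix \<xi> assume \<xi>: "x < \<xi>" "\<xi> < y"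
      show "(G has_vector_derivative exp (- \<mu> * of_real (\<phi> \<xi>)) * h \<xi>) (at \<xi>)" by (rule G)
      show "((\<lambda>y. ?e * \<psi> y) has_vector_derivative ?e * \<psi>' \<xi>) (at \<xi>)"
        using DERIV_cmult[OF \<psi>(1), of ?e \<xi>] by (simp add: has_real_derivative_iff_has_vector_derivative)
      have "Re \<mu> * \<phi> x \<le> Re \<mu> * \<phi> \<xi>" using \<xi> \<mu> by (intro mult_left_mono mono) auto
      then show "norm (exp (- \<mu> * of_real (\<phi> \<xi>)) * h \<xi>) \<le> ?e * \<psi>' \<xi>"
        unfolding norm_mult using \<psi>(3)[of \<xi>] by (intro mult_mono) auto
    qed
    also have "\<dots> = ?e * (\<psi> y - \<psi> x)" by (simp add: algebra_simps)
    also have "\<dots> \<le> ?e * (2 * K)"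
      using \<psi>(2)[of x] \<psi>(2)[of y] by (intro mult_left_mono) auto
    finally have "norm (G x) \<le> norm (G y) + ?e * (2 * K)"
      using norm_triangle_ineq2[of "G x" "G y"] by (simp add: norm_minus_commute)
    moreover have "norm (G x) = ?e * norm (g x)" by (simp add: G_def norm_mult)
    moreover have "norm (G y) \<le> ?e * norm (g y)"
    proof -
      have "Re \<mu> * \<phi> x \<le> Re \<mu> * \<phi> y" using that \<mu> by (intro mult_left_mono mono) auto
      then show ?thesis by (simp add: G_def norm_mult mult_right_mono)
    qed
    ultimately have "?e * norm (g x) \<le> ?e * (norm (g y) + 2 * K)" by (simp add: algebra_simps)
    then show ?thesis by simp
  qed
  then have "\<forall>\<^sub>F y in at_top. norm (g x) \<le> norm (g y) + 2 * K"
    by (rule eventually_mono[OF eventually_gt_at_top[of x]])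
  moreover have "((\<lambda>y. norm (g y) + 2 * K) \<longlongrightarrow> norm (0::complex) + 2 * K) at_top"
    by (intro tendsto_intros lim)
  ultimately have "norm (g x) \<le> norm (0::complex) + 2 * K"
    by (intro tendsto_lowerbound[of _ _ at_top]) auto
  then show ?thesis by simp
qed

lemma ode_bound:
  fixes g h :: "real \<Rightarrow> complex" and \<phi> :: "real \<Rightarrow> real"
  assumes g: "\<And>x. (g has_vector_derivative \<mu> * of_real (\<phi>' x) * g x + h x) (at x)"
    and \<phi>: "\<And>x. (\<phi> has_real_derivative \<phi>' x) (at x)" "\<And>x. \<phi>' x \<ge> 0"
    and h: "\<And>x. norm (h x) \<le> C * decay_weight p x" and p: "p > 1" and C: "C \<ge> 0"
    and lim: "(g \<longlongrightarrow> 0) (far_end \<mu>)"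
  shows "norm (g x) \<le> C * (2 / (p - 1))"
proof -
  let ?\<psi> = "\<lambda>x. C * weight_primitive p x"
  have \<psi>: "(?\<psi> has_real_derivative C * decay_weight p x) (at x)" "\<bar>?\<psi> x\<bar> \<le> C * (1 / (p - 1))" for x
    using weight_primitive_deriv[OF p] weight_primitive_bound[OF p, of x] C
    unfolding abs_mult by (auto intro!: DERIV_cmult mult_left_mono simp del: times_divide_eq_right)
  have "norm (g x) \<le> 2 * (C * (1 / (p - 1)))"
  proof (cases "Re \<mu> \<ge> 0")
    case True
    then show ?thesis
      using lim by (intro ode_bound_at_top[OF g \<phi> \<psi> h]) (auto simp: far_end_def)
  next
    case False
    have "norm (g (- (- x))) \<le> 2 * (C * (1 / (p - 1)))"
    \<comment> \<open>Reflection of the line interchanges the two ends and changes the sign of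
      \<mu>; the phase - \<phi>(- x) is again nondecreasing, and the weight is even.\<close>
    proof (rule ode_bound_at_top[where g = "\<lambda>x. g (- x)" and \<psi> = ?\<psi> and x = "- x" and \<mu> = "- \<mu>" and \<phi> = "\<lambda>x. - \<phi> (- x)" and \<phi>' = "\<lambda>x. \<phi>' (- x)" and h = "\<lambda>x. - h (- x)"])
      show "((\<lambda>x. g (- x)) has_vector_derivative - \<mu> * of_real (\<phi>' (- x)) * g (- x) + - h (- x)) (at x)" for x
      proof -
        have "(g has_vector_derivative \<mu> * of_real (\<phi>' (- x)) * g (- x) + h (- x)) (at (- x))" by (rule g)
        then have "((g \<circ> uminus) has_vector_derivative (-1) *\<^sub>R (\<mu> * of_real (\<phi>' (- x)) * g (- x) + h (- x))) (at x)"
          by (intro vector_diff_chain_at) (auto intro!: derivative_eq_intros)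
        then show ?thesis by (simp add: o_def)
      qed
      show "((\<lambda>x. - \<phi> (- x)) has_real_derivative \<phi>' (- x)) (at x)" for x
      proof -
        have "((\<lambda>x. \<phi> (- x)) has_real_derivative \<phi>' (- x) * - 1) (at x)"
          by (rule DERIV_chain2[OF \<phi>(1)]) (auto intro!: derivative_eq_intros)
        from DERIV_minus[OF this] show ?thesis by simp
      qed
      show "(?\<psi> has_real_derivative C * decay_weight p x) (at x)" "\<bar>?\<psi> x\<bar> \<le> C * (1 / (p - 1))" for x by (rule \<psi>)+
      show "norm (- h (- x)) \<le> C * decay_weight p x" for x
        using h[of "- x"] by (simp add: decay_weight_minus)
      show "((\<lambda>x. g (- x)) \<longlongrightarrow> 0) at_top"
        using lim False by (simp add: far_end_def filterlim_at_bot_mirror)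
    qed (use \<phi> False in auto)
    then show ?thesis by simp
  qed
  then show ?thesis by (simp add: field_simps)
qed

text \<open>The supremum over all components and points is finite by hypothesis, so Sup \<le> 1 +
  Sup/2 may be solved for it. The result no longer depends on the unknown bounds of the individual
  components.\<close>

lemma bootstrap_bound:
  fixes m :: "'i::finite \<Rightarrow> 'x \<Rightarrow> complex" and \<delta> :: "'i \<Rightarrow> complex"
  assumes bdd: "\<And>j. bounded (range (m j))" and \<delta>: "\<And>j. norm (\<delta> j) \<le> 1"
    and \<epsilon>: "\<epsilon> \<le> 1 / 2" "\<epsilon> \<ge> 0"
    and step: "\<And>B j x. B \<ge> 0 \<Longrightarrow> (\<And>j x. norm (m j x) \<le> B) \<Longrightarrow> norm (m j x - \<delta> j) \<le> \<epsilon> * B"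
  shows "norm (m j x - \<delta> j) \<le> 2 * \<epsilon>" "norm (m j x) \<le> 2"
proof -
  define R where "R = (\<lambda>p. norm (m (fst p) (snd p))) ` UNIV"
  have "\<forall>j. \<exists>b. \<forall>x. norm (m j x) \<le> b"
    using bdd unfolding bounded_iff by (metis rangeI)
  then obtain b where b: "\<And>j x. norm (m j x) \<le> b j" by metis
  have "bdd_above R"
    unfolding R_def
  proof (rule bdd_aboveI2)
    fix p :: "'i \<times> 'x"
    have "norm (m (fst p) (snd p)) \<le> b (fst p)" by (rule b)
    also have "b (fst p) \<le> (\<Sum>j\<in>UNIV. \<bar>b j\<bar>)"
      by (rule order_trans[OF abs_ge_self member_le_sum[of _ _ "\<lambda>j. \<bar>b j\<bar>"]]) auto
    finally show "norm (m (fst p) (snd p)) \<le> (\<Sum>j\<in>UNIV. \<bar>b j\<bar>)" .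
  qed
  then have sup: "norm (m j x) \<le> Sup R" for j x
    unfolding R_def by (intro cSup_upper) (auto intro!: image_eqI[of _ _ "(j, x)"])
  have S0: "Sup R \<ge> 0" using sup[of j x] norm_ge_zero order_trans by blast
  have "norm (m j x) \<le> 1 + 1 / 2 * Sup R" for j x
  proof -
    have "norm (m j x) \<le> norm (\<delta> j) + norm (m j x - \<delta> j)"
      using norm_triangle_ineq[of "\<delta> j" "m j x - \<delta> j"] by simp
    also have "\<dots> \<le> 1 + \<epsilon> * Sup R" by (intro add_mono \<delta> step S0 sup)
    also have "\<dots> \<le> 1 + 1 / 2 * Sup R" using \<epsilon> S0 by (intro add_left_mono mult_right_mono)
    finally show ?thesis .
  qed
  then have "Sup R \<le> 1 + 1 / 2 * Sup R"
    unfolding R_def by (intro cSup_least) auto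
  then have "Sup R \<le> 2" by simp
  then have 2: "norm (m j x) \<le> 2" for j x using sup[of j x] by simp
  show "norm (m j x) \<le> 2" by (rule 2)
  show "norm (m j x - \<delta> j) \<le> 2 * \<epsilon>" using step[of 2 j x] 2 by (simp add: mult.commute)
qed

section \<open>Volterra equations with an endpoint at infinity\<close>

context
  fixes \<phi> \<phi>' :: "real \<Rightarrow> real" and G g :: "real \<Rightarrow> complex" and \<mu> \<delta> :: complex and e :: ereal and C p :: real
  assumes \<phi>: "\<And>x. (\<phi> has_real_derivative \<phi>' x) (at x)" "\<And>x. \<phi>' x \<ge> 0"
    and e: "e = (if Re \<mu> \<ge> 0 then \<infinity> else -\<infinity>)"
    and int: "\<And>x. interval_lebesgue_integrable lborel e (ereal x) (\<lambda>\<xi>. exp (\<mu> * of_real (\<phi> x - \<phi> \<xi>)) * G \<xi>)"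
    and eq: "\<And>x. g x = \<delta> + (LBINT \<xi>=e..ereal x. exp (\<mu> * of_real (\<phi> x - \<phi> \<xi>)) * G \<xi>)"
begin

text \<open>The dependence on the outer variable factors out of the exponential. What remains is an
  ordinary integral from the finite point \<open>a\<close> plus a constant \<open>c\<close>
  collecting the improper part, so both kinds of endpoint are treated alike.\<close>

lemma volterra_local:
  obtains c where "\<And>x. a \<le> x \<Longrightarrow> (\<lambda>\<xi>. exp (\<mu> * of_real (\<phi> a - \<phi> \<xi>)) * G \<xi>) integrable_on {a..x}"
    "\<And>x. a \<le> x \<Longrightarrow> g x = \<delta> + exp (\<mu> * of_real (\<phi> x - \<phi> a)) * (c + integral {a..x} (\<lambda>\<xi>. exp (\<mu> * of_real (\<phi> a - \<phi> \<xi>)) * G \<xi>))"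
proof -
  define f where "f \<xi> = exp (\<mu> * of_real (\<phi> a - \<phi> \<xi>)) * G \<xi>" for \<xi>
  have f: "exp (\<mu> * of_real (\<phi> x - \<phi> \<xi>)) * G \<xi> = exp (\<mu> * of_real (\<phi> x - \<phi> a)) * f \<xi>" for x \<xi>
    unfolding f_def mult.assoc[symmetric] exp_add[symmetric] by (simp add: algebra_simps)
  have fi: "interval_lebesgue_integrable lborel e (ereal x) f" for x
  proof -
    have "f = (\<lambda>\<xi>. exp (\<mu> * of_real (\<phi> a - \<phi> x)) * (exp (\<mu> * of_real (\<phi> x - \<phi> \<xi>)) * G \<xi>))"
      unfolding f_def mult.assoc[symmetric] exp_add[symmetric] by (simp add: algebra_simps)
    then show ?thesis using interval_lebesgue_integrable_mult_right[OF int[of x]] by simp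
  qed
  have gx: "g x = \<delta> + exp (\<mu> * of_real (\<phi> x - \<phi> a)) * (LBINT \<xi>=e..ereal x. f \<xi>)" for x
    unfolding eq[of x] f by simp
  have fax: "set_integrable lborel {a..x} f" "(LBINT \<xi>=e..ereal x. f \<xi>) = (LBINT \<xi>=e..ereal a. f \<xi>) + integral {a..x} f"
    if "a \<le> x" for x
  proof -
    \<comment> \<open>The unit of slack on both sides lets one open interval fit into either
      half-line of integrability while still containing the closed interval.\<close>
    have "set_integrable lborel (einterval (ereal (a - 1)) (ereal (x + 1))) f"
    proof (cases "Re \<mu> \<ge> 0")
      case True
      then have "set_integrable lborel (einterval (ereal (a - 1)) \<infinity>) f"
        using fi[of "a - 1"] by (simp add: e interval_lebesgue_integrable_def)
      then show ?thesis by (rule set_integrable_subset) (auto simp: einterval_def)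
    next
      case False
      then have "set_integrable lborel (einterval (-\<infinity>) (ereal (x + 1))) f"
        using fi[of "x + 1"] by (simp add: e interval_lebesgue_integrable_def)
      then show ?thesis by (rule set_integrable_subset) (auto simp: einterval_def)
    qed
    then show s: "set_integrable lborel {a..x} f"
      by (rule set_integrable_subset) (auto simp: einterval_def)
    have "(LBINT \<xi>=e..ereal a. f \<xi>) + (LBINT \<xi>=ereal a..ereal x. f \<xi>) = (LBINT \<xi>=e..ereal x. f \<xi>)"
    proof (rule interval_integral_sum)
      show "interval_lebesgue_integrable lborel (min e (min (ereal a) (ereal x))) (max e (max (ereal a) (ereal x))) f"
        using fi[of a] fi[of x] that by (auto simp: e interval_lebesgue_integrable_def min_def max_def)
    qed
    then show "(LBINT \<xi>=e..ereal x. f \<xi>) = (LBINT \<xi>=e..ereal a. f \<xi>) + integral {a..x} f"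
      using interval_integral_eq_integral[OF that s] by simp
  qed
  show ?thesis
  proof (rule that[of "LBINT \<xi>=e..ereal a. f \<xi>"])
    fix x assume x: "a \<le> x"
    show "(\<lambda>\<xi>. exp (\<mu> * of_real (\<phi> a - \<phi> \<xi>)) * G \<xi>) integrable_on {a..x}"
      using set_borel_integral_eq_integral(1)[OF fax(1)[OF x]] by (simp add: f_def[abs_def])
    show "g x = \<delta> + exp (\<mu> * of_real (\<phi> x - \<phi> a)) * ((LBINT \<xi>=e..ereal a. f \<xi>) + integral {a..x} (\<lambda>\<xi>. exp (\<mu> * of_real (\<phi> a - \<phi> \<xi>)) * G \<xi>))"
      using gx[of x] fax(2)[OF x] by (simp add: f_def[abs_def])
  qed
qed

text \<open>Only local integrability of \<open>G\<close> enters. For the eigenfunctions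
  \<open>G\<close> is built from the solutions themselves, so this is the first half of a bootstrap:
  it makes \<open>G\<close> continuous, and \<open>volterra_deriv\<close> then gives
  differentiability.\<close>

lemma volterra_continuous: "isCont g x"
proof -
  obtain c where c: "\<And>y. x - 1 \<le> y \<Longrightarrow> (\<lambda>\<xi>. exp (\<mu> * of_real (\<phi> (x - 1) - \<phi> \<xi>)) * G \<xi>) integrable_on {x - 1..y}"
    "\<And>y. x - 1 \<le> y \<Longrightarrow> g y = \<delta> + exp (\<mu> * of_real (\<phi> y - \<phi> (x - 1))) * (c + integral {x - 1..y} (\<lambda>\<xi>. exp (\<mu> * of_real (\<phi> (x - 1) - \<phi> \<xi>)) * G \<xi>))"
    by (rule volterra_local[of "x - 1"]) blast
  have "continuous_on {x - 1..x + 1} \<phi>"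
    using \<phi>(1) by (meson continuous_at_imp_continuous_on DERIV_isCont)
  moreover have "continuous_on {x - 1..x + 1} (\<lambda>y. integral {x - 1..y} (\<lambda>\<xi>. exp (\<mu> * of_real (\<phi> (x - 1) - \<phi> \<xi>)) * G \<xi>))"
    by (rule indefinite_integral_continuous_1, rule c(1)) simp
  ultimately have "continuous_on {x - 1..x + 1} (\<lambda>y. \<delta> + exp (\<mu> * of_real (\<phi> y - \<phi> (x - 1))) *
      (c + integral {x - 1..y} (\<lambda>\<xi>. exp (\<mu> * of_real (\<phi> (x - 1) - \<phi> \<xi>)) * G \<xi>)))"
    by (intro continuous_intros)
  then have "continuous_on {x - 1..x + 1} g"
    by (rule continuous_on_eq) (use c(2) in auto)
  then show ?thesis
    by (rule continuous_on_interior) auto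
qed

lemma volterra_deriv:
  assumes G: "continuous_on UNIV G"
  shows "(g has_vector_derivative \<mu> * of_real (\<phi>' x) * (g x - \<delta>) + G x) (at x)"
proof -
  define a where "a = x - 1"
  obtain c where c: 
    "\<And>y. a \<le> y \<Longrightarrow> g y = \<delta> + exp (\<mu> * of_real (\<phi> y - \<phi> a)) * (c + integral {a..y} (\<lambda>\<xi>. exp (\<mu> * of_real (\<phi> a - \<phi> \<xi>)) * G \<xi>))"
    by (rule volterra_local[of a]) blast
  let ?f = "\<lambda>\<xi>. exp (\<mu> * of_real (\<phi> a - \<phi> \<xi>)) * G \<xi>"
  let ?h = "\<lambda>y. \<delta> + exp (\<mu> * of_real (\<phi> y - \<phi> a)) * (c + integral {a..y} ?f)"
  have "continuous_on {a..x + 1} \<phi>"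
    using \<phi>(1) by (meson continuous_at_imp_continuous_on DERIV_isCont)
  then have "continuous_on {a..x + 1} ?f"
    by (intro continuous_intros continuous_on_subset[OF G]) auto
  then have "((\<lambda>y. integral {a..y} ?f) has_vector_derivative ?f x) (at x within {a..x + 1})"
    by (rule integral_has_vector_derivative) (auto simp: a_def)
  moreover have "at x within {a..x + 1} = at x"
    by (rule at_within_Icc_at) (auto simp: a_def)
  ultimately have I: "((\<lambda>y. c + integral {a..y} ?f) has_vector_derivative ?f x) (at x)"
    by (auto intro!: derivative_eq_intros)
  have "((\<lambda>y. \<mu> * of_real (\<phi> y - \<phi> a)) has_vector_derivative \<mu> * of_real (\<phi>' x)) (at x)"
    using DERIV_diff[OF \<phi>(1)[of x] DERIV_const[of "\<phi> a"]]
    by (intro has_vector_derivative_mult_right has_vector_derivative_of_real)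
      (simp add: has_real_derivative_iff_has_vector_derivative)
  then have E: "((\<lambda>y. exp (\<mu> * of_real (\<phi> y - \<phi> a))) has_vector_derivative (\<mu> * of_real (\<phi>' x)) * exp (\<mu> * of_real (\<phi> x - \<phi> a))) (at x)"
    by (rule field_vector_diff_chain_at[unfolded o_def]) (auto intro: DERIV_exp)
  have "(?h has_vector_derivative 0 + (exp (\<mu> * of_real (\<phi> x - \<phi> a)) * ?f x
      + (\<mu> * of_real (\<phi>' x)) * exp (\<mu> * of_real (\<phi> x - \<phi> a)) * (c + integral {a..x} ?f))) (at x)"
    by (intro has_vector_derivative_add has_vector_derivative_const has_vector_derivative_mult E I)
  moreover have m1: "exp (\<mu> * of_real (\<phi> x - \<phi> a)) * ?f x = G x"
    unfolding mult.assoc[symmetric] exp_add[symmetric] by (simp add: algebra_simps)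
  moreover have "(\<mu> * of_real (\<phi>' x)) * exp (\<mu> * of_real (\<phi> x - \<phi> a)) * (c + integral {a..x} ?f)
      = \<mu> * of_real (\<phi>' x) * (g x - \<delta>)"
    unfolding mult.assoc using c[of x] by (simp add: a_def)
  ultimately have "(?h has_vector_derivative \<mu> * of_real (\<phi>' x) * (g x - \<delta>) + G x) (at x)"
    by (simp only: add_0_left add.commute)
  then show ?thesis
    by (rule has_vector_derivative_transform_within_open[where S = "{a<..}"]) (use c in \<open>auto simp: a_def\<close>)
qed

text \<open>Between \<open>x\<close> and the endpoint \<open>e\<close> the exponential has modulus
  at most 1, so \<open>g x - \<delta>\<close> is bounded by the tail of an integrable
  weight.\<close>

lemma volterra_limit:
  assumes G: "\<And>\<xi>. norm (G \<xi>) \<le> C * decay_weight p \<xi>" and p: "p > 1"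
  shows "(g \<longlongrightarrow> \<delta>) (far_end \<mu>)"
proof -
  have mono: "\<phi> a \<le> \<phi> b" if "a \<le> b" for a b
    by (rule DERIV_nonneg_imp_nondecreasing[OF that]) (use \<phi> in blast)
  have bound: "norm (exp (\<mu> * of_real (\<phi> x - \<phi> \<xi>)) * G \<xi>) \<le> C * decay_weight p \<xi>"
    if "Re \<mu> * (\<phi> x - \<phi> \<xi>) \<le> 0" for x \<xi>
  proof -
    have "norm (exp (\<mu> * of_real (\<phi> x - \<phi> \<xi>))) \<le> 1" using that by simp
    from mult_mono[OF this G[of \<xi>]] show ?thesis by (simp add: norm_mult)
  qed
  have "((\<lambda>x. g x - \<delta>) \<longlongrightarrow> 0) (far_end \<mu>)"
  proof (cases "Re \<mu> \<ge> 0")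
    case True
    have "norm (g x - \<delta>) \<le> C * (1 / (p - 1) - weight_primitive p x)" for x
    proof -
      have "norm (LBINT \<xi>=ereal x..\<infinity>. exp (\<mu> * of_real (\<phi> x - \<phi> \<xi>)) * G \<xi>) \<le> C * (1 / (p - 1) - weight_primitive p x)"
        using int[of x] True
        by (intro right_integral_bound[OF p] bound mult_nonneg_nonpos)
          (auto simp: e interval_lebesgue_integrable_def mono)
      moreover have "g x - \<delta> = - (LBINT \<xi>=ereal x..\<infinity>. exp (\<mu> * of_real (\<phi> x - \<phi> \<xi>)) * G \<xi>)"
        unfolding eq[of x] using True
        by (subst interval_integral_endpoints_reverse) (simp add: e)
      ultimately show ?thesis by simp
    qed
    moreover have "((\<lambda>x. C * (1 / (p - 1) - weight_primitive p x)) \<longlongrightarrow> C * (1 / (p - 1) - 1 / (p - 1))) at_top"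
      by (intro tendsto_intros weight_primitive_at_top p)
    ultimately show ?thesis
      using True by (simp add: far_end_def Lim_null_comparison[OF always_eventually, where g = "\<lambda>x. C * (1 / (p - 1) - weight_primitive p x)"])
  next
    case False
    have "norm (g x - \<delta>) \<le> C * (weight_primitive p x + 1 / (p - 1))" for x
    proof -
      have "norm (LBINT \<xi>=-\<infinity>..ereal x. exp (\<mu> * of_real (\<phi> x - \<phi> \<xi>)) * G \<xi>) \<le> C * (weight_primitive p x + 1 / (p - 1))"
        using int[of x] False
        by (intro left_integral_bound[OF p] bound mult_nonpos_nonneg)
          (auto simp: e interval_lebesgue_integrable_def mono)
      then show ?thesis
        unfolding eq[of x] using False by (simp add: e)
    qed
    moreover have "((\<lambda>x. C * (weight_primitive p x + 1 / (p - 1))) \<longlongrightarrow> C * (- (1 / (p - 1)) + 1 / (p - 1))) at_bot"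
      by (intro tendsto_intros weight_primitive_at_bot p)
    ultimately show ?thesis
      using False by (simp add: far_end_def Lim_null_comparison[OF always_eventually, where g = "\<lambda>x. C * (weight_primitive p x + 1 / (p - 1))"])
  qed
  then show ?thesis by (simp add: LIM_zero_iff)
qed

end

section \<open>Cube roots of unity and the contour\<close>

definition om :: "3 \<Rightarrow> complex" where "om j = lam 1 $ j"

lemma om_simps [simp]: "om 1 = omega" "om 2 = omega ^ 2" "om 3 = 1"
  by (simp_all add: om_def lam_def)

lemma lam_om: "lam z $ j = z * om j"
  using exhaust_3[of j] by (auto simp: om_def lam_def)

lemma om_cube: "om j ^ 3 = 1"
proof -
  have "(omega ^ 2) ^ 3 = (omega ^ 3) ^ 2" by (metis power_mult mult.commute)
  then show ?thesis using exhaust_3[of j] by auto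
qed

lemma norm_om [simp]: "norm (om j) = 1"
  using exhaust_3[of j] by (auto simp: norm_power)

lemma om_nonzero [simp]: "om j \<noteq> 0"
  using norm_om[of j] by force

lemma omega_fourth: "omega ^ 4 = omega"
  using omega_cube by (simp add: eval_nat_numeral)

lemma sum_om [simp]: "(\<Sum>j\<in>UNIV. om j) = 0" "(\<Sum>j\<in>UNIV. om j ^ 2) = 0"
proof -
  have "(omega ^ 2) ^ 2 = omega" by (simp add: omega_fourth flip: power_mult)
  then show "(\<Sum>j\<in>UNIV. om j) = 0" "(\<Sum>j\<in>UNIV. om j ^ 2) = 0"
    unfolding sum_3 om_simps by (simp_all add: omega_square)
qed

lemma norm_om_diff: "norm (om j - om k) \<le> 2"
  using norm_triangle_ineq4[of "om j" "om k"] by simp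

text \<open>The differences of the cube roots of unity point along \<open>\<i> \<omega>\<^sup>k\<close>, so that the lines of the
  contour are where two of the \<open>\<lambda>\<^sub>j\<close> have equal real part.\<close>

lemma Re_om_distinct:
  assumes z: "z \<notin> contour" and jl: "j \<noteq> l"
  shows "Re (z * (om j - om l)) \<noteq> 0"
proof
  assume *: "Re (z * (om j - om l)) = 0"
  have w: "omega ^ 2 = Complex (-1/2) (- sqrt 3 / 2)"
    by (simp add: omega_eq complex_eq_iff power2_eq_square)
  have L: "z \<in> ray_line k \<Longrightarrow> k < 3 \<Longrightarrow> False" for k
    using z by (auto simp: contour_eq)
  have r0: "z \<in> ray_line 0 \<longleftrightarrow> Im z = 0" by (simp add: ray_line_def)
  have r1: "z \<in> ray_line 1 \<longleftrightarrow> Im z + sqrt 3 * Re z = 0"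
    unfolding ray_line_def Im_div_omega by (auto simp: inner_complex_def omega_eq algebra_simps)
  have r2: "z \<in> ray_line 2 \<longleftrightarrow> Im z = sqrt 3 * Re z"
    unfolding ray_line_def Im_div_omega unfolding w by (auto simp: inner_complex_def algebra_simps)
  have v: "Re (om 1) = - 1 / 2" "Im (om 1) = sqrt 3 / 2" "Re (om 2) = - 1 / 2" "Im (om 2) = - sqrt 3 / 2"
    "Re (om 3) = 1" "Im (om 3) = 0"
    unfolding om_simps w by (simp_all add: omega_eq)
  have "Re z * (Re (om j) - Re (om l)) = Im z * (Im (om j) - Im (om l))"
    using * by (simp del: om_simps)
  then consider "sqrt 3 * Im z = 0" | "3 * Re z + sqrt 3 * Im z = 0" | "3 * Re z - sqrt 3 * Im z = 0"
    using jl exhaust_3[of j] exhaust_3[of l]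
    by (elim disjE) (simp_all add: v algebra_simps del: om_simps)
  then have "Im z = 0 \<or> Im z + sqrt 3 * Re z = 0 \<or> Im z = sqrt 3 * Re z"
  proof cases
    case 2
    then have "sqrt 3 * (Im z + sqrt 3 * Re z) = 0" by (simp add: distrib_left mult.assoc[symmetric])
    then show ?thesis by simp
  next
    case 3
    then have "sqrt 3 * (Im z - sqrt 3 * Re z) = 0" by (simp add: right_diff_distrib mult.assoc[symmetric])
    then show ?thesis by simp
  qed simp
  then show False using L[of 0] L[of 1] L[of 2] r0 r1 r2 by auto
qed

lemma far_end_zero [simp]: "far_end 0 = at_top"
  by (simp add: far_end_def)

lemma tendsto_far_end:
  assumes "(f \<longlongrightarrow> c) at_top" "(f \<longlongrightarrow> c) at_bot"
  shows "(f \<longlongrightarrow> c) (far_end \<mu>)"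
  using assms by (simp add: far_end_def)

lemma decay_weight_far_end: "p > 0 \<Longrightarrow> (decay_weight p \<longlongrightarrow> 0) (far_end \<mu>)"
  by (simp add: tendsto_far_end decay_weight_at_top decay_weight_at_bot)

lemma norm_sum_3_le:
  fixes f :: "3 \<Rightarrow> complex"
  assumes "\<And>k. norm (f k) \<le> B"
  shows "norm (\<Sum>k\<in>UNIV. f k) \<le> 3 * B"
  using sum_norm_bound[of "UNIV :: 3 set" f B] assms by simp

section \<open>Estimates near \<open>z = 0\<close>, uniform in \<open>x\<close>\<close>

context wave_solution
begin

lemma wt_far_end: "((\<lambda>x. C * wt x) \<longlongrightarrow> 0) (far_end \<mu>)"
  using tendsto_mult[OF tendsto_const decay_weight_far_end[of decay_exponent \<mu>], of C] decay_exponent(1) by simp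

text \<open>Close to \<open>z = 0\<close> the system for the rescaled eigenfunctions is a perturbation of size \<open>|z|\<close> of
  the free one. The gain in the column sums comes from the gauge term \<open>z \<omega>\<^sup>j u\<^sub>x / 3\<close>, which cancels
  the leading part of the perturbation and drops out of the sum as \<open>1 + \<omega> + \<omega>\<^sup>2 = 0\<close>.\<close>

lemma small_z:
  obtains C where "C > 0"
    "\<And>t z l E j x. \<lbrakk>t \<in> {0..T}; C * norm z \<le> 1;
      \<And>j x. (E j has_vector_derivative z * (om j - om l) * E j x
               - z * of_real (D 2 x t) * (om j / 3) * (\<Sum>k\<in>UNIV. E k x)) (at x);
      \<And>j. bounded (range (E j));
      \<And>j. (E j \<longlongrightarrow> (if j = l then 1 else 0)) (far_end (z * (om j - om l)))\<rbrakk>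
      \<Longrightarrow> norm (E j x - (if j = l then 1 else 0)) \<le> C * norm z
        \<and> norm ((\<Sum>j\<in>UNIV. E j x) - 1) \<le> C * (norm z)\<^sup>2"
proof -
  define p where "p = decay_exponent"
  have p: "p > 1" using decay_exponent(1) by (simp add: p_def)
  obtain C2 where C2: "C2 \<ge> 0" "\<And>x t. t \<in> {0..T} \<Longrightarrow> \<bar>D 2 x t\<bar> \<le> C2 * wt x"
    by (rule D_bound) blast
  obtain C1 where C1: "C1 \<ge> 0" "\<And>x t. t \<in> {0..T} \<Longrightarrow> \<bar>D 1 x t\<bar> \<le> C1 * wt x"
    by (rule D_bound) blast
  \<comment> \<open>\<open>A\<close> comes from \<open>ode_bound\<close> applied to the perturbation
    with u_xx, \<open>A'\<close> from its application after the gauge, the factor 3 there being the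
    number of components. The choice of \<open>C\<close> makes \<open>A * norm z\<close> at most
    1/2, as the bootstrap requires.\<close>
  define A where "A = C2 * (2 / (p - 1))"
  define A' where "A' = 3 * ((2 * C1 + C2 * (6 * A)) * (2 / (p - 1)))"
  have A: "A \<ge> 0" using C2 p by (simp add: A_def)
  have A': "A' \<ge> 0" using C2 C1 p A by (simp add: A'_def)
  define C where "C = 2 * A + A' + 1"
  have C: "C > 0" using A A' by (simp add: C_def)
  show ?thesis
  proof (rule that[OF C])
    fix t :: real and z l E j x
    assume t: "t \<in> {0..T}" and z: "C * norm z \<le> 1"
      and E: "\<And>j x. (E j has_vector_derivative z * (om j - om l) * E j x
               - z * of_real (D 2 x t) * (om j / 3) * (\<Sum>k\<in>UNIV. E k x)) (at x)"
      and bdd: "\<And>j. bounded (range (E j))"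
      and lim: "\<And>j. (E j \<longlongrightarrow> (if j = l then 1 else 0)) (far_end (z * (om j - om l)))"
    let ?\<delta> = "\<lambda>j. (if j = l then 1 else 0) :: complex"
    have "2 * A * norm z \<le> C * norm z" using A A' by (intro mult_right_mono) (auto simp: C_def)
    then have \<epsilon>: "A * norm z \<le> 1 / 2" using z by simp
    have near: "norm (E j x - ?\<delta> j) \<le> 2 * (A * norm z)" for j x
    proof (rule bootstrap_bound(1)[where m = E, OF bdd _ \<epsilon>])
      show "norm (?\<delta> j) \<le> 1" for j by simp
      show "0 \<le> A * norm z" using A by simp
      fix B j x assume B: "B \<ge> 0" "\<And>j x. norm (E j x) \<le> B"
      have "norm (E j x - ?\<delta> j) \<le> (C2 * norm z * B) * (2 / (p - 1))"
      proof (rule ode_bound[where \<mu> = "z * (om j - om l)" and \<phi> = "\<lambda>x. x" and \<phi>' = "\<lambda>_. 1" and p = p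
            and h = "\<lambda>x. - (z * of_real (D 2 x t) * (om j / 3) * (\<Sum>k\<in>UNIV. E k x))"])
        show "((\<lambda>x. E j x - ?\<delta> j) has_vector_derivative z * (om j - om l) * of_real 1 * (E j x - ?\<delta> j)
            + - (z * of_real (D 2 x t) * (om j / 3) * (\<Sum>k\<in>UNIV. E k x))) (at x)" for x
          using has_vector_derivative_diff[OF E[of j x] has_vector_derivative_const[of "?\<delta> j"]]
          by (auto simp: algebra_simps split: if_splits)
        show "norm (- (z * of_real (D 2 x t) * (om j / 3) * (\<Sum>k\<in>UNIV. E k x))) \<le> C2 * norm z * B * decay_weight p x" for x
        proof -
          have "norm (\<Sum>k\<in>UNIV. E k x) \<le> 3 * B" by (intro norm_sum_3_le B)
          then have "norm z * \<bar>D 2 x t\<bar> * (1 / 3) * norm (\<Sum>k\<in>UNIV. E k x) \<le> norm z * (C2 * wt x) * (1 / 3) * (3 * B)"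
            using C2(2)[OF t, of x] C2(1) by (intro mult_mono) auto
          then show ?thesis by (simp add: norm_mult norm_divide p_def mult_ac)
        qed
        show "((\<lambda>x. E j x - ?\<delta> j) \<longlongrightarrow> 0) (far_end (z * (om j - om l)))"
          using lim[of j] by (rule LIM_zero)
      qed (use p C2 B in auto)
      then show "norm (E j x - ?\<delta> j) \<le> A * norm z * B" by (simp add: A_def mult_ac)
    qed
    have "2 * (A * norm z) \<le> C * norm z"
      using A A' by (simp add: C_def algebra_simps)
    then have 1: "norm (E j x - ?\<delta> j) \<le> C * norm z" using near[of j x] by linarith
    have sumE: "norm ((\<Sum>k\<in>UNIV. E k x) - 1) \<le> 6 * A * norm z" for x
    proof -
      have "norm (\<Sum>k\<in>UNIV. E k x - ?\<delta> k) \<le> 3 * (2 * (A * norm z))" by (intro norm_sum_3_le near)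
      then show ?thesis by (simp add: sum_subtractf)
    qed
    \<comment> \<open>The derivative of the added term replaces the column sum in the perturbation
      by its deviation from 1, which is O(z) by \<open>sumE\<close>. The price is a commutator term
      with z^2 u_x, so the whole inhomogeneity is quadratic in \<open>z\<close>.\<close>
    define N where "N j x = E j x + z * (om j / 3) * of_real (D 1 x t)" for j x
    have N: "norm (N j x - ?\<delta> j) \<le> (2 * C1 + C2 * (6 * A)) * (norm z)\<^sup>2 * (2 / (p - 1))" for j x
    proof (rule ode_bound[where \<mu> = "z * (om j - om l)" and \<phi> = "\<lambda>x. x" and \<phi>' = "\<lambda>_. 1" and p = p
            and h = "\<lambda>x. - (z\<^sup>2 * (om j - om l) * (om j / 3) * of_real (D 1 x t))
              - z * of_real (D 2 x t) * (om j / 3) * ((\<Sum>k\<in>UNIV. E k x) - 1)"])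
      show "((\<lambda>x. N j x - ?\<delta> j) has_vector_derivative z * (om j - om l) * of_real 1 * (N j x - ?\<delta> j)
            + (- (z\<^sup>2 * (om j - om l) * (om j / 3) * of_real (D 1 x t))
              - z * of_real (D 2 x t) * (om j / 3) * ((\<Sum>k\<in>UNIV. E k x) - 1))) (at x)" for x
      proof -
        have "((\<lambda>x. D 1 x t) has_real_derivative D 2 x t) (at x)"
          using D_deriv[of t 1 x] t by (simp add: numeral_2_eq_2)
        then have "((\<lambda>x. z * (om j / 3) * of_real (D 1 x t)) has_vector_derivative z * (om j / 3) * of_real (D 2 x t)) (at x)"
          by (intro has_vector_derivative_mult_right has_vector_derivative_of_real)
            (simp add: has_real_derivative_iff_has_vector_derivative)
        from has_vector_derivative_diff[OF has_vector_derivative_add[OF E[of j x] this] has_vector_derivative_const[of "?\<delta> j"]]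
        show ?thesis
          unfolding N_def
          by (rule has_vector_derivative_eq_rhs) (cases "j = l"; simp add: field_simps power2_eq_square)
      qed
      show "norm (- (z\<^sup>2 * (om j - om l) * (om j / 3) * of_real (D 1 x t))
              - z * of_real (D 2 x t) * (om j / 3) * ((\<Sum>k\<in>UNIV. E k x) - 1))
            \<le> (2 * C1 + C2 * (6 * A)) * (norm z)\<^sup>2 * decay_weight p x" for x
      proof -
        have "(norm z)\<^sup>2 * norm (om j - om l) * (1 / 3) * \<bar>D 1 x t\<bar> \<le> (norm z)\<^sup>2 * 2 * 1 * (C1 * wt x)"
          using C1(2)[OF t, of x] norm_om_diff by (intro mult_mono) auto
        moreover have "norm z * \<bar>D 2 x t\<bar> * (1 / 3) * norm ((\<Sum>k\<in>UNIV. E k x) - 1) \<le> norm z * (C2 * wt x) * 1 * (6 * A * norm z)"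
          using C2(2)[OF t, of x] C2(1) sumE[of x] by (intro mult_mono) auto
        moreover have "norm (- (z\<^sup>2 * (om j - om l) * (om j / 3) * of_real (D 1 x t)))
            = (norm z)\<^sup>2 * norm (om j - om l) * (1 / 3) * \<bar>D 1 x t\<bar>"
          by (simp only: norm_minus_cancel norm_mult norm_divide norm_power norm_om norm_of_real norm_numeral)
        moreover have "norm (z * of_real (D 2 x t) * (om j / 3) * ((\<Sum>k\<in>UNIV. E k x) - 1))
            = norm z * \<bar>D 2 x t\<bar> * (1 / 3) * norm ((\<Sum>k\<in>UNIV. E k x) - 1)"
          by (simp only: norm_mult norm_divide norm_om norm_of_real norm_numeral)
        moreover have "(norm z)\<^sup>2 * 2 * 1 * (C1 * wt x) + norm z * (C2 * wt x) * 1 * (6 * A * norm z)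
            = (2 * C1 + C2 * (6 * A)) * (norm z)\<^sup>2 * decay_weight p x"
          by (simp add: p_def algebra_simps power2_eq_square)
        ultimately show ?thesis
          using norm_triangle_ineq4[of "- (z\<^sup>2 * (om j - om l) * (om j / 3) * of_real (D 1 x t))"
              "z * of_real (D 2 x t) * (om j / 3) * ((\<Sum>k\<in>UNIV. E k x) - 1)"] by linarith
      qed
      have "((\<lambda>x. z * (om j / 3) * of_real (D 1 x t)) \<longlongrightarrow> 0) (far_end (z * (om j - om l)))"
      proof (rule Lim_null_comparison[OF always_eventually wt_far_end[of "norm z * C1"]], rule allI)
        fix x
        have "norm z * (1 / 3) * \<bar>D 1 x t\<bar> \<le> norm z * 1 * (C1 * wt x)"
          using C1(2)[OF t, of x] by (intro mult_mono) auto
        then show "norm (z * (om j / 3) * of_real (D 1 x t)) \<le> norm z * C1 * wt x"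
          by (simp add: norm_mult norm_divide)
      qed
      from tendsto_add[OF LIM_zero[OF lim[of j]] this]
      show "((\<lambda>x. N j x - ?\<delta> j) \<longlongrightarrow> 0) (far_end (z * (om j - om l)))"
        by (simp add: N_def algebra_simps)
    qed (use p C1 C2 A in auto)
    have "norm (\<Sum>j\<in>UNIV. N j x - ?\<delta> j) \<le> 3 * ((2 * C1 + C2 * (6 * A)) * (norm z)\<^sup>2 * (2 / (p - 1)))"
      by (intro norm_sum_3_le N)
    moreover have "(\<Sum>j\<in>UNIV. z * (om j / 3) * of_real (D 1 x t)) = 0"
        using sum_om(1) by (simp add: sum_distrib_left[symmetric] sum_distrib_right[symmetric] sum_divide_distrib[symmetric])
    then have "(\<Sum>j\<in>UNIV. N j x - ?\<delta> j) = (\<Sum>j\<in>UNIV. E j x) - 1"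
      unfolding N_def by (simp add: sum_subtractf sum.distrib)
    ultimately have "norm ((\<Sum>j\<in>UNIV. E j x) - 1) \<le> A' * (norm z)\<^sup>2"
      by (simp add: A'_def algebra_simps)
    also have "\<dots> \<le> C * (norm z)\<^sup>2" using A by (intro mult_right_mono) (auto simp: C_def)
    finally show "norm (E j x - ?\<delta> j) \<le> C * norm z \<and> norm ((\<Sum>j\<in>UNIV. E j x) - 1) \<le> C * (norm z)\<^sup>2"
      using 1 by blast
  qed
qed

end

section \<open>Algebra of the perturbation \<open>U\<close>\<close>

text \<open>The constant matrix factor of \<open>U\<close>: as \<open>om k ^ 2\<close> is the
  inverse of \<open>om k\<close>, its entries are 1 - \<omega>^(j-k).\<close>

definition cmat :: "3 \<Rightarrow> 3 \<Rightarrow> complex" where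
  "cmat j k = 1 - om j * om k ^ 2"

text \<open>Solves the commutator equation [\<Lambda>(1), X] = - \<open>cmat\<close>. Off the
  diagonal this determines the entries; on the diagonal, where both sides vanish, zero is
  chosen.\<close>

definition xmat :: "3 \<Rightarrow> 3 \<Rightarrow> complex" where
  "xmat j k = (if j = k then 0 else om k ^ 2)"

lemma xmat_commutator: "xmat j k * (om j - om k) = - cmat j k"
proof -
  have "om k ^ 2 * (om j - om k) = om j * om k ^ 2 - om k ^ 3"
    by (simp add: algebra_simps power2_eq_square power3_eq_cube)
  moreover have "om j * om j ^ 2 = 1" using om_cube[of j] by (simp add: power2_eq_square power3_eq_cube mult.assoc)
  ultimately show ?thesis by (auto simp: xmat_def cmat_def om_cube)
qed

lemma cmat_simps [simp]:
  "cmat j j = 0" "cmat 1 2 = 1 - omega ^ 2" "cmat 1 3 = 1 - omega"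
  "cmat 2 1 = 1 - omega" "cmat 2 3 = 1 - omega ^ 2"
  "cmat 3 1 = 1 - omega ^ 2" "cmat 3 2 = 1 - omega"
proof -
  have "om j * om j ^ 2 = 1" using om_cube[of j] by (simp add: power2_eq_square power3_eq_cube mult.assoc)
  moreover have "(omega ^ 2) ^ 2 = omega" by (simp add: omega_fourth flip: power_mult)
  moreover have "omega * omega = omega ^ 2" "omega ^ 2 * omega ^ 2 = omega"
    by (simp_all add: omega_fourth power2_eq_square[symmetric] flip: power_add)
  ultimately show "cmat j j = 0" "cmat 1 2 = 1 - omega ^ 2" "cmat 1 3 = 1 - omega"
    "cmat 2 1 = 1 - omega" "cmat 2 3 = 1 - omega ^ 2"
    "cmat 3 1 = 1 - omega ^ 2" "cmat 3 2 = 1 - omega"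
    by (simp_all add: cmat_def)
qed

lemma norm_cmat: "norm (cmat j k) \<le> 2"
proof -
  have "norm (cmat j k) \<le> norm (1::complex) + norm (om j * om k ^ 2)"
    unfolding cmat_def by (rule norm_triangle_ineq4)
  then show ?thesis by (simp add: norm_mult norm_power)
qed

lemma norm_xmat: "norm (xmat j k) \<le> 1"
  by (simp add: xmat_def norm_power)

text \<open>Jacobi's formula for the derivative of a determinant. The matrix with entries
  \<open>a\<close>, \<open>b\<close> has zero trace, and the commutator with the diagonal matrix
  contributes the same trace twice with opposite signs.\<close>

lemma traceless_det_identity:
  fixes a b p :: complex and m d :: "3 \<Rightarrow> 3 \<Rightarrow> complex" and e :: "3 \<Rightarrow> complex"
  assumes "\<And>l. d 1 l = p * (e 1 - e l) * m 1 l + (a * m 2 l + b * m 3 l)"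
    "\<And>l. d 2 l = p * (e 2 - e l) * m 2 l + (b * m 1 l + a * m 3 l)"
    "\<And>l. d 3 l = p * (e 3 - e l) * m 3 l + (a * m 1 l + b * m 2 l)"
  shows "(d 1 1 * m 2 2 * m 3 3 + m 1 1 * d 2 2 * m 3 3 + m 1 1 * m 2 2 * d 3 3)
    + (d 1 2 * m 2 3 * m 3 1 + m 1 2 * d 2 3 * m 3 1 + m 1 2 * m 2 3 * d 3 1)
    + (d 1 3 * m 2 1 * m 3 2 + m 1 3 * d 2 1 * m 3 2 + m 1 3 * m 2 1 * d 3 2)
    - (d 1 1 * m 2 3 * m 3 2 + m 1 1 * d 2 3 * m 3 2 + m 1 1 * m 2 3 * d 3 2)
    - (d 1 2 * m 2 1 * m 3 3 + m 1 2 * d 2 1 * m 3 3 + m 1 2 * m 2 1 * d 3 3)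
    - (d 1 3 * m 2 2 * m 3 1 + m 1 3 * d 2 2 * m 3 1 + m 1 3 * m 2 2 * d 3 1) = 0"
  unfolding assms by algebra

lemma has_vector_derivative_det_3:
  fixes A :: "real \<Rightarrow> complex^3^3"
  assumes "\<And>j l. ((\<lambda>x. A x $ j $ l) has_vector_derivative d j l) (at x)"
  shows "((\<lambda>x. det (A x)) has_vector_derivative
    (d 1 1 * A x $ 2 $ 2 * A x $ 3 $ 3 + A x $ 1 $ 1 * d 2 2 * A x $ 3 $ 3 + A x $ 1 $ 1 * A x $ 2 $ 2 * d 3 3)
    + (d 1 2 * A x $ 2 $ 3 * A x $ 3 $ 1 + A x $ 1 $ 2 * d 2 3 * A x $ 3 $ 1 + A x $ 1 $ 2 * A x $ 2 $ 3 * d 3 1)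
    + (d 1 3 * A x $ 2 $ 1 * A x $ 3 $ 2 + A x $ 1 $ 3 * d 2 1 * A x $ 3 $ 2 + A x $ 1 $ 3 * A x $ 2 $ 1 * d 3 2)
    - (d 1 1 * A x $ 2 $ 3 * A x $ 3 $ 2 + A x $ 1 $ 1 * d 2 3 * A x $ 3 $ 2 + A x $ 1 $ 1 * A x $ 2 $ 3 * d 3 2)
    - (d 1 2 * A x $ 2 $ 1 * A x $ 3 $ 3 + A x $ 1 $ 2 * d 2 1 * A x $ 3 $ 3 + A x $ 1 $ 2 * A x $ 2 $ 1 * d 3 3)
    - (d 1 3 * A x $ 2 $ 2 * A x $ 3 $ 1 + A x $ 1 $ 3 * d 2 2 * A x $ 3 $ 1 + A x $ 1 $ 3 * A x $ 2 $ 2 * d 3 1)) (at x)"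
proof -
  have t: "((\<lambda>x. A x $ a $ a' * A x $ b $ b' * A x $ c $ c') has_vector_derivative
      d a a' * A x $ b $ b' * A x $ c $ c' + A x $ a $ a' * d b b' * A x $ c $ c' + A x $ a $ a' * A x $ b $ b' * d c c') (at x)"
    for a a' b b' c c'
    using has_vector_derivative_mult[OF has_vector_derivative_mult[OF assms[of a a'] assms[of b b']] assms[of c c']]
    by (rule has_vector_derivative_eq_rhs) (simp add: algebra_simps)
  show ?thesis
    unfolding det_3 by (intro has_vector_derivative_add has_vector_derivative_diff t)
qed

section \<open>Eigenfunctions and jump matrix at t = 0\<close>

locale scattering_problem = wave_solution +
  fixes M :: "real \<Rightarrow> complex \<Rightarrow> complex^3^3" and S :: "complex \<Rightarrow> complex^3^3"
    and Z :: "complex set" and col src :: "complex \<Rightarrow> 3" and v :: "complex \<Rightarrow> complex"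
  assumes data: "scattering_data (\<lambda>\<xi>. u \<xi> 0) M S Z col src v"
begin

abbreviation "u0 \<equiv> \<lambda>\<xi>. u \<xi> 0"

definition "r x = q' x 0 / (3 * q x 0)"

lemma qfun_u0: "qfun u0 = (\<lambda>x. q x 0)"
  using q_qfun by auto

lemma deriv_qfun_u0: "deriv (qfun u0) x = q' x 0"
  unfolding qfun_u0 using q_deriv by (intro DERIV_imp_deriv) auto

lemma Umat_u0: "Umat u0 x $ j $ k = of_real (r x) * cmat j k"
proof -
  have c: "(a *\<^sub>R V) $ j $ k = of_real a * V $ j $ k" for a and V :: "complex^3^3"
    by (subst vector_scaleR_component)+ (rule scaleR_conv_of_real)
  show ?thesis
    unfolding Umat_def c deriv_qfun_u0 unfolding qfun_u0 r_def
    using exhaust_3[of j] exhaust_3[of k] by auto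
qed

lemma r_eq: "r x = - D 3 x 0 / (9 * q x 0 ^ 3)"
  using q_pos[of 0 x] by (simp add: r_def q'_def power2_eq_square power3_eq_cube field_simps)

lemma r_bound: obtains C where "C \<ge> 0" "\<And>x. \<bar>r x\<bar> \<le> C * wt x"
proof -
  obtain C where C: "C \<ge> 0" "\<And>x s. s \<in> {0..0} \<Longrightarrow> \<bar>D 3 x s\<bar> \<le> C * wt x"
    by (rule D_bound) blast
  obtain c where c: "c > 0" "\<And>x s. s \<in> {0..0} \<Longrightarrow> q x s \<ge> c" by (rule q_lower) blast
  have "\<bar>r x\<bar> \<le> C / (9 * c ^ 3) * wt x" for x
  proof -
    have "c ^ 3 \<le> q x 0 ^ 3" using c by (intro power_mono) auto
    then have "\<bar>D 3 x 0\<bar> / (9 * q x 0 ^ 3) \<le> (C * wt x) / (9 * c ^ 3)"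
      using C(2)[of 0 x] c by (intro frac_le) auto
    moreover have "\<bar>r x\<bar> = \<bar>D 3 x 0\<bar> / (9 * q x 0 ^ 3)"
      using q_pos[of 0 x] by (simp add: r_eq abs_mult)
    ultimately show ?thesis by simp
  qed
  then show ?thesis using that[of "C / (9 * c ^ 3)"] C c by auto
qed

lemma r_cont: "continuous_on UNIV r"
  using continuous_on_slice1[OF q'_cont, of 0 UNIV] q_slice_cont[of 0 UNIV] q_pos
  unfolding r_def by (intro continuous_intros) (auto simp: less_imp_neq[symmetric])

lemma eigen: "z \<notin> contour \<union> Z \<Longrightarrow> eigenfunction u0 z (\<lambda>x. M x z)"
  using data by (simp add: scattering_data_def)

lemma M_bounded:
  assumes "z \<notin> contour \<union> Z"
  obtains B where "B \<ge> 0" "\<And>x j l. norm (M x z $ j $ l) \<le> B"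
proof -
  obtain B where B: "\<And>x. norm (M x z) \<le> B"
    using eigen[OF assms] by (auto simp: eigenfunction_def bounded_iff)
  have "norm (M x z $ j $ l) \<le> B" for x j l
    by (rule order_trans[OF Finite_Cartesian_Product.norm_nth_le order_trans[OF Finite_Cartesian_Product.norm_nth_le B]])
  moreover have "B \<ge> 0" using B norm_ge_zero order_trans by blast
  ultimately show ?thesis using that by blast
qed

definition "G z j l \<xi> = of_real (r \<xi>) * (\<Sum>k\<in>UNIV. cmat j k * M \<xi> z $ k $ l)"

text \<open>The phase, an integral of \<open>q\<close>, is an increment of \<open>Y\<close> at time
  0. Hence the Volterra lemmas apply with this increasing function as \<phi>.\<close>

lemma eigen_integrand_eq:
  "eigen_integrand u0 (\<lambda>x. M x z) z j l x = (\<lambda>\<xi>. exp (z * (om j - om l) * of_real (Y x 0 - Y \<xi> 0)) * G z j l \<xi>)"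
proof
  fix \<xi>
  have I: "(LBINT \<zeta>=ereal \<xi>..ereal x. q \<zeta> 0) = Y x 0 - Y \<xi> 0"
    by (rule interval_integral_FTC_finite)
      (auto intro!: q_slice_cont has_field_derivative_at_within[OF Y_deriv]
        simp: has_real_derivative_iff_has_vector_derivative[symmetric])
  show "eigen_integrand u0 (\<lambda>x. M x z) z j l x \<xi> = exp (z * (om j - om l) * of_real (Y x 0 - Y \<xi> 0)) * G z j l \<xi>"
    unfolding eigen_integrand_def qfun_u0 I
    by (simp add: lam_om right_diff_distrib G_def matrix_matrix_mult_def Umat_u0 sum_distrib_left mult.assoc)
qed

lemma inf_jl_eq: "inf_jl z j l = (if Re (z * (om j - om l)) \<ge> 0 then \<infinity> else -\<infinity>)"
  by (simp add: inf_jl_def lam_om right_diff_distrib)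

context
  fixes z assumes z: "z \<notin> contour \<union> Z"
begin

lemma M_integrable:
  "interval_lebesgue_integrable lborel (inf_jl z j l) (ereal x)
     (\<lambda>\<xi>. exp (z * (om j - om l) * of_real (Y x 0 - Y \<xi> 0)) * G z j l \<xi>)"
  using eigen[OF z] by (simp add: eigenfunction_def eigen_integrand_eq)

lemma M_equation:
  "M x z $ j $ l = (if j = l then 1 else 0)
     + (LBINT \<xi>=inf_jl z j l..ereal x. exp (z * (om j - om l) * of_real (Y x 0 - Y \<xi> 0)) * G z j l \<xi>)"
  using eigen[OF z] by (simp add: eigenfunction_def eigen_integrand_eq)

lemma Y_mono_deriv: "((\<lambda>x. Y x 0) has_real_derivative q x 0) (at x)" "q x 0 \<ge> 0"
  using Y_deriv[of 0 x] q_pos[of 0 x] by auto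

lemma M_isCont: "isCont (\<lambda>x. M x z $ j $ l) x"
  by (rule volterra_continuous[OF Y_mono_deriv inf_jl_eq M_integrable M_equation])

lemma G_cont: "continuous_on UNIV (G z j l)"
  unfolding G_def
  by (intro continuous_on_mult continuous_on_of_real continuous_on_sum continuous_on_const r_cont
      continuous_at_imp_continuous_on ballI M_isCont)

lemma M_deriv:
  "((\<lambda>x. M x z $ j $ l) has_vector_derivative
      z * (om j - om l) * of_real (q x 0) * (M x z $ j $ l) + G z j l x) (at x)"
proof -
  have "((\<lambda>x. M x z $ j $ l) has_vector_derivative
      z * (om j - om l) * of_real (q x 0) * (M x z $ j $ l - (if j = l then 1 else 0)) + G z j l x) (at x)"
    by (rule volterra_deriv[OF Y_mono_deriv inf_jl_eq M_integrable M_equation G_cont])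
  then show ?thesis
    by (rule has_vector_derivative_eq_rhs) auto
qed

lemma M_limit: "((\<lambda>x. M x z $ j $ l) \<longlongrightarrow> (if j = l then 1 else 0)) (far_end (z * (om j - om l)))"
proof -
  obtain B where B: "B \<ge> 0" "\<And>x j l. norm (M x z $ j $ l) \<le> B" by (rule M_bounded[OF z]) blast
  obtain C where C: "C \<ge> 0" "\<And>x. \<bar>r x\<bar> \<le> C * wt x" by (rule r_bound) blast
  have "norm (G z j l x) \<le> C * (3 * (2 * B)) * wt x" for x
  proof -
    have "norm (cmat j k * M x z $ k $ l) \<le> 2 * B" for k
      unfolding norm_mult using norm_cmat B by (intro mult_mono) auto
    then have "norm (\<Sum>k\<in>UNIV. cmat j k * M x z $ k $ l) \<le> 3 * (2 * B)" by (rule norm_sum_3_le)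
    then have "\<bar>r x\<bar> * norm (\<Sum>k\<in>UNIV. cmat j k * M x z $ k $ l) \<le> (C * wt x) * (3 * (2 * B))"
      using C by (intro mult_mono) auto
    then show ?thesis by (simp add: G_def norm_mult mult_ac)
  qed
  then show ?thesis
    by (rule volterra_limit[OF Y_mono_deriv inf_jl_eq M_integrable M_equation _ decay_exponent(1)])
qed

text \<open>At \<open>+\<infinity>\<close> the matrix becomes triangular up to a reordering of the indices.\<close>

lemma det_M: "det (M x z) = 1"
proof -
  have "((\<lambda>x. det (M x z)) has_vector_derivative 0) (at x)" for x
  proof -
    have G: "G z 1 l x = of_real (r x) * ((1 - omega ^ 2) * M x z $ 2 $ l + (1 - omega) * M x z $ 3 $ l)"
      "G z 2 l x = of_real (r x) * ((1 - omega) * M x z $ 1 $ l + (1 - omega ^ 2) * M x z $ 3 $ l)"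
      "G z 3 l x = of_real (r x) * ((1 - omega ^ 2) * M x z $ 1 $ l + (1 - omega) * M x z $ 2 $ l)" for l
      by (simp_all add: G_def sum_3)
    define d where "d j l = z * (om j - om l) * of_real (q x 0) * (M x z $ j $ l) + G z j l x" for j l
    have d: "d 1 l = (z * of_real (q x 0)) * (om 1 - om l) * (M x z $ 1 $ l)
          + ((of_real (r x) * (1 - omega ^ 2)) * M x z $ 2 $ l + (of_real (r x) * (1 - omega)) * M x z $ 3 $ l)"
      "d 2 l = (z * of_real (q x 0)) * (om 2 - om l) * (M x z $ 2 $ l)
          + ((of_real (r x) * (1 - omega)) * M x z $ 1 $ l + (of_real (r x) * (1 - omega ^ 2)) * M x z $ 3 $ l)"
      "d 3 l = (z * of_real (q x 0)) * (om 3 - om l) * (M x z $ 3 $ l)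
          + ((of_real (r x) * (1 - omega ^ 2)) * M x z $ 1 $ l + (of_real (r x) * (1 - omega)) * M x z $ 2 $ l)" for l
      unfolding d_def G by (simp_all add: algebra_simps del: om_simps)
    have "((\<lambda>x. M x z $ j $ l) has_vector_derivative d j l) (at x)" for j l
      unfolding d_def by (rule M_deriv)
    from has_vector_derivative_det_3[of "\<lambda>x. M x z", OF this] show ?thesis
      unfolding traceless_det_identity[of d _ om "\<lambda>j l. M x z $ j $ l", OF d] .
  qed
  then obtain c where c: "\<And>x. det (M x z) = c"
    using has_vector_derivative_zero_constant[of UNIV "\<lambda>x. det (M x z)"] by (metis UNIV_I convex_UNIV)
  obtain B where B: "B \<ge> 0" "\<And>x j l. norm (M x z $ j $ l) \<le> B" by (rule M_bounded[OF z]) blast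
  \<comment> \<open>Off the contour these real parts are pairwise distinct, so they order the three
    indices strictly; an entry whose row has the larger value tends to 0 at +\<infinity>.\<close>
  define \<rho> where "\<rho> j = Re (z * om j)" for j
  have \<rho>: "\<rho> j < \<rho> l \<or> \<rho> l < \<rho> j" if "j \<noteq> l" for j l
    using Re_om_distinct[of z j l] that z by (auto simp: \<rho>_def right_diff_distrib simp del: om_simps)
  have off: "((\<lambda>x. M x z $ j $ l) \<longlongrightarrow> 0) at_top" if "\<rho> j > \<rho> l" for j l
    using M_limit[of j l] that
    by (auto simp: far_end_def \<rho>_def right_diff_distrib simp del: om_simps split: if_splits)
  have diag: "((\<lambda>x. M x z $ j $ j) \<longlongrightarrow> 1) at_top" for j
    using M_limit[of j j] by simp
  \<comment> \<open>Every permutation other than the identity sends some index to one with smaller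
    \<rho>. So the other five products of the determinant contain a vanishing factor, and the
    remaining factors are bounded.\<close>
  have triple: "((\<lambda>x. M x z $ j $ j' * M x z $ k $ k' * M x z $ l $ l') \<longlongrightarrow> 0) at_top"
    if "\<rho> j > \<rho> j' \<or> \<rho> k > \<rho> k' \<or> \<rho> l > \<rho> l'" for j j' k k' l l'
  proof -
    have *: "((\<lambda>x. M x z $ a $ a' * (M x z $ b $ b' * M x z $ d $ d')) \<longlongrightarrow> 0) at_top"
      if "\<rho> a > \<rho> a'" for a a' b b' d d'
    proof (rule Lim_null_comparison[OF always_eventually])
      show "\<forall>x. norm (M x z $ a $ a' * (M x z $ b $ b' * M x z $ d $ d')) \<le> norm (M x z $ a $ a') * (B * B)"
        unfolding norm_mult using B by (auto intro!: mult_mono)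
      have "((\<lambda>x. norm (M x z $ a $ a') * (B * B)) \<longlongrightarrow> norm (0::complex) * (B * B)) at_top"
        by (intro tendsto_intros off that)
      then show "((\<lambda>x. norm (M x z $ a $ a') * (B * B)) \<longlongrightarrow> 0) at_top" by simp
    qed
    show ?thesis
      using that *[of j' j k k' l l'] *[of k' k j j' l l'] *[of l' l j j' k k']
      by (auto simp: mult_ac)
  qed
  have "((\<lambda>x. det (M x z)) \<longlongrightarrow> 1 * 1 * 1 + 0 + 0 - 0 - 0 - 0) at_top"
    unfolding det_3
    using \<rho>[of 1 2] \<rho>[of 1 3] \<rho>[of 2 3]
    by (intro tendsto_add tendsto_diff triple tendsto_mult diag) auto
  then have "((\<lambda>x. c) \<longlongrightarrow> 1) (at_top :: real filter)" by (simp add: c)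
  then have "c = 1" using tendsto_unique[OF _ tendsto_const] by force
  then show ?thesis by (simp add: c)
qed

end

text \<open>The determinant is 1 off the contour, hence for both one-sided limits, and the
  exponentials in the jump relation cancel; x = 0 is an arbitrary choice. The fact
  \<open>one\<close> checks that regular points accumulate at the contour point from the given side,
  so the limit is determined by them.\<close>

lemma det_S:
  assumes k: "k < 3" and s: "s \<noteq> 0"
  shows "det (S (of_real s * omega ^ k)) = 1"
proof -
  let ?w = "of_real s * omega ^ k"
  have Zfin: "finite Z" using data by (simp add: scattering_data_def discrete_data_def)
  have "jump_condition S (yfun u0 0) 0 (M 0)" using data by (simp add: scattering_data_def)
  then obtain Fp Fm where
    p: "(M 0 \<longlongrightarrow> Fp) (at ?w within {u. Im (u / omega ^ k) > 0})" and
    m: "(M 0 \<longlongrightarrow> Fm) (at ?w within {u. Im (u / omega ^ k) < 0})" and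
    e: "Fp = Fm ** expQ (yfun u0 0) 0 ?w ** S ?w ** expQ (- yfun u0 0) (- 0) ?w"
    using k s unfolding jump_condition_def Let_def by blast
  have one: "det A = 1" if A: "(M 0 \<longlongrightarrow> A) (at ?w within U)" and U: "open U" "?w \<in> closure U" "?w \<notin> U" for U A
  proof -
    have "at ?w within (U \<inter> - (contour \<union> Z)) \<noteq> bot"
      unfolding trivial_limit_within islimpt_def
    proof (clarify, rule ccontr)
      fix V assume V: "?w \<in> V" "open V" "\<not> (\<exists>y\<in>U \<inter> - (contour \<union> Z). y \<in> V \<and> y \<noteq> ?w)"
      have "V \<inter> U \<noteq> {}" using U(2) V by (auto simp: closure_iff_nhds_not_empty)
      then obtain w' where w': "w' \<in> V \<inter> U" by blast
      have "w' islimpt - (contour \<union> Z)"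
        using offcontour_islimpt[OF Zfin, of w'] by (simp add: trivial_limit_within)
      moreover have "open (V \<inter> U)" using V U by auto
      ultimately obtain y where "y \<in> - (contour \<union> Z)" "y \<in> V \<inter> U"
        using w' unfolding islimpt_def by blast
      then show False using V(3) U(3) by blast
    qed
    moreover have "((\<lambda>w. det (M 0 w)) \<longlongrightarrow> det A) (at ?w within (U \<inter> - (contour \<union> Z)))"
      by (rule tendsto_within_subset[OF tendsto_det_3[OF A]]) auto
    moreover have "((\<lambda>w. det (M 0 w)) \<longlongrightarrow> 1) (at ?w within (U \<inter> - (contour \<union> Z)))"
      by (rule Lim_transform_eventually[OF tendsto_const])
        (auto simp: eventually_at_filter det_M intro!: always_eventually)
    ultimately show ?thesis using tendsto_unique by blast
  qed
  have o: "open {u. Im (u / omega ^ k) > 0}" "open {u. Im (u / omega ^ k) < 0}"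
    unfolding Im_div_omega by (rule open_halfspace_gt open_halfspace_lt)+
  have "closure {u. Im (u / omega ^ k) > 0} = {u. Im (u / omega ^ k) \<ge> 0}"
    "closure {u. Im (u / omega ^ k) < 0} = {u. Im (u / omega ^ k) \<le> 0}"
    unfolding Im_div_omega by (simp_all add: closure_halfspace_gt closure_halfspace_lt)
  then have "det Fp = 1" "det Fm = 1"
    using one[OF p o(1)] one[OF m o(2)] by auto
  then show ?thesis using det_expQ_conj[of Fm "yfun u0 0" 0 ?w "S ?w"] e by simp
qed

section \<open>Eigenfunctions for large \<open>z\<close>\<close>

definition "s x = r x / q x 0"

definition "s' x = - D 4 x 0 / (9 * q x 0 ^ 4) + 4 * D 3 x 0 * q' x 0 / (9 * q x 0 ^ 5)"

lemma s_deriv: "(s has_real_derivative s' x) (at x)"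
proof -
  have "((\<lambda>x. - D 3 x 0) has_real_derivative - D 4 x 0) (at x)"
    using D_deriv[of 0 3 x] by (auto intro!: derivative_eq_intros simp: eval_nat_numeral)
  moreover have "((\<lambda>x. 9 * q x 0 ^ 4) has_real_derivative 9 * (4 * q x 0 ^ 3 * q' x 0)) (at x)"
    using q_deriv[of 0 x] by (auto intro!: derivative_eq_intros)
  ultimately have "((\<lambda>x. - D 3 x 0 / (9 * q x 0 ^ 4)) has_real_derivative
      (- D 4 x 0 * (9 * q x 0 ^ 4) - - D 3 x 0 * (9 * (4 * q x 0 ^ 3 * q' x 0))) / ((9 * q x 0 ^ 4) * (9 * q x 0 ^ 4))) (at x)"
    using q_pos[of 0 x] by (intro DERIV_divide) auto
  moreover have "s = (\<lambda>x. - D 3 x 0 / (9 * q x 0 ^ 4))"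
    by (auto simp: s_def r_eq eval_nat_numeral)
  moreover have "(- D 4 x 0 * (9 * q x 0 ^ 4) - - D 3 x 0 * (9 * (4 * q x 0 ^ 3 * q' x 0))) / ((9 * q x 0 ^ 4) * (9 * q x 0 ^ 4)) = s' x"
    using q_pos[of 0 x] unfolding s'_def by (simp add: field_simps eval_nat_numeral)
  ultimately show ?thesis by simp
qed

lemma s_bound:
  obtains C where "C \<ge> 0" "\<And>x. \<bar>s x\<bar> \<le> C * wt x" "\<And>x. \<bar>s x\<bar> \<le> C" "\<And>x. \<bar>s' x\<bar> \<le> C * wt x" "\<And>x. \<bar>s x * r x\<bar> \<le> C * wt x"
proof -
  obtain Cr where Cr: "Cr \<ge> 0" "\<And>x. \<bar>r x\<bar> \<le> Cr * wt x" by (rule r_bound) blast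
  obtain C3 where C3: "C3 \<ge> 0" "\<And>x s. s \<in> {0..0} \<Longrightarrow> \<bar>D 3 x s\<bar> \<le> C3 * wt x" by (rule D_bound) blast
  obtain C4 where C4: "C4 \<ge> 0" "\<And>x s. s \<in> {0..0} \<Longrightarrow> \<bar>D 4 x s\<bar> \<le> C4 * wt x" by (rule D_bound) blast
  obtain c where c: "c > 0" "\<And>x s. s \<in> {0..0} \<Longrightarrow> q x s \<ge> c" by (rule q_lower) blast
  have w1: "wt x \<le> 1" for x using decay_weight_le_one[of decay_exponent x] decay_exponent(1) by simp
  have qc: "c ^ n \<le> q x 0 ^ n" for n x using c by (intro power_mono) auto
  have r1: "\<bar>r x\<bar> \<le> Cr" for x
    using Cr(2)[of x] mult_left_mono[OF w1[of x] Cr(1)] by simp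
  have s1: "\<bar>s x\<bar> \<le> Cr / c * wt x" for x
  proof -
    have "\<bar>r x\<bar> / q x 0 \<le> Cr * wt x / c"
      using c(1) c(2)[of 0 x] Cr by (intro frac_le) auto
    then show ?thesis using q_pos[of 0 x] by (simp add: s_def)
  qed
  then have s0: "\<bar>s x\<bar> \<le> Cr / c" for x
    by (rule order_trans) (use mult_left_mono[OF w1[of x], of "Cr / c"] Cr(1) c(1) in simp)
  have sr: "\<bar>s x * r x\<bar> \<le> Cr / c * Cr * wt x" for x
  proof -
    have "\<bar>s x\<bar> * \<bar>r x\<bar> \<le> (Cr / c) * (Cr * wt x)" using s0 Cr c by (intro mult_mono) auto
    then show ?thesis by (simp add: abs_mult)
  qed
  define B where "B = C4 / (9 * c ^ 4) + 12 * (C3 / (9 * c ^ 4)) * Cr"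
  have s'1: "\<bar>s' x\<bar> \<le> B * wt x" for x
  proof -
    have "\<bar>D 4 x 0\<bar> / (9 * q x 0 ^ 4) \<le> C4 * wt x / (9 * c ^ 4)"
      using C4(2)[of 0 x] C4(1) c(1) qc[of 4 x] by (intro frac_le) auto
    moreover have d3: "\<bar>D 3 x 0\<bar> / (9 * q x 0 ^ 4) \<le> C3 * wt x / (9 * c ^ 4)"
      using C3(2)[of 0 x] C3(1) c(1) qc[of 4 x] by (intro frac_le) auto
    have "12 * (\<bar>D 3 x 0\<bar> / (9 * q x 0 ^ 4)) * \<bar>r x\<bar> \<le> 12 * (C3 * wt x / (9 * c ^ 4)) * Cr"
      using d3 r1[of x] q_pos[of 0 x] C3(1) c(1) by (intro mult_mono) auto
    moreover have "4 * D 3 x 0 * q' x 0 / (9 * q x 0 ^ 5) = 12 * (D 3 x 0 / (9 * q x 0 ^ 4)) * r x"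
      using q_pos[of 0 x] by (simp add: r_def field_simps eval_nat_numeral)
    ultimately have "\<bar>s' x\<bar> \<le> C4 * wt x / (9 * c ^ 4) + 12 * (C3 * wt x / (9 * c ^ 4)) * Cr"
      unfolding s'_def using q_pos[of 0 x]
      by (intro order_trans[OF abs_triangle_ineq add_mono]) (simp_all add: abs_mult)
    then show ?thesis by (simp add: B_def algebra_simps)
  qed
  define C where "C = max (Cr / c) (max B (Cr / c * Cr))"
  have C0: "C \<ge> 0" using Cr c by (simp add: C_def le_max_iff_disj)
  have *: "a * wt x \<le> C * wt x" if "a \<le> C" for a x using that by (intro mult_right_mono) auto
  show ?thesis
  proof (rule that[OF C0])
    fix x
    show "\<bar>s x\<bar> \<le> C * wt x" by (rule order_trans[OF s1 *]) (simp add: C_def)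
    show "\<bar>s x\<bar> \<le> C" by (rule order_trans[OF s0]) (simp add: C_def)
    show "\<bar>s' x\<bar> \<le> C * wt x" by (rule order_trans[OF s'1 *]) (simp add: C_def)
    show "\<bar>s x * r x\<bar> \<le> C * wt x" by (rule order_trans[OF sr *]) (simp add: C_def)
  qed
qed

text \<open>The gauge \<open>N = (I - s X\<^sub>0 / z) M\<close> with \<open>[\<Lambda>(1), X\<^sub>0] = -(1 - \<omega>\<^sup>j \<omega>\<^sup>-\<^sup>k)\<^sub>j\<^sub>k\<close> replaces the perturbation
  \<open>U\<close>, which is not small, by one of size \<open>1 / |z|\<close>.\<close>

lemma gauge_deriv:
  fixes j l :: 3
  assumes z: "z \<notin> contour \<union> Z"
  defines "XM \<equiv> \<lambda>j x. \<Sum>k\<in>UNIV. xmat j k * M x z $ k $ l"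
  defines "CM \<equiv> \<lambda>j x. \<Sum>k\<in>UNIV. cmat j k * M x z $ k $ l"
  shows "((\<lambda>x. M x z $ j $ l - of_real (s x) / z * XM j x) has_vector_derivative
      z * (om j - om l) * of_real (q x 0) * (M x z $ j $ l - of_real (s x) / z * XM j x)
      - (of_real (s' x) / z * XM j x + of_real (s x * r x) / z * (\<Sum>k\<in>UNIV. xmat j k * CM k x))) (at x)"
proof -
  have z0: "z \<noteq> 0" using z by auto
  let ?q = "of_real (q x 0) :: complex"
  \<comment> \<open>The definition of \<open>s\<close> is made for this identity: the commutator of
    z q \<Lambda>(1) with the gauge term then cancels the matrix \<open>U\<close>, leaving only
    terms with a factor 1/z.\<close>
  have sq: "of_real (s x) * ?q = of_real (r x)"
  proof -
    have "s x * q x 0 = r x" using q_pos[of 0 x] by (simp add: s_def)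
    then show ?thesis by (metis of_real_mult)
  qed
  have G: "G z k l x = of_real (r x) * CM k x" for k by (simp add: G_def CM_def)
  define XM' where "XM' = (\<Sum>k\<in>UNIV. xmat j k * (z * (om k - om l) * ?q * M x z $ k $ l + of_real (r x) * CM k x))"
  have XM: "((\<lambda>x. XM j x) has_vector_derivative XM') (at x)"
    unfolding XM_def XM'_def
    by (intro has_vector_derivative_sum has_vector_derivative_mult_right) (use M_deriv[OF z, of _ l x] in \<open>simp only: G\<close>)
  have "((\<lambda>x. of_real (s x)) has_vector_derivative complex_of_real (s' x)) (at x)"
    using s_deriv[of x] by (intro has_vector_derivative_of_real) (simp add: has_real_derivative_iff_has_vector_derivative)
  then have sz: "((\<lambda>x. of_real (s x) / z) has_vector_derivative of_real (s' x) / z) (at x)"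
    using has_vector_derivative_mult_left[of _ _ _ "1 / z"] by fastforce
  have XM'_eq: "XM' = z * (om j - om l) * ?q * XM j x + z * ?q * CM j x + of_real (r x) * (\<Sum>k\<in>UNIV. xmat j k * CM k x)"
  proof -
    have "xmat j k * (z * (om k - om l) * ?q * M x z $ k $ l + of_real (r x) * CM k x)
       = z * (om j - om l) * ?q * (xmat j k * M x z $ k $ l) + z * ?q * (cmat j k * M x z $ k $ l) + of_real (r x) * (xmat j k * CM k x)" for k
    proof -
      have e: "xmat j k * (om k - om l) = xmat j k * (om j - om l) + cmat j k"
        using xmat_commutator[of j k] by (simp add: algebra_simps del: om_simps)
      have "xmat j k * (z * (om k - om l) * ?q * M x z $ k $ l + of_real (r x) * CM k x)
        = z * ?q * M x z $ k $ l * (xmat j k * (om k - om l)) + of_real (r x) * (xmat j k * CM k x)"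
        by (simp add: algebra_simps del: om_simps)
      then show ?thesis unfolding e by (simp add: algebra_simps del: om_simps)
    qed
    then show ?thesis
      unfolding XM'_def by (simp add: sum.distrib sum_distrib_left XM_def CM_def del: om_simps)
  qed
  have "((\<lambda>x. M x z $ j $ l - of_real (s x) / z * XM j x) has_vector_derivative
     (z * (om j - om l) * ?q * M x z $ j $ l + G z j l x) - (of_real (s x) / z * XM' + of_real (s' x) / z * XM j x)) (at x)"
    by (intro has_vector_derivative_diff M_deriv[OF z] has_vector_derivative_mult sz XM)
  moreover have "(z * (om j - om l) * ?q * M x z $ j $ l + G z j l x) - (of_real (s x) / z * XM' + of_real (s' x) / z * XM j x)
     = z * (om j - om l) * ?q * (M x z $ j $ l - of_real (s x) / z * XM j x)
      - (of_real (s' x) / z * XM j x + of_real (s x * r x) / z * (\<Sum>k\<in>UNIV. xmat j k * CM k x))"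
  proof -
    have "of_real (s x) / z * XM' = (om j - om l) * (of_real (s x) * ?q) * XM j x + (of_real (s x) * ?q) * CM j x
      + of_real (s x * r x) / z * (\<Sum>k\<in>UNIV. xmat j k * CM k x)"
      unfolding XM'_eq using z0 by (simp add: field_simps del: om_simps)
    then have e: "of_real (s x) / z * XM' = (om j - om l) * of_real (r x) * XM j x + of_real (r x) * CM j x
      + of_real (s x * r x) / z * (\<Sum>k\<in>UNIV. xmat j k * CM k x)"
      unfolding sq .
    have "z * (om j - om l) * ?q * (of_real (s x) / z * XM j x) = (om j - om l) * (of_real (s x) * ?q) * XM j x"
      using z0 by (simp add: field_simps del: om_simps)
    then have "z * (om j - om l) * ?q * (of_real (s x) / z * XM j x) = (om j - om l) * of_real (r x) * XM j x"
      unfolding sq .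
    then show ?thesis unfolding e G right_diff_distrib[of "z * (om j - om l) * ?q"] by simp
  qed
  ultimately show ?thesis by (simp only:)
qed

text \<open>After the gauge the inhomogeneity is of size B/|z|, so \<open>ode_bound\<close> with
  phase \<open>Y\<close> and the absorption of \<open>B\<close> give an error O(1/|z|) uniformly in
  \<open>x\<close>. This is the normalization at infinity needed for the Riemann--Hilbert
  problem.\<close>

lemma large_z:
  obtains C where "C > 0" "\<And>x z j l. z \<notin> contour \<union> Z \<Longrightarrow> norm z \<ge> C \<Longrightarrow>
    norm (M x z $ j $ l - (if j = l then 1 else 0)) \<le> C / norm z"
proof -
  define p where "p = decay_exponent"
  have p: "p > 1" using decay_exponent(1) by (simp add: p_def)
  obtain C where C: "C \<ge> 0" "\<And>x. \<bar>s x\<bar> \<le> C * wt x" "\<And>x. \<bar>s x\<bar> \<le> C" "\<And>x. \<bar>s' x\<bar> \<le> C * wt x" "\<And>x. \<bar>s x * r x\<bar> \<le> C * wt x"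
    by (rule s_bound) blast
  \<comment> \<open>The number 21 is 3 + 18: the derivative of the gauge contributes three entries
    of size \<open>B\<close>, the product with \<open>U\<close> contributes 3 * 3 * 2. The summand
    \<open>3 * C\<close> pays for undoing the gauge.\<close>
  define A where "A = 21 * C * (2 / (p - 1)) + 3 * C"
  have A: "A \<ge> 0" using C p by (simp add: A_def)
  show ?thesis
  proof (rule that[of "2 * A + 1"])
    fix x z and j l :: 3 assume z: "z \<notin> contour \<union> Z" and zn: "norm z \<ge> 2 * A + 1"
    let ?\<delta> = "\<lambda>j. (if j = l then 1 else 0) :: complex"
    have n0: "norm z > 0" using A zn by linarith
    obtain B0 where B0: "\<And>x j l. norm (M x z $ j $ l) \<le> B0" by (rule M_bounded[OF z]) blast
    have "norm (M x z $ j $ l - ?\<delta> j) \<le> 2 * (A / norm z)"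
    proof (rule bootstrap_bound(1)[where m = "\<lambda>j x. M x z $ j $ l"])
      show "bounded (range (\<lambda>x. M x z $ j $ l))" for j using B0 by (auto simp: bounded_iff)
      show "norm (?\<delta> j) \<le> 1" for j by simp
      show "A / norm z \<le> 1 / 2" "0 \<le> A / norm z" using A zn n0 by (auto simp: field_simps)
      fix B j x assume B: "B \<ge> 0" "\<And>j x. norm (M x z $ j $ l) \<le> B"
      define XM where "XM j x = (\<Sum>k\<in>UNIV. xmat j k * M x z $ k $ l)" for j x
      define CM where "CM j x = (\<Sum>k\<in>UNIV. cmat j k * M x z $ k $ l)" for j x
      define N where "N j x = M x z $ j $ l - of_real (s x) / z * XM j x" for j x
      define h where "h j x = - (of_real (s' x) / z * XM j x + of_real (s x * r x) / z * (\<Sum>k\<in>UNIV. xmat j k * CM k x))" for j x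
      have XMb: "norm (XM j x) \<le> 3 * B" for j x
        unfolding XM_def norm_mult
        by (intro norm_sum_3_le) (use norm_xmat B in \<open>auto simp: norm_mult intro!: mult_left_le_one_le[THEN order_trans]\<close>)
      have CMb: "norm (CM j x) \<le> 3 * (2 * B)" for j x
        unfolding CM_def
        by (intro norm_sum_3_le) (use norm_cmat B in \<open>auto simp: norm_mult intro!: mult_mono\<close>)
      have XCb: "norm (\<Sum>k\<in>UNIV. xmat j k * CM k x) \<le> 3 * (3 * (2 * B))" for j x
        by (intro norm_sum_3_le) (use norm_xmat CMb in \<open>auto simp: norm_mult intro!: mult_left_le_one_le[THEN order_trans]\<close>)
      have N: "norm (N j x - ?\<delta> j) \<le> 21 * C * B / norm z * (2 / (p - 1))" for j x
      proof (rule ode_bound[where \<mu> = "z * (om j - om l)" and \<phi> = "\<lambda>x. Y x 0" and \<phi>' = "\<lambda>x. q x 0" and h = "h j" and p = p])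
        show "((\<lambda>x. N j x - ?\<delta> j) has_vector_derivative z * (om j - om l) * of_real (q x 0) * (N j x - ?\<delta> j) + h j x) (at x)" for x
          using has_vector_derivative_diff[OF gauge_deriv[OF z, of j l x] has_vector_derivative_const[of "?\<delta> j"]]
          unfolding N_def h_def XM_def CM_def
          by (rule has_vector_derivative_eq_rhs) (cases "j = l"; simp del: om_simps)
        show "norm (h j x) \<le> 21 * C * B / norm z * decay_weight p x" for x
        proof -
          have "\<bar>s' x\<bar> / norm z * norm (XM j x) \<le> C * wt x / norm z * (3 * B)"
            using C XMb n0 by (intro mult_mono divide_right_mono) auto
          moreover have "\<bar>s x * r x\<bar> / norm z * norm (\<Sum>k\<in>UNIV. xmat j k * CM k x) \<le> C * wt x / norm z * (3 * (3 * (2 * B)))"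
            using C XCb n0 by (intro mult_mono divide_right_mono) auto
          ultimately have "norm (h j x) \<le> C * wt x / norm z * (3 * B) + C * wt x / norm z * (3 * (3 * (2 * B)))"
            unfolding h_def norm_minus_cancel
            by (intro order_trans[OF norm_triangle_ineq add_mono]) (simp_all only: norm_mult norm_divide norm_of_real)
          also have "\<dots> = 21 * C * B / norm z * decay_weight p x"
            by (simp add: p_def algebra_simps add_divide_distrib[symmetric])
          finally show ?thesis .
        qed
        have "((\<lambda>x. of_real (s x) / z * XM j x) \<longlongrightarrow> 0) (far_end (z * (om j - om l)))"
        proof (rule Lim_null_comparison[OF always_eventually wt_far_end[of "C / norm z * (3 * B)"]], rule allI)
          fix x
          have "\<bar>s x\<bar> / norm z * norm (XM j x) \<le> C * wt x / norm z * (3 * B)"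
            using C XMb n0 by (intro mult_mono divide_right_mono) auto
          then show "norm (of_real (s x) / z * XM j x) \<le> C / norm z * (3 * B) * wt x"
            by (simp add: norm_mult norm_divide mult_ac)
        qed
        from tendsto_diff[OF LIM_zero[OF M_limit[OF z, of j l]] this]
        show "((\<lambda>x. N j x - ?\<delta> j) \<longlongrightarrow> 0) (far_end (z * (om j - om l)))"
          by (simp add: N_def algebra_simps)
      qed (use p C B n0 Y_mono_deriv[OF z] in auto)
      have "norm (of_real (s x) / z * XM j x) \<le> C / norm z * (3 * B)"
        unfolding norm_mult norm_divide norm_of_real
        using C(3) C(1) XMb n0 by (intro mult_mono divide_right_mono) auto
      moreover have "M x z $ j $ l - ?\<delta> j = (N j x - ?\<delta> j) + of_real (s x) / z * XM j x" by (simp add: N_def)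
      ultimately have "norm (M x z $ j $ l - ?\<delta> j) \<le> 21 * C * B / norm z * (2 / (p - 1)) + C / norm z * (3 * B)"
        using norm_triangle_le[OF add_mono[OF N]] by presburger
      also have "\<dots> = A / norm z * B" by (simp add: A_def algebra_simps add_divide_distrib)
      finally show "norm (M x z $ j $ l - ?\<delta> j) \<le> A / norm z * B" .
    qed
    also have "\<dots> \<le> (2 * A + 1) / norm z" using n0 by (simp add: divide_right_mono)
    finally show "norm (M x z $ j $ l - ?\<delta> j) \<le> (2 * A + 1) / norm z" .
  qed (use A in auto)
qed

end

section \<open>Propagation in time\<close>

text \<open>Column \<open>j\<close> is the vector (\<psi>, \<psi>_x / z, \<psi>_xx / z^2) of the
  free solution \<psi> = exp(z \<omega>^j x), up to the exponential. Thus \<open>vand\<close> passes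
  from the diagonal basis of \<Lambda> to that of the scalar third-order equation, and
  \<open>vinv\<close> back.\<close>

definition vand :: "3 \<Rightarrow> 3 \<Rightarrow> complex" where
  "vand i j = (if i = 1 then 1 else if i = 2 then om j else om j ^ 2)"

definition vinv :: "3 \<Rightarrow> 3 \<Rightarrow> complex" where
  "vinv j i = (if i = 1 then 1 else if i = 2 then om j ^ 2 else om j) / 3"

lemma vand_simps: "vand 1 j = 1" "vand 2 j = om j" "vand 3 j = om j ^ 2"
  by (simp_all add: vand_def)

lemma vinv_simps: "vinv j 1 = 1 / 3" "vinv j 2 = om j ^ 2 / 3" "vinv j 3 = om j / 3"
  by (simp_all add: vinv_def)

lemma norm_vand: "norm (vand i j) = 1"
  by (simp add: vand_def norm_power)

lemma norm_vinv: "norm (vinv j i) \<le> 1"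
  by (simp add: vinv_def norm_power norm_divide)

text \<open>In the index type 0 equals 3, so the predecessor wraps around; this is what makes the
  systems cyclic.\<close>

lemma cyclic_pred_3: "(1::3) - 1 = 3" "(2::3) - 1 = 1" "(3::3) - 1 = 2"
  by simp_all

lemma om_square_square: "(om j ^ 2) ^ 2 = om j" "om j * om j ^ 2 = 1" "om j ^ 2 * om j = 1" "om j ^ 2 * om j ^ 2 = om j"
proof -
  have a: "om j * om j ^ 2 = 1" using om_cube[of j] by (simp add: power2_eq_square power3_eq_cube mult.assoc)
  then show "om j * om j ^ 2 = 1" "om j ^ 2 * om j = 1" by (simp_all add: mult.commute)
  have "(om j ^ 2) ^ 2 = om j * (om j * om j ^ 2)" by (simp add: power2_eq_square mult.assoc)
  then show "(om j ^ 2) ^ 2 = om j" "om j ^ 2 * om j ^ 2 = om j" using a by (simp_all add: power2_eq_square[of "om j ^ 2"])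
qed

text \<open>Column \<open>j\<close> is an eigenvector of the cyclic shift, with eigenvalue
  \<open>om j ^ 2\<close>, the inverse of \<open>om j\<close>. This is how t/\<lambda>_j enters when
  \<open>q = 1\<close>.\<close>

lemma vand_shift: "vand (i - 1) j = om j ^ 2 * vand i j"
proof -
  consider "i = 1" | "i = 2" | "i = 3" using exhaust_3 by blast
  then show ?thesis
    by cases (simp_all only: cyclic_pred_3 vand_simps om_square_square mult_1_right)
qed

lemma vinv_vand: "(\<Sum>i\<in>UNIV. vinv j i * vand i l) = (if j = l then 1 else 0)"
proof -
  have e: "omega * omega = omega ^ 2" "omega ^ 2 * omega ^ 2 = omega" "(omega ^ 2) ^ 2 = omega"
    "omega * omega ^ 2 = 1" "omega ^ 2 * omega = 1"
    "omega ^ 4 = omega" "omega ^ 6 = 1"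
    using om_square_square[of 1] omega_fourth power_add[of omega 3 3]
    by (simp_all add: power2_eq_square[of omega])
  have s: "1 / 3 + omega / 3 + omega ^ 2 / 3 = 0" "1 / 3 + omega ^ 2 / 3 + omega / 3 = 0"
    by (simp_all add: omega_square field_simps)
  show ?thesis
    using exhaust_3[of j] exhaust_3[of l]
    by (elim disjE; simp add: sum_3 vand_simps vinv_simps e s)
qed

lemma vand_vinv: "(\<Sum>j\<in>UNIV. vand i j * vinv j k) = (if i = k then 1 else 0)"
proof -
  have "(\<Sum>j\<in>UNIV. om j ^ 2 * om j) = 3" by (simp add: om_square_square del: om_simps)
  moreover have "(\<Sum>j\<in>UNIV. om j * om j ^ 2) = 3" by (simp add: om_square_square del: om_simps)
  moreover have "(\<Sum>j\<in>UNIV. om j * om j) = 0" "(\<Sum>j\<in>UNIV. om j ^ 2 * om j ^ 2) = 0"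
    unfolding om_square_square(4) using sum_om by (simp_all only: power2_eq_square)
  ultimately show ?thesis
    using exhaust_3[of i] exhaust_3[of k] sum_om
    by (auto simp: vand_simps vinv_simps sum_divide_distrib[symmetric] simp del: om_simps)
qed

text \<open>Conjugation by \<open>vand\<close> turns \<open>cmat\<close> into diag(3, 0, -3), hence
  \<open>U\<close> into q_x/q diag(1, 0, -1). That is the logarithmic derivative of diag(q, 1, 1/q),
  the origin of the weights used below.\<close>

lemma vand_cmat: "(\<Sum>j\<in>UNIV. vand i j * cmat j k) = (if i = 1 then 3 else if i = 2 then 0 else - 3) * vand i k"
proof -
  have "(\<Sum>j\<in>UNIV. om j * om k ^ 2) = 0" "(\<Sum>j\<in>UNIV. om j * (om j * om k ^ 2)) = 0"
    "(\<Sum>j\<in>UNIV. om j ^ 2 * (om j * om k ^ 2)) = 3 * om k ^ 2"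
    using sum_om by (simp_all add: sum_distrib_right[symmetric] mult.assoc[symmetric] om_square_square
        power2_eq_square[symmetric] del: om_simps)
  then show ?thesis
    using exhaust_3[of i] sum_om
    by (auto simp: vand_simps cmat_def right_diff_distrib sum_subtractf om_square_square simp del: om_simps)
qed

section \<open>The propagator along the characteristics\<close>

context wave_solution
begin

definition "qh y t = q (X y t) t"
definition "u1h y t = D 1 (X y t) t"
definition "u2h y t = D 2 (X y t) t"

lemma hat_cont:
  assumes "continuous_on (UNIV \<times> {0..}) (\<lambda>(x, t). h x t)"
  shows "continuous_on (UNIV \<times> {0..T}) (\<lambda>(y, t). h (X y t) t)"
proof -
  have sub: "UNIV \<times> {0..T} \<subseteq> UNIV \<times> {0..}" by auto
  have "continuous_on (UNIV \<times> {0..T}) (\<lambda>p. X (fst p) (snd p))"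
    using continuous_on_subset[OF X_cont sub] by (simp add: case_prod_unfold)
  then have "continuous_on (UNIV \<times> {0..T}) ((\<lambda>(x, t). h x t) \<circ> (\<lambda>p. (X (fst p) (snd p), snd p)))"
    by (intro continuous_on_compose continuous_on_subset[OF assms] continuous_intros) auto
  then show ?thesis by (simp add: o_def case_prod_unfold)
qed

lemma qh_cont: "continuous_on (UNIV \<times> {0..T}) (\<lambda>(y, t). qh y t)"
  unfolding qh_def by (rule hat_cont[OF q_cont])

lemma u1h_cont: "continuous_on (UNIV \<times> {0..T}) (\<lambda>(y, t). u1h y t)"
  unfolding u1h_def by (rule hat_cont[OF D_cont])

lemma u2h_cont: "continuous_on (UNIV \<times> {0..T}) (\<lambda>(y, t). u2h y t)"
  unfolding u2h_def by (rule hat_cont[OF D_cont])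

lemma qh_pos: "t \<ge> 0 \<Longrightarrow> qh y t > 0"
  unfolding qh_def by (rule q_pos)

lemma qh_cube: "t \<ge> 0 \<Longrightarrow> qh y t ^ 3 = 1 - u2h y t"
  unfolding qh_def u2h_def by (rule q_cube)

lemma qh_t:
  assumes "t \<ge> 0"
  shows "((\<lambda>s. qh y s) has_real_derivative - u1h y t * qh y t) (at t within {0..})"
  using chain_rule_halfplane[OF q_deriv q'_cont q_t[OF assms] X_t[OF assms] assms]
  by (simp add: qh_def u1h_def algebra_simps)

lemma qh_y:
  assumes "t \<ge> 0"
  shows "((\<lambda>y. qh y t) has_real_derivative q' (X y t) t / qh y t) (at y)"
  using DERIV_chain2[OF q_deriv[OF assms] X_deriv[OF assms]] by (simp add: qh_def)

lemma u1h_y: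
  assumes "t \<ge> 0"
  shows "((\<lambda>y. u1h y t) has_real_derivative u2h y t / qh y t) (at y)"
  using DERIV_chain2[OF D_deriv[OF assms, of 1] X_deriv[OF assms]]
  by (simp add: qh_def u1h_def u2h_def numeral_2_eq_2)

text \<open>Multiplying the components of \<open>(\<psi>, \<psi>\<^sub>x / z, \<psi>\<^sub>x\<^sub>x / z\<^sup>2)\<close> by \<open>q\<close>, \<open>1\<close>, \<open>1 / q\<close> removes \<open>u\<^sub>x\<close> from the
  time equation and leaves a cyclic system with the coefficients \<open>kh i / z\<close>.\<close>

definition "kh i y t = (if i = (1::3) then (qh y t)\<^sup>2 else 1 / qh y t)"

lemma kh_cyclic:
  assumes T: "T \<ge> 0"
  obtains K where "\<And>j. cyclic_ode kh (\<lambda>i. vand i j) K T"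
proof -
  obtain c where c: "c > 0" "\<And>x s. s \<in> {0..T} \<Longrightarrow> q x s \<ge> c" by (rule q_lower) blast
  obtain C where C: "C \<ge> 1" "\<And>x s. s \<in> {0..T} \<Longrightarrow> q x s \<le> C" by (rule q_upper) blast
  define K where "K = max (C\<^sup>2) (1 / c)"
  have K1: "K \<ge> 1" using C(1) by (simp add: K_def le_max_iff_disj one_le_power)
  have kb: "\<bar>kh i y t\<bar> \<le> K" if "t \<in> {0..T}" for i y t
  proof -
    have "qh y t \<le> C" "qh y t \<ge> c" "qh y t > 0"
      using c C qh_pos that by (auto simp: qh_def)
    then have "(qh y t)\<^sup>2 \<le> C\<^sup>2" "1 / qh y t \<le> 1 / c"
      using c(1) by (auto intro!: power_mono frac_le)
    then show ?thesis using \<open>qh y t > 0\<close> by (auto simp: kh_def K_def)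
  qed
  have kc: "continuous_on (UNIV \<times> {0..T}) (\<lambda>(y, t). kh i y t)" for i
  proof -
    have "continuous_on (UNIV \<times> {0..T}) (\<lambda>(y, t). (qh y t)\<^sup>2)"
      using qh_cont[of T] by (auto simp: case_prod_unfold intro!: continuous_intros)
    moreover have "continuous_on (UNIV \<times> {0..T}) (\<lambda>(y, t). 1 / qh y t)"
      using qh_cont[of T] qh_pos by (auto simp: case_prod_unfold intro!: continuous_intros simp: less_imp_neq[symmetric])
    ultimately show ?thesis by (cases "i = 1") (simp_all add: kh_def)
  qed
  show ?thesis
    by (rule that[of K], unfold_locales) (use K1 T kb kc norm_vand in auto)
qed

text \<open>The propagator at time \<open>t\<close> applied to column \<open>j\<close> of
  \<open>vand\<close>. It is entire in 1/z, so it is holomorphic for z \<noteq> 0 and creates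
  neither jumps nor poles.\<close>

definition "Bmat i j z y t = cyclic_solution kh (\<lambda>i. vand i j) i (1 / z) y t"

lemma Bmat_t:
  assumes "t \<in> {0..T}"
  shows "((\<lambda>t. Bmat i j z y t) has_vector_derivative (1 / z) * (of_real (kh i y t) * Bmat (i - 1) j z y t)) (at t within {0..T})"
proof -
  obtain K where "\<And>j. cyclic_ode kh (\<lambda>i. vand i j) K T" using kh_cyclic assms by (metis atLeastAtMost_iff order_trans)
  from cyclic_ode.solution_deriv[OF this assms] show ?thesis unfolding Bmat_def .
qed

lemma Bmat_initial: "Bmat i j z y 0 = vand i j"
proof -
  obtain K where "\<And>j. cyclic_ode kh (\<lambda>i. vand i j) K 0" by (rule kh_cyclic[of 0]) auto
  from cyclic_ode.solution_initial[OF this] show ?thesis unfolding Bmat_def .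
qed

lemma Bmat_cont: "T \<ge> 0 \<Longrightarrow> continuous_on (UNIV \<times> {0..T}) (\<lambda>(y, t). Bmat i j z y t)"
  unfolding Bmat_def using kh_cyclic cyclic_ode.solution_cont by metis

lemma Bmat_bound:
  assumes "T \<ge> 0"
  obtains B where "B \<ge> 0" "\<And>i j y t. t \<in> {0..T} \<Longrightarrow> norm (Bmat i j z y t) \<le> B"
proof -
  obtain K where K: "\<And>j. cyclic_ode kh (\<lambda>i. vand i j) K T" using kh_cyclic[OF assms] by blast
  show ?thesis
    by (rule that[of "exp (norm (1 / z) * (K * T))"])
      (use cyclic_ode.solution_bound[OF K] in \<open>auto simp: Bmat_def\<close>)
qed

lemma Bmat_holomorphic:
  assumes "t \<ge> 0"
  shows "(\<lambda>z. Bmat i j z y t) holomorphic_on - {0}"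
proof -
  obtain K where K: "\<And>j. cyclic_ode kh (\<lambda>i. vand i j) K t" using kh_cyclic[OF assms] by blast
  have "(\<lambda>\<zeta>. cyclic_solution kh (\<lambda>i. vand i j) i \<zeta> y t) holomorphic_on UNIV"
    by (rule cyclic_ode.solution_holomorphic[OF K]) (use assms in auto)
  then have "(\<lambda>\<zeta>. cyclic_solution kh (\<lambda>i. vand i j) i \<zeta> y t) \<circ> (\<lambda>z. 1 / z) holomorphic_on - {0}"
    by (intro holomorphic_on_compose_gen[where t = UNIV] holomorphic_intros) auto
  then show ?thesis by (simp add: o_def Bmat_def)
qed

lemma Bmat_large_z:
  assumes "t \<ge> 0"
  obtains C where "C \<ge> 0" "\<And>i j y z. norm z \<ge> 1 \<Longrightarrow> norm (Bmat i j z y t - vand i j) \<le> C / norm z"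
proof -
  obtain K where K: "\<And>j. cyclic_ode kh (\<lambda>i. vand i j) K t" using kh_cyclic[OF assms] by blast
  have "K \<ge> 1" using K by (simp add: cyclic_ode_def)
  show ?thesis
  proof (rule that[of "K * t * exp (K * t)"])
    fix i j y and z :: complex assume z: "norm z \<ge> 1"
    then have "norm (1 / z) \<le> 1" by (simp add: norm_divide divide_le_eq)
    from cyclic_ode.solution_near_zero[OF K[of j] _ this, where t = t and i = i and y = y] assms
    show "norm (Bmat i j z y t - vand i j) \<le> K * t * exp (K * t) / norm z"
      by (simp add: Bmat_def norm_divide)
  qed (use \<open>K \<ge> 1\<close> assms in auto)
qed

lemma qh_limit:
  assumes "e > 0" "T \<ge> 0"
  obtains R where "R > 0" "\<And>y t. \<bar>y\<bar> \<ge> R \<Longrightarrow> t \<in> {0..T} \<Longrightarrow> \<bar>qh y t - 1\<bar> < e"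
proof -
  obtain C where C: "C \<ge> 0" "\<And>x t. t \<in> {0..T} \<Longrightarrow> \<bar>q x t - 1\<bar> \<le> C * wt x" by (rule q_minus_one_bound) blast
  obtain R where R: "R > 0" "\<And>x. \<bar>x\<bar> \<ge> R \<Longrightarrow> C * wt x < e" by (rule wt_small[OF assms(1)]) blast
  obtain A where A: "A > 0" "\<And>x t. t \<in> {0..T} \<Longrightarrow> \<bar>Y x t - x\<bar> \<le> A" by (rule Y_bound) blast
  show ?thesis
  proof (rule that[of "R + A"])
    fix y t assume y: "\<bar>y\<bar> \<ge> R + A" and t: "t \<in> {0..T}"
    have "\<bar>y - X y t\<bar> \<le> A" using A(2)[OF t, of "X y t"] t by simp
    then have "\<bar>X y t\<bar> \<ge> R" using y by linarith
    then show "\<bar>qh y t - 1\<bar> < e" using C(2)[OF t, of "X y t"] R(2) unfolding qh_def by fastforce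
  qed (use R A in auto)
qed

text \<open>For \<open>q = 1\<close> the propagator is conjugate to \<open>e\<^bsup>t \<Lambda>\<inverse>\<^esup>\<close>.\<close>

lemma Bmat_limit:
  assumes t: "t \<ge> 0"
  shows "((\<lambda>y. Bmat i j z y t) \<longlongrightarrow> vand i j * exp (of_real t * inverse (lam z $ j))) at_top"
    and "((\<lambda>y. Bmat i j z y t) \<longlongrightarrow> vand i j * exp (of_real t * inverse (lam z $ j))) at_bot"
proof -
  obtain K where K: "\<And>j. cyclic_ode kh (\<lambda>i. vand i j) K t" using kh_cyclic[OF t] by blast
  obtain c where c: "c > 0" "\<And>x s. s \<in> {0..t} \<Longrightarrow> q x s \<ge> c" by (rule q_lower) blast
  obtain C where C: "C \<ge> 1" "\<And>x s. s \<in> {0..t} \<Longrightarrow> q x s \<le> C" by (rule q_upper) blast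
  \<comment> \<open>The summands control q^2 - 1 = (q + 1)(q - 1) and 1/q - 1 = -(q - 1)/q, the two
    kinds of deviation of the coefficients from 1.\<close>
  define A where "A = (C + 1) + 1 / c"
  have A: "A > 0" using c C by (simp add: A_def add_pos_pos)
  have kh1: "\<bar>kh i y s - 1\<bar> \<le> A * \<bar>qh y s - 1\<bar>" if s: "s \<in> {0..t}" for i y s
  proof -
    have qh: "qh y s \<le> C" "qh y s \<ge> c" "qh y s > 0" using c C qh_pos s by (auto simp: qh_def)
    show ?thesis
    proof (cases "i = 1")
      case True
      have "kh i y s - 1 = (qh y s + 1) * (qh y s - 1)"
        using True by (simp add: kh_def algebra_simps power2_eq_square)
      then have "\<bar>kh i y s - 1\<bar> = (qh y s + 1) * \<bar>qh y s - 1\<bar>" using qh by (simp add: abs_mult)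
      also have "\<dots> \<le> A * \<bar>qh y s - 1\<bar>" using qh c(1) by (intro mult_right_mono) (auto simp: A_def add_increasing2)
      finally show ?thesis .
    next
      case False
      have "kh i y s - 1 = - (1 / qh y s) * (qh y s - 1)" using False qh by (simp add: kh_def field_simps)
      then have "\<bar>kh i y s - 1\<bar> = (1 / qh y s) * \<bar>qh y s - 1\<bar>" using qh by (simp add: abs_mult)
      also have "\<dots> \<le> A * \<bar>qh y s - 1\<bar>"
      proof (intro mult_right_mono)
        have "1 / qh y s \<le> 1 / c" using qh c(1) by (intro frac_le) auto
        then show "1 / qh y s \<le> A" using C by (simp add: A_def)
      qed auto
      finally show ?thesis .
    qed
  qed
  have ex: "(1 / z) * om j ^ 2 * of_real t = of_real t * inverse (lam z $ j)"
  proof -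
    have "inverse (om j) = om j ^ 2" using om_square_square(2)[of j] by (rule inverse_unique)
    then show ?thesis by (simp add: lam_om inverse_mult_distrib divide_inverse mult_ac del: om_simps)
  qed
  define S where "S = (\<Sum>n. of_nat n * cyclic_ode.maj K t (1 / z) n)"
  have near: "norm (Bmat i j z y t - vand i j * exp (of_real t * inverse (lam z $ j))) \<le> \<epsilon> * S"
    if \<epsilon>: "\<And>i s. s \<in> {0..t} \<Longrightarrow> \<bar>kh i y s - 1\<bar> \<le> \<epsilon>" for \<epsilon> y
    unfolding Bmat_def S_def ex[symmetric]
    by (rule cyclic_ode.solution_near_shift[OF K]) (use \<epsilon> t vand_shift in \<open>auto simp: norm_power simp del: om_simps\<close>)
  have "\<exists>R. \<forall>y. \<bar>y\<bar> \<ge> R \<longrightarrow> norm (Bmat i j z y t - vand i j * exp (of_real t * inverse (lam z $ j))) < e" if e: "e > 0" for e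
  proof -
    have pos: "e / (A * (\<bar>S\<bar> + 1)) > 0" using e A by (intro divide_pos_pos mult_pos_pos) auto
    obtain R where R: "R > 0" "\<And>y s. \<bar>y\<bar> \<ge> R \<Longrightarrow> s \<in> {0..t} \<Longrightarrow> \<bar>qh y s - 1\<bar> < e / (A * (\<bar>S\<bar> + 1))"
      by (rule qh_limit[OF pos t]) blast
    have "norm (Bmat i j z y t - vand i j * exp (of_real t * inverse (lam z $ j))) < e" if y: "\<bar>y\<bar> \<ge> R" for y
    proof -
      have "norm (Bmat i j z y t - vand i j * exp (of_real t * inverse (lam z $ j))) \<le> (e / (\<bar>S\<bar> + 1)) * S"
      proof (rule near)
        fix i s assume s: "s \<in> {0..t}"
        have "\<bar>kh i y s - 1\<bar> \<le> A * (e / (A * (\<bar>S\<bar> + 1)))"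
          using R(2)[OF y s] A by (intro order_trans[OF kh1[OF s]] mult_left_mono) auto
        then show "\<bar>kh i y s - 1\<bar> \<le> e / (\<bar>S\<bar> + 1)" using A by simp
      qed
      also have "\<dots> \<le> (e / (\<bar>S\<bar> + 1)) * \<bar>S\<bar>" using e by (intro mult_left_mono) auto
      also have "\<dots> < e" using e by (simp add: field_simps)
      finally show ?thesis .
    qed
    then show ?thesis by blast
  qed
  then show "((\<lambda>y. Bmat i j z y t) \<longlongrightarrow> vand i j * exp (of_real t * inverse (lam z $ j))) at_top"
    "((\<lambda>y. Bmat i j z y t) \<longlongrightarrow> vand i j * exp (of_real t * inverse (lam z $ j))) at_bot"
    unfolding tendsto_iff dist_norm eventually_at_top_linorder eventually_at_bot_linorder
    by (metis abs_ge_self order_trans, metis abs_ge_minus_self minus_le_iff order_trans neg_le_iff_le)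
qed

end

text \<open>Both equations of the Lax pair for \<open>(\<psi>, \<psi>\<^sub>x / z, \<psi>\<^sub>x\<^sub>x / z\<^sup>2)\<close>, in the coordinates \<open>(y, t)\<close>, are of the
  form \<open>v \<mapsto> lax_act z (\<alpha>, \<beta>, \<gamma>, \<kappa>) v\<close>: the first with \<open>\<alpha> = 1 / q\<close>, \<open>\<beta> = q\<^sup>2\<close>, the second with
  \<open>\<gamma> = u\<^sub>x\<close>, \<open>\<kappa> = 1 / z\<close>.\<close>

fun lax_act :: "complex \<Rightarrow> complex \<times> complex \<times> complex \<times> complex \<Rightarrow> complex \<times> complex \<times> complex \<Rightarrow> complex \<times> complex \<times> complex" where
  "lax_act z (\<alpha>, \<beta>, \<gamma>, \<kappa>) (v1, v2, v3) =
     (z * \<alpha> * v2 + \<gamma> * v1 + \<kappa> * v3, z * \<alpha> * v3 + \<kappa> * v1, z * \<beta> * v1 + \<kappa> * v2 - \<gamma> * v3)"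

lemma bounded_bilinear_lax_act: "bounded_bilinear (lax_act z)"
proof -
  have "bilinear (lax_act z)"
    unfolding bilinear_def
  proof (intro conjI allI linearI)
    fix a b :: "complex \<times> complex \<times> complex \<times> complex" and v w :: "complex \<times> complex \<times> complex" and r :: real
    show "lax_act z a (v + w) = lax_act z a v + lax_act z a w"
      "lax_act z (a + b) v = lax_act z a v + lax_act z b v"
      "lax_act z a (r *\<^sub>R v) = r *\<^sub>R lax_act z a v"
      "lax_act z (r *\<^sub>R a) v = r *\<^sub>R lax_act z a v"
      by (cases a, cases b, cases v, cases w, simp add: algebra_simps)+
  qed
  then show ?thesis by (simp add: bilinear_conv_bounded_bilinear)
qed

text \<open>The zero curvature relation. The powers of \<open>z\<close> cancel between the two
  operators, and the relation of \<open>q\<close> to u_xx enters only in the form u_xx / q = 1/q -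
  q^2.\<close>

lemma lax_compatible:
  fixes q u1 u2 z :: complex
  assumes q: "q \<noteq> 0" and z: "z \<noteq> 0" and e: "q ^ 3 = 1 - u2"
  shows "lax_act z (u1 / q, - 2 * u1 * q\<^sup>2, 0, 0) v + lax_act z (1 / q, q\<^sup>2, 0, 0) (lax_act z (0, 0, u1, 1 / z) v)
    = lax_act z (0, 0, u2 / q, 0) v + lax_act z (0, 0, u1, 1 / z) (lax_act z (1 / q, q\<^sup>2, 0, 0) v)"
proof -
  have u2: "u2 / q = 1 / q - q\<^sup>2"
    using q e by (simp add: field_simps power2_eq_square power3_eq_cube)
  obtain v1 v2 v3 where v: "v = (v1, v2, v3)" by (cases v) auto
  show ?thesis
    unfolding v u2 using q z by (simp add: field_simps power2_eq_square)
qed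

section \<open>Zero curvature applied to the eigenfunctions\<close>

context scattering_problem
begin

context
  fixes z :: complex and l :: 3
  assumes z: "z \<notin> contour \<union> Z"
begin

text \<open>In terms of a solution \<psi> of the Lax pair this is (q \<psi>, \<psi>_x / z, \<psi>_xx
  / (q z^2)), the form in which the time evolution is cyclic; \<open>fvec\<close> removes the
  weights.\<close>

definition "avec i y t = (\<Sum>k\<in>UNIV. Bmat i k z y t * M (X y 0) z $ k $ l) * exp (of_real y * lam z $ l)"

definition "fvec y t = (avec 1 y t / of_real (qh y t), avec 2 y t, of_real (qh y t) * avec 3 y t)"

lemma z_nonzero: "z \<noteq> 0"
  using z by auto

lemma avec_t:
  assumes "t \<in> {0..T}"
  shows "((\<lambda>t. avec i y t) has_vector_derivative (1 / z) * (of_real (kh i y t) * avec (i - 1) y t)) (at t within {0..T})"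
proof -
  have "((\<lambda>t. avec i y t) has_vector_derivative
      (\<Sum>k\<in>UNIV. (1 / z) * (of_real (kh i y t) * Bmat (i - 1) k z y t) * M (X y 0) z $ k $ l) * exp (of_real y * lam z $ l)) (at t within {0..T})"
    unfolding avec_def
    by (intro has_vector_derivative_mult_left has_vector_derivative_sum Bmat_t assms)
  then show ?thesis
    by (rule has_vector_derivative_eq_rhs) (simp add: avec_def sum_distrib_left sum_distrib_right mult_ac)
qed

lemma M_X_isCont: "continuous_on UNIV (\<lambda>y. M (X y 0) z $ k $ l)"
proof -
  have "continuous_on UNIV ((\<lambda>x. M x z $ k $ l) \<circ> (\<lambda>y. X y 0))"
    using X_deriv[of 0]
    by (intro continuous_on_compose)
      (auto intro!: continuous_at_imp_continuous_on M_isCont[OF z] DERIV_isCont)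
  then show ?thesis by (simp add: o_def)
qed

lemma avec_cont: "T \<ge> 0 \<Longrightarrow> continuous_on (UNIV \<times> {0..T}) (\<lambda>(y, t). avec i y t)"
proof -
  assume T: "T \<ge> 0"
  have "continuous_on (UNIV \<times> {0..T}) ((\<lambda>y. M (X y 0) z $ k $ l) \<circ> fst)" for k
    by (intro continuous_on_compose continuous_on_subset[OF M_X_isCont] continuous_intros) auto
  moreover have "continuous_on (UNIV \<times> {0..T}) (\<lambda>p. Bmat i k z (fst p) (snd p))" for k
    using Bmat_cont[OF T, of i k z] by (simp add: case_prod_unfold)
  ultimately have "continuous_on (UNIV \<times> {0..T}) (\<lambda>p. (\<Sum>k\<in>UNIV. Bmat i k z (fst p) (snd p) * M (X (fst p) 0) z $ k $ l) * exp (of_real (fst p) * lam z $ l))"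
    by (intro continuous_on_mult continuous_on_sum continuous_on_exp continuous_on_of_real continuous_on_const continuous_on_fst continuous_on_id)
      (simp_all add: o_def)
  then show ?thesis by (simp add: avec_def case_prod_unfold)
qed

text \<open>The factor exp(y \<lambda>_l) turns the commutator with \<Lambda> into multiplication
  from the left, and \<open>vand_cmat\<close> makes \<open>U\<close> diagonal. The diagonal term
  that is left is the one absorbed by the weights of \<open>fvec\<close>.\<close>

lemma avec_initial:
  "((\<lambda>y. avec i y 0) has_vector_derivative
      z * ((\<Sum>k\<in>UNIV. vand i k * om k * M (X y 0) z $ k $ l) * exp (of_real y * lam z $ l))
      + of_real (r (X y 0) / qh y 0) * (if i = 1 then 3 else if i = 2 then 0 else - 3) * avec i y 0) (at y)"
proof -
  let ?x = "X y 0" and ?e = "exp (of_real y * lam z $ l)"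
  let ?m = "\<lambda>k y. M (X y 0) z $ k $ l"
  have q0: "q ?x 0 \<noteq> 0" using q_pos[of 0 ?x] by simp
  have G: "G z k l ?x = of_real (r ?x) * (\<Sum>i\<in>UNIV. cmat k i * ?m i y)" for k by (simp add: G_def)
  define m' where "m' k = z * (om k - om l) * ?m k y + of_real (r ?x / q ?x 0) * (\<Sum>i\<in>UNIV. cmat k i * ?m i y)" for k
  have m: "((\<lambda>y. ?m k y) has_vector_derivative m' k) (at y)" for k
  proof -
    have "((\<lambda>y. X y 0) has_vector_derivative 1 / q ?x 0) (at y)"
      using X_deriv[of 0 y] by (simp add: has_real_derivative_iff_has_vector_derivative)
    from vector_diff_chain_at[OF this M_deriv[OF z, of k l ?x]]
    have "((\<lambda>y. ?m k y) has_vector_derivative (1 / q ?x 0) *\<^sub>R (z * (om k - om l) * of_real (q ?x 0) * ?m k y + G z k l ?x)) (at y)"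
      by (simp add: o_def)
    then show ?thesis
      by (rule has_vector_derivative_eq_rhs) (use q0 in \<open>simp add: m'_def G scaleR_conv_of_real field_simps\<close>)
  qed
  have e: "((\<lambda>y. exp (of_real y * lam z $ l)) has_vector_derivative lam z $ l * ?e) (at y)"
  proof -
    have "((\<lambda>y. of_real y * lam z $ l) has_vector_derivative lam z $ l) (at y)"
      by (rule has_vector_derivative_eq_rhs[OF has_vector_derivative_mult_left[OF has_vector_derivative_of_real[OF DERIV_ident]]]) simp
    then show ?thesis
      by (rule field_vector_diff_chain_at[unfolded o_def]) (auto intro: DERIV_exp)
  qed
  have av: "(\<lambda>y. avec i y 0) = (\<lambda>y. (\<Sum>k\<in>UNIV. vand i k * ?m k y) * exp (of_real y * lam z $ l))"
    by (simp add: avec_def Bmat_initial)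
  have "((\<lambda>y. avec i y 0) has_vector_derivative (\<Sum>k\<in>UNIV. vand i k * ?m k y) * (lam z $ l * ?e) + (\<Sum>k\<in>UNIV. vand i k * m' k) * ?e) (at y)"
    unfolding av by (intro has_vector_derivative_mult has_vector_derivative_sum has_vector_derivative_mult_right m e)
  then show ?thesis
  proof (rule has_vector_derivative_eq_rhs)
    have "(\<Sum>k\<in>UNIV. vand i k * (\<Sum>j\<in>UNIV. cmat k j * ?m j y)) = (\<Sum>j\<in>UNIV. (\<Sum>k\<in>UNIV. vand i k * cmat k j) * ?m j y)"
      unfolding sum_distrib_left sum_distrib_right by (subst sum.swap) (simp add: mult.assoc)
    also have "\<dots> = (if i = 1 then 3 else if i = 2 then 0 else - 3) * (\<Sum>j\<in>UNIV. vand i j * ?m j y)"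
      unfolding vand_cmat by (simp add: sum_distrib_left mult.assoc)
    finally have c: "(\<Sum>k\<in>UNIV. vand i k * (\<Sum>j\<in>UNIV. cmat k j * ?m j y))
      = (if i = 1 then 3 else if i = 2 then 0 else - 3) * (\<Sum>j\<in>UNIV. vand i j * ?m j y)" .
    have m'_sum: "(\<Sum>k\<in>UNIV. vand i k * m' k) = z * (\<Sum>k\<in>UNIV. vand i k * om k * ?m k y) - z * om l * (\<Sum>k\<in>UNIV. vand i k * ?m k y)
      + of_real (r ?x / q ?x 0) * (\<Sum>k\<in>UNIV. vand i k * (\<Sum>j\<in>UNIV. cmat k j * ?m j y))"
      unfolding m'_def by (simp add: distrib_left right_diff_distrib left_diff_distrib sum.distrib sum_subtractf sum_distrib_left mult_ac)
    show "(\<Sum>k\<in>UNIV. vand i k * ?m k y) * (lam z $ l * ?e) + (\<Sum>k\<in>UNIV. vand i k * m' k) * ?e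
      = z * ((\<Sum>k\<in>UNIV. vand i k * om k * ?m k y) * ?e)
      + of_real (r ?x / qh y 0) * (if i = 1 then 3 else if i = 2 then 0 else - 3) * avec i y 0"
      unfolding m'_sum c av[THEN fun_cong] lam_om[of z l] qh_def by (simp only: algebra_simps)
  qed
qed

lemma fvec_y:
  assumes t: "t \<ge> 0"
  shows "((\<lambda>y. fvec y t) has_vector_derivative lax_act z (1 / of_real (qh y t), (of_real (qh y t))\<^sup>2, 0, 0) (fvec y t)) (at y)"
proof (rule zero_curvature[OF bounded_bilinear_lax_act, where T = t
      and L' = "\<lambda>y t. (of_real (u1h y t) / of_real (qh y t), - 2 * of_real (u1h y t) * (of_real (qh y t))\<^sup>2, 0, 0)"
      and N = "\<lambda>y t. (0, 0, of_real (u1h y t), 1 / z)" and N' = "\<lambda>y t. (0, 0, of_real (u2h y t) / of_real (qh y t), 0)"])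
  have qc: "continuous_on (UNIV \<times> {0..t}) (\<lambda>p. complex_of_real (qh (fst p) (snd p)))"
    and u1c: "continuous_on (UNIV \<times> {0..t}) (\<lambda>p. complex_of_real (u1h (fst p) (snd p)))"
    and u2c: "continuous_on (UNIV \<times> {0..t}) (\<lambda>p. complex_of_real (u2h (fst p) (snd p)))"
    and ac: "continuous_on (UNIV \<times> {0..t}) (\<lambda>p. avec i (fst p) (snd p))" for i
    using qh_cont[of t] u1h_cont[of t] u2h_cont[of t] avec_cont[OF t, of i]
    by (auto simp: case_prod_unfold intro!: continuous_on_of_real)
  have q0: "complex_of_real (qh y s) \<noteq> 0" if "s \<in> {0..t}" for y s
    using qh_pos[of s y] that by auto
  show "continuous_on (UNIV \<times> {0..t}) (\<lambda>(y, t). fvec y t)"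
    unfolding fvec_def case_prod_unfold
    by (intro continuous_on_Pair continuous_on_mult continuous_on_divide ac qc ballI) (use q0 in auto)
  show "continuous_on (UNIV \<times> {0..t}) (\<lambda>(y, t). (1 / complex_of_real (qh y t), (complex_of_real (qh y t))\<^sup>2, 0 :: complex, 0 :: complex))"
    unfolding case_prod_unfold
    by (intro continuous_on_Pair continuous_on_power continuous_on_divide continuous_on_const qc ballI) (use q0 in auto)
  show "continuous_on (UNIV \<times> {0..t}) (\<lambda>(y, t). (complex_of_real (u1h y t) / of_real (qh y t), - 2 * complex_of_real (u1h y t) * (of_real (qh y t))\<^sup>2, 0 :: complex, 0 :: complex))"
    unfolding case_prod_unfold
    by (intro continuous_on_Pair continuous_on_mult continuous_on_power continuous_on_divide continuous_on_const qc u1c ballI) (use q0 in auto)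
  show "continuous_on (UNIV \<times> {0..t}) (\<lambda>(y, t). (0 :: complex, 0 :: complex, complex_of_real (u1h y t), 1 / z))"
    unfolding case_prod_unfold by (intro continuous_on_Pair continuous_on_const u1c)
  show "continuous_on (UNIV \<times> {0..t}) (\<lambda>(y, t). (0 :: complex, 0 :: complex, complex_of_real (u2h y t) / of_real (qh y t), 0 :: complex))"
    unfolding case_prod_unfold
    by (intro continuous_on_Pair continuous_on_divide continuous_on_const qc u2c ballI) (use q0 in auto)
  show "t \<in> {0..t}" using t by simp
  have qt: "((\<lambda>s. complex_of_real (qh y s)) has_vector_derivative - of_real (u1h y s) * of_real (qh y s)) (at s within {0..t})"
    if "s \<in> {0..t}" for s y
  proof -
    have "((\<lambda>s. qh y s) has_real_derivative - u1h y s * qh y s) (at s within {0..t})"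
      by (rule DERIV_subset[OF qh_t]) (use that in auto)
    then have "((\<lambda>s. complex_of_real (qh y s)) has_vector_derivative of_real (- u1h y s * qh y s)) (at s within {0..t})"
      by (intro has_vector_derivative_of_real) (simp add: has_real_derivative_iff_has_vector_derivative)
    then show ?thesis by simp
  qed
  have qit: "((\<lambda>s. 1 / complex_of_real (qh y s)) has_vector_derivative of_real (u1h y s) / of_real (qh y s)) (at s within {0..t})"
    if "s \<in> {0..t}" for s y
  proof -
    have "qh y s \<noteq> 0" using qh_pos[of s y] that by auto
    have "((\<lambda>s. qh y s) has_real_derivative - u1h y s * qh y s) (at s within {0..t})"
      by (rule DERIV_subset[OF qh_t]) (use that in auto)
    from DERIV_inverse'[OF this \<open>qh y s \<noteq> 0\<close>]
    have "((\<lambda>s. 1 / qh y s) has_real_derivative - (inverse (qh y s) * (- u1h y s * qh y s) * inverse (qh y s))) (at s within {0..t})"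
      unfolding inverse_eq_divide .
    also have "- (inverse (qh y s) * (- u1h y s * qh y s) * inverse (qh y s)) = u1h y s / qh y s"
      using \<open>qh y s \<noteq> 0\<close> by (simp add: field_simps)
    finally have "((\<lambda>s. 1 / qh y s) has_real_derivative u1h y s / qh y s) (at s within {0..t})" .
    then have "((\<lambda>s. complex_of_real (1 / qh y s)) has_vector_derivative of_real (u1h y s / qh y s)) (at s within {0..t})"
      by (intro has_vector_derivative_of_real) (simp add: has_real_derivative_iff_has_vector_derivative)
    then show ?thesis by simp
  qed
  have kh: "kh 1 y s = (qh y s)\<^sup>2" "kh 2 y s = 1 / qh y s" "kh 3 y s = 1 / qh y s" for y s by (simp_all add: kh_def)
  fix y s
  show "((\<lambda>y. fvec y 0) has_vector_derivative lax_act z (1 / of_real (qh y 0), (of_real (qh y 0))\<^sup>2, 0, 0) (fvec y 0)) (at y)"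
  proof -
    let ?q = "complex_of_real (qh y 0)"
    have q0': "qh y 0 > 0" by (rule qh_pos) simp
    define \<rho> where "\<rho> = complex_of_real (q' (X y 0) 0 / qh y 0)"
    have 3: "of_real (r (X y 0) / qh y 0) * 3 = \<rho> / ?q"
      by (simp add: r_def \<rho>_def qh_def)
    \<comment> \<open>Multiplication by \<open>om k\<close> shifts the rows of \<open>vand\<close>
      cyclically, which produces the companion form of the third-order equation.\<close>
    have S: "(\<Sum>k\<in>UNIV. vand 1 k * om k * M (X y 0) z $ k $ l) * exp (of_real y * lam z $ l) = avec 2 y 0"
      "(\<Sum>k\<in>UNIV. vand 2 k * om k * M (X y 0) z $ k $ l) * exp (of_real y * lam z $ l) = avec 3 y 0"
      "(\<Sum>k\<in>UNIV. vand 3 k * om k * M (X y 0) z $ k $ l) * exp (of_real y * lam z $ l) = avec 1 y 0"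
      by (simp_all only: avec_def Bmat_initial vand_simps om_square_square mult_1_left power2_eq_square[symmetric])
    have a: "((\<lambda>y. avec 1 y 0) has_vector_derivative z * avec 2 y 0 + \<rho> / ?q * avec 1 y 0) (at y)"
      "((\<lambda>y. avec 2 y 0) has_vector_derivative z * avec 3 y 0) (at y)"
      "((\<lambda>y. avec 3 y 0) has_vector_derivative z * avec 1 y 0 - \<rho> / ?q * avec 3 y 0) (at y)"
      using avec_initial[of 1 y] avec_initial[of 2 y] avec_initial[of 3 y]
      unfolding S by (simp_all add: 3[symmetric])
    have qy: "((\<lambda>y. complex_of_real (qh y 0)) has_vector_derivative \<rho>) (at y)"
      unfolding \<rho>_def using qh_y[of 0 y]
      by (intro has_vector_derivative_of_real) (simp add: has_real_derivative_iff_has_vector_derivative)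
    have qiy: "((\<lambda>y. 1 / complex_of_real (qh y 0)) has_vector_derivative - \<rho> / ?q\<^sup>2) (at y)"
    proof -
      have "((\<lambda>y. inverse (qh y 0)) has_real_derivative - (inverse (qh y 0) * (q' (X y 0) 0 / qh y 0) * inverse (qh y 0))) (at y)"
        by (rule DERIV_inverse'[OF qh_y]) (use q0' in auto)
      then have "((\<lambda>y. complex_of_real (inverse (qh y 0))) has_vector_derivative of_real (- (inverse (qh y 0) * (q' (X y 0) 0 / qh y 0) * inverse (qh y 0)))) (at y)"
        by (intro has_vector_derivative_of_real) (simp add: has_real_derivative_iff_has_vector_derivative)
      then show ?thesis by (simp add: \<rho>_def field_simps power2_eq_square)
    qed
    have fv: "(\<lambda>y. fvec y 0) = (\<lambda>y. (avec 1 y 0 * (1 / of_real (qh y 0)), avec 2 y 0, of_real (qh y 0) * avec 3 y 0))"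
      by (simp add: fvec_def)
    have "((\<lambda>y. fvec y 0) has_vector_derivative
       (avec 1 y 0 * (- \<rho> / ?q\<^sup>2) + (z * avec 2 y 0 + \<rho> / ?q * avec 1 y 0) * (1 / ?q), z * avec 3 y 0,
        ?q * (z * avec 1 y 0 - \<rho> / ?q * avec 3 y 0) + \<rho> * avec 3 y 0)) (at y)"
      unfolding fv by (intro has_vector_derivative_Pair has_vector_derivative_mult a qy qiy)
    then show ?thesis
      by (rule has_vector_derivative_eq_rhs) (use q0' in \<open>simp add: fvec_def field_simps power2_eq_square\<close>)
  qed
  assume s: "s \<in> {0..t}"
  show "((\<lambda>s. fvec y s) has_vector_derivative lax_act z (0, 0, of_real (u1h y s), 1 / z) (fvec y s)) (at s within {0..t})"
  proof -
    let ?q = "complex_of_real (qh y s)"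
    note a = avec_t[OF s, of 1 y, unfolded kh cyclic_pred_3] avec_t[OF s, of 2 y, unfolded kh cyclic_pred_3] avec_t[OF s, of 3 y, unfolded kh cyclic_pred_3]
    have fv: "(\<lambda>s. fvec y s) = (\<lambda>s. (avec 1 y s * (1 / of_real (qh y s)), avec 2 y s, of_real (qh y s) * avec 3 y s))"
      by (simp add: fvec_def)
    have "((\<lambda>s. fvec y s) has_vector_derivative
       (avec 1 y s * (of_real (u1h y s) / ?q) + (1 / z * (of_real ((qh y s)\<^sup>2) * avec 3 y s)) * (1 / ?q),
        1 / z * (of_real (1 / qh y s) * avec 1 y s),
        ?q * (1 / z * (of_real (1 / qh y s) * avec 2 y s)) + (- of_real (u1h y s) * ?q) * avec 3 y s)) (at s within {0..t})"
      unfolding fv by (intro has_vector_derivative_Pair has_vector_derivative_mult a qt qit s)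
    then show ?thesis
      by (rule has_vector_derivative_eq_rhs) (use q0[OF s] z_nonzero in \<open>simp add: fvec_def field_simps power2_eq_square\<close>)
  qed
  show "((\<lambda>s. (1 / complex_of_real (qh y s), (complex_of_real (qh y s))\<^sup>2, 0 :: complex, 0 :: complex)) has_vector_derivative
      (of_real (u1h y s) / of_real (qh y s), - 2 * of_real (u1h y s) * (of_real (qh y s))\<^sup>2, 0, 0)) (at s within {0..t})"
  proof -
    have "((\<lambda>s. (complex_of_real (qh y s))\<^sup>2) has_vector_derivative - 2 * of_real (u1h y s) * (of_real (qh y s))\<^sup>2) (at s within {0..t})"
      unfolding power2_eq_square
      by (rule has_vector_derivative_eq_rhs[OF has_vector_derivative_mult[OF qt[OF s] qt[OF s]]]) (simp add: algebra_simps)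
    then show ?thesis by (intro has_vector_derivative_Pair has_vector_derivative_const qit s)
  qed
  show "((\<lambda>y. (0 :: complex, 0 :: complex, complex_of_real (u1h y s), 1 / z)) has_vector_derivative
      (0, 0, of_real (u2h y s) / of_real (qh y s), 0)) (at y)"
  proof -
    have "((\<lambda>y. complex_of_real (u1h y s)) has_vector_derivative of_real (u2h y s / qh y s)) (at y)"
      using u1h_y[of s y] s by (intro has_vector_derivative_of_real) (auto simp: has_real_derivative_iff_has_vector_derivative)
    then show ?thesis by (intro has_vector_derivative_Pair has_vector_derivative_const) simp
  qed
  show "lax_act z (of_real (u1h y s) / of_real (qh y s), - 2 * of_real (u1h y s) * (of_real (qh y s))\<^sup>2, 0, 0) v
      + lax_act z (1 / of_real (qh y s), (of_real (qh y s))\<^sup>2, 0, 0) (lax_act z (0, 0, of_real (u1h y s), 1 / z) v)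
    = lax_act z (0, 0, of_real (u2h y s) / of_real (qh y s), 0) v
      + lax_act z (0, 0, of_real (u1h y s), 1 / z) (lax_act z (1 / of_real (qh y s), (of_real (qh y s))\<^sup>2, 0, 0) v)" for v
  proof (rule lax_compatible[OF q0[OF s] z_nonzero])
    have "complex_of_real (qh y s ^ 3) = of_real (1 - u2h y s)" using qh_cube[of s y] s by simp
    then show "complex_of_real (qh y s) ^ 3 = 1 - of_real (u2h y s)" by simp
  qed
qed

end

end

section \<open>The propagated eigenfunctions for small \<open>z\<close>\<close>

lemma sum_vinv: "(\<Sum>k\<in>UNIV. vinv k i) = (if i = 1 then 1 else 0)"
  using exhaust_3[of i] sum_om by (auto simp: vinv_simps sum_divide_distrib[symmetric] simp del: om_simps)

lemma has_vector_derivative_fst: "(f has_vector_derivative D) F \<Longrightarrow> ((\<lambda>x. fst (f x)) has_vector_derivative fst D) F"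
  by (rule bounded_linear.has_vector_derivative[OF bounded_linear_fst])

lemma has_vector_derivative_snd: "(f has_vector_derivative D) F \<Longrightarrow> ((\<lambda>x. snd (f x)) has_vector_derivative snd D) F"
  by (rule bounded_linear.has_vector_derivative[OF bounded_linear_snd])

context scattering_problem
begin

definition "bvec z l i y t = (\<Sum>k\<in>UNIV. Bmat i k z y t * M (X y 0) z $ k $ l)"

definition dfac :: "3 \<Rightarrow> real \<Rightarrow> real \<Rightarrow> complex" where
  "dfac i y t = of_real (if i = 1 then 1 / qh y t else if i = 2 then 1 else qh y t)"

text \<open>The propagated solution in the diagonal basis, normalized by exp(- x \<lambda>_l -
  t/\<lambda>_l) with the phase \<open>x\<close> instead of \<open>y\<close>. \<open>bvec\<close>
  carries no exponential in \<open>y\<close>, which leaves the factor with \<open>Y x t - x\<close>.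
  In this normalization the deviation from the free equation has size |z| |u_xx|.\<close>

definition "Efun z l t j x = (\<Sum>i\<in>UNIV. vinv j i * (dfac i (Y x t) t * bvec z l i (Y x t) t))
   * exp (of_real (Y x t - x) * lam z $ l) * exp (- (of_real t * inverse (lam z $ l)))"

lemma dfac_simps: "dfac 1 y t = 1 / of_real (qh y t)" "dfac 2 y t = 1" "dfac 3 y t = of_real (qh y t)"
  by (simp_all add: dfac_def)

lemma dfac_nonzero: "t \<ge> 0 \<Longrightarrow> dfac i y t \<noteq> 0"
  using qh_pos[of t y] by (simp add: dfac_def)

lemma qh_Y: "t \<ge> 0 \<Longrightarrow> qh (Y x t) t = q x t"
  by (simp add: qh_def)

definition "gvec z l t i x = dfac i (Y x t) t * avec z l i (Y x t) t"

text \<open>Passing from \<open>y\<close> to \<open>x\<close> multiplies by \<open>q\<close> and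
  clears the weights: the system is \<psi>_xxx = z^3 q^3 \<psi> for the first component.\<close>

lemma gvec_deriv:
  assumes z: "z \<notin> contour \<union> Z" and t: "t \<ge> 0"
  shows "((\<lambda>x. gvec z l t 1 x) has_vector_derivative z * gvec z l t 2 x) (at x)"
    "((\<lambda>x. gvec z l t 2 x) has_vector_derivative z * gvec z l t 3 x) (at x)"
    "((\<lambda>x. gvec z l t 3 x) has_vector_derivative z * of_real (q x t) ^ 3 * gvec z l t 1 x) (at x)"
proof -
  let ?q = "complex_of_real (q x t)"
  have q0: "?q \<noteq> 0" using q_pos[OF t, of x] by simp
  have fv: "fvec z l (Y x t) t = (gvec z l t 1 x, gvec z l t 2 x, gvec z l t 3 x)" for x
    by (simp add: fvec_def[OF z] gvec_def dfac_simps)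
  have "((\<lambda>x. Y x t) has_vector_derivative q x t) (at x)"
    using Y_deriv[OF t] by (simp add: has_real_derivative_iff_has_vector_derivative)
  from vector_diff_chain_at[OF this fvec_y[OF z t, of l "Y x t"]]
  have "((\<lambda>x. (gvec z l t 1 x, gvec z l t 2 x, gvec z l t 3 x)) has_vector_derivative
     q x t *\<^sub>R lax_act z (1 / ?q, ?q\<^sup>2, 0, 0) (gvec z l t 1 x, gvec z l t 2 x, gvec z l t 3 x)) (at x)"
    by (simp add: o_def fv qh_Y[OF t] del: lax_act.simps)
  also have "q x t *\<^sub>R lax_act z (1 / ?q, ?q\<^sup>2, 0, 0) (gvec z l t 1 x, gvec z l t 2 x, gvec z l t 3 x)
    = (z * gvec z l t 2 x, z * gvec z l t 3 x, z * ?q ^ 3 * gvec z l t 1 x)"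
    using q0 by (simp add: scaleR_conv_of_real power2_eq_square power3_eq_cube)
  finally have d: "((\<lambda>x. (gvec z l t 1 x, gvec z l t 2 x, gvec z l t 3 x)) has_vector_derivative
     (z * gvec z l t 2 x, z * gvec z l t 3 x, z * ?q ^ 3 * gvec z l t 1 x)) (at x)" .
  show "((\<lambda>x. gvec z l t 1 x) has_vector_derivative z * gvec z l t 2 x) (at x)"
    using has_vector_derivative_fst[OF d] by simp
  show "((\<lambda>x. gvec z l t 2 x) has_vector_derivative z * gvec z l t 3 x) (at x)"
    using has_vector_derivative_fst[OF has_vector_derivative_snd[OF d]] by simp
  show "((\<lambda>x. gvec z l t 3 x) has_vector_derivative z * ?q ^ 3 * gvec z l t 1 x) (at x)"
    using has_vector_derivative_snd[OF has_vector_derivative_snd[OF d]] by simp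
qed

lemma Efun_gvec:
  assumes z: "z \<notin> contour \<union> Z"
  shows "Efun z l t j x = (\<Sum>i\<in>UNIV. vinv j i * gvec z l t i x) * exp (- (of_real x * lam z $ l)) * exp (- (of_real t * inverse (lam z $ l)))"
proof -
  have "gvec z l t i x * exp (- (of_real x * lam z $ l)) = dfac i (Y x t) t * bvec z l i (Y x t) t * exp (of_real (Y x t - x) * lam z $ l)" for i
    unfolding gvec_def avec_def[OF z] bvec_def mult.assoc exp_add[symmetric] by (simp add: algebra_simps)
  then have eqi: "vinv j i * (dfac i (Y x t) t * bvec z l i (Y x t) t) * exp (of_real (Y x t - x) * lam z $ l)
      = vinv j i * gvec z l t i x * exp (- (of_real x * lam z $ l))" for i
    by (metis mult.assoc)
  have "(\<Sum>i\<in>UNIV. vinv j i * (dfac i (Y x t) t * bvec z l i (Y x t) t)) * exp (of_real (Y x t - x) * lam z $ l)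
    = (\<Sum>i\<in>UNIV. vinv j i * gvec z l t i x) * exp (- (of_real x * lam z $ l))"
    unfolding sum_distrib_right by (intro sum.cong refl eqi)
  then show ?thesis unfolding Efun_def by (simp only:)
qed

text \<open>Writing q^3 = 1 - u_xx separates the free system. The perturbation acts only on the
  first component \<psi>, which is the column sum of \<open>Efun\<close> up to the normalizing
  exponentials, because the columns of \<open>vinv\<close> other than the first sum to 0.\<close>

lemma Efun_deriv:
  assumes z: "z \<notin> contour \<union> Z" and t: "t \<ge> 0"
  shows "((\<lambda>x. Efun z l t j x) has_vector_derivative z * (om j - om l) * Efun z l t j x
               - z * of_real (D 2 x t) * (om j / 3) * (\<Sum>k\<in>UNIV. Efun z l t k x)) (at x)"
proof -
  let ?e = "\<lambda>x. exp (- (of_real x * lam z $ l))" and ?c = "exp (- (of_real t * inverse (lam z $ l)))"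
  let ?g = "\<lambda>i. gvec z l t i x"
  have e: "((\<lambda>x. ?e x) has_vector_derivative (- lam z $ l) * ?e x) (at x)"
  proof -
    have "((\<lambda>x. - (of_real x * lam z $ l)) has_vector_derivative - lam z $ l) (at x)"
      by (rule has_vector_derivative_eq_rhs[OF has_vector_derivative_minus[OF
            has_vector_derivative_mult_left[OF has_vector_derivative_of_real[OF DERIV_ident]]]]) simp
    then show ?thesis
      by (rule field_vector_diff_chain_at[unfolded o_def]) (auto intro: DERIV_exp)
  qed
  define S where "S j x = (\<Sum>i\<in>UNIV. vinv j i * gvec z l t i x)" for j x
  have E: "Efun z l t j x = S j x * ?e x * ?c" for j x
    unfolding S_def by (rule Efun_gvec[OF z])
  have S3: "S j x = (gvec z l t 1 x + om j ^ 2 * gvec z l t 2 x + om j * gvec z l t 3 x) / 3" for j x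
    by (simp add: S_def sum_3 vinv_simps add_divide_distrib del: om_simps)
  have q3: "of_real (q x t) ^ 3 = 1 - complex_of_real (D 2 x t)"
    using q_cube[OF t, of x] by (metis of_real_1 of_real_diff of_real_power)
  have S': "((\<lambda>x. S j x) has_vector_derivative z * om j * S j x - z * of_real (D 2 x t) * (om j / 3) * ?g 1) (at x)"
  proof -
    have "((\<lambda>x. S j x) has_vector_derivative
       (z * ?g 2 + om j ^ 2 * (z * ?g 3) + om j * (z * of_real (q x t) ^ 3 * ?g 1)) / 3) (at x)"
      unfolding S3 by (intro has_vector_derivative_divide has_vector_derivative_add has_vector_derivative_mult_right gvec_deriv[OF z t])
    then show ?thesis
    proof (rule has_vector_derivative_eq_rhs)
      have "om j * (om j ^ 2 * a) = a" for a using om_square_square(2)[of j] by (simp add: mult.assoc[symmetric] del: om_simps)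
      then show "(z * ?g 2 + om j ^ 2 * (z * ?g 3) + om j * (z * of_real (q x t) ^ 3 * ?g 1)) / 3
          = z * om j * S j x - z * of_real (D 2 x t) * (om j / 3) * ?g 1"
        unfolding q3 S3 by (simp add: field_simps power2_eq_square del: om_simps)
    qed
  qed
  have sumE: "(\<Sum>k\<in>UNIV. Efun z l t k x) = ?g 1 * ?e x * ?c"
  proof -
    have "(\<Sum>k\<in>UNIV. S k x) = (\<Sum>i\<in>UNIV. (\<Sum>k\<in>UNIV. vinv k i) * ?g i)"
      unfolding S_def sum_distrib_right by (rule sum.swap)
    also have "\<dots> = ?g 1" by (simp add: sum_vinv sum_3)
    finally show ?thesis by (simp add: E sum_distrib_right[symmetric])
  qed
  have "((\<lambda>x. S j x * ?e x * ?c) has_vector_derivative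
      (S j x * ((- lam z $ l) * ?e x) + (z * om j * S j x - z * of_real (D 2 x t) * (om j / 3) * ?g 1) * ?e x) * ?c) (at x)"
    by (intro has_vector_derivative_mult_left has_vector_derivative_mult S' e)
  then show ?thesis
    unfolding sumE unfolding E by (rule has_vector_derivative_eq_rhs) (simp add: lam_om algebra_simps del: om_simps)
qed

lemma bvec_bound:
  assumes z: "z \<notin> contour \<union> Z" and t: "t \<ge> 0"
  obtains B where "B \<ge> 0" "\<And>i y. norm (bvec z l i y t) \<le> B"
proof -
  obtain B1 where B1: "B1 \<ge> 0" "\<And>i j y s. s \<in> {0..t} \<Longrightarrow> norm (Bmat i j z y s) \<le> B1"
    by (rule Bmat_bound[OF t]) blast
  obtain B2 where B2: "B2 \<ge> 0" "\<And>x j l. norm (M x z $ j $ l) \<le> B2" by (rule M_bounded[OF z]) blast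
  have "norm (bvec z l i y t) \<le> 3 * (B1 * B2)" for i y
    unfolding bvec_def
    by (rule norm_sum_3_le) (use B1(2)[of t] B2 B1(1) t in \<open>auto simp: norm_mult intro!: mult_mono\<close>)
  then show ?thesis using that[of "3 * (B1 * B2)"] B1 B2 by auto
qed

lemma dfac_bound:
  assumes t: "t \<ge> 0"
  obtains B where "B \<ge> 0" "\<And>i y. norm (dfac i y t) \<le> B"
proof -
  obtain c where c: "c > 0" "\<And>x s. s \<in> {0..t} \<Longrightarrow> q x s \<ge> c" by (rule q_lower) blast
  obtain C where C: "C \<ge> 1" "\<And>x s. s \<in> {0..t} \<Longrightarrow> q x s \<le> C" by (rule q_upper) blast
  define d where "d = 1 / c"
  have d: "d > 0" using c by (simp add: d_def)
  have "norm (dfac i y t) \<le> C + d" for i y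
  proof -
    have qh: "qh y t \<le> C" "qh y t \<ge> c" "qh y t > 0" using c C qh_pos[OF t] t by (auto simp: qh_def)
    moreover have "1 / qh y t \<le> d" using qh c(1) unfolding d_def by (intro frac_le) auto
    moreover have "1 / qh y t > 0" using qh by simp
    ultimately have "\<bar>1 / qh y t\<bar> \<le> C + d" "\<bar>qh y t\<bar> \<le> C + d" "\<bar>1\<bar> \<le> C + d" using C d by linarith+
    then show ?thesis unfolding dfac_def norm_of_real by simp
  qed
  then show ?thesis using that[of "C + d"] C d by auto
qed

lemma exp_shift_bound:
  fixes \<mu> :: complex
  assumes t: "t \<ge> 0"
  obtains B where "B \<ge> 0" "\<And>x. norm (exp (of_real (Y x t - x) * \<mu>)) \<le> B"
proof -
  obtain A where A: "A > 0" "\<And>x s. s \<in> {0..t} \<Longrightarrow> \<bar>Y x s - x\<bar> \<le> A" by (rule Y_bound) blast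
  have "norm (exp (of_real (Y x t - x) * \<mu>)) \<le> exp (A * norm \<mu>)" for x
  proof -
    have "norm (exp (of_real (Y x t - x) * \<mu>)) \<le> exp (norm (of_real (Y x t - x) * \<mu>))" by (rule norm_exp)
    also have "\<dots> \<le> exp (A * norm \<mu>)"
      using A(2)[of t x] t unfolding norm_mult norm_of_real exp_le_cancel_iff by (intro mult_right_mono) auto
    finally show ?thesis .
  qed
  then show ?thesis using that[of "exp (A * norm \<mu>)"] by auto
qed

text \<open>The bound depends on \<open>z\<close> without control as \<open>z\<close> tends to 0.
  Its finiteness is the input which the absorption argument in \<open>small_z\<close> converts into
  a uniform bound.\<close>

lemma Efun_bounded:
  assumes z: "z \<notin> contour \<union> Z" and t: "t \<ge> 0"
  shows "bounded (range (Efun z l t j))"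
proof -
  obtain B1 where B1: "B1 \<ge> 0" "\<And>i y. norm (bvec z l i y t) \<le> B1" by (rule bvec_bound[OF z t]) blast
  obtain B2 where B2: "B2 \<ge> 0" "\<And>i y. norm (dfac i y t) \<le> B2" by (rule dfac_bound[OF t]) blast
  obtain B3 where B3: "B3 \<ge> 0" "\<And>x. norm (exp (of_real (Y x t - x) * lam z $ l)) \<le> B3" by (rule exp_shift_bound[OF t]) blast
  let ?c = "norm (exp (- (of_real t * inverse (lam z $ l))))"
  have "norm (Efun z l t j x) \<le> 3 * (1 * (B2 * B1)) * B3 * ?c" for x
  proof -
    have "norm (vinv j i * (dfac i (Y x t) t * bvec z l i (Y x t) t)) \<le> 1 * (B2 * B1)" for i
      unfolding norm_mult using norm_vinv B1 B2 by (intro mult_mono) auto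
    then have "norm (\<Sum>i\<in>UNIV. vinv j i * (dfac i (Y x t) t * bvec z l i (Y x t) t)) \<le> 3 * (1 * (B2 * B1))"
      by (rule norm_sum_3_le)
    then show ?thesis unfolding Efun_def norm_mult using B1 B2 B3 by (intro mult_mono) auto
  qed
  then show ?thesis by (auto simp: bounded_iff)
qed

lemma Y_filterlim:
  assumes t: "t \<ge> 0"
  shows "filterlim (\<lambda>x. Y x t) at_top at_top" "filterlim (\<lambda>x. Y x t) at_bot at_bot"
    "filterlim (\<lambda>y. X y t) at_top at_top" "filterlim (\<lambda>y. X y t) at_bot at_bot"
proof -
  obtain A where A: "A > 0" "\<And>x s. s \<in> {0..t} \<Longrightarrow> \<bar>Y x s - x\<bar> \<le> A" by (rule Y_bound) blast
  have Y: "x - A \<le> Y x t" "Y x t \<le> x + A" for x using A(2)[of t x] t by auto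
  have X: "y - A \<le> X y t" "X y t \<le> y + A" for y using A(2)[of t "X y t"] t by auto
  have top: "filterlim (\<lambda>x. x - A) at_top at_top" and bot: "filterlim (\<lambda>x. x + A) at_bot at_bot"
    by real_asymp+
  show "filterlim (\<lambda>x. Y x t) at_top at_top" "filterlim (\<lambda>y. X y t) at_top at_top"
    by (rule filterlim_at_top_mono[OF top], use Y X in simp)+
  show "filterlim (\<lambda>x. Y x t) at_bot at_bot" "filterlim (\<lambda>y. X y t) at_bot at_bot"
    by (rule filterlim_at_bot_mono[OF bot], use Y X in simp)+
qed

lemma Efun_limit:
  assumes z: "z \<notin> contour \<union> Z" and t: "t \<ge> 0"
  shows "((\<lambda>x. Efun z l t j x) \<longlongrightarrow> (if j = l then 1 else 0)) (far_end (z * (om j - om l)))"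
proof -
  let ?F = "far_end (z * (om j - om l))" and ?\<delta> = "\<lambda>j. (if j = l then 1 else 0) :: complex"
  let ?E = "\<lambda>k. exp (of_real t * inverse (lam z $ k))"
  obtain B1 where B1: "B1 \<ge> 0" "\<And>i y. norm (bvec z l i y t) \<le> B1" by (rule bvec_bound[OF z t]) blast
  obtain B2 where B2: "B2 \<ge> 0" "\<And>x j l. norm (M x z $ j $ l) \<le> B2" by (rule M_bounded[OF z]) blast
  obtain B3 where B3: "B3 \<ge> 0" "\<And>x. norm (exp (of_real (Y x t - x) * lam z $ l)) \<le> B3" by (rule exp_shift_bound[OF t]) blast
  have YF: "filterlim (\<lambda>x. Y x t) ?F ?F" and XF: "filterlim (\<lambda>y. X y 0) ?F ?F"
    using Y_filterlim[OF t] Y_filterlim[of 0] by (auto simp: far_end_def)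
  have Bl: "((\<lambda>y. Bmat i k z y t) \<longlongrightarrow> vand i k * ?E k) ?F" for i k
    using Bmat_limit[OF t] by (simp add: far_end_def)
  have dl: "((\<lambda>y. dfac i y t) \<longlongrightarrow> 1) ?F" for i
  proof -
    have "((\<lambda>y. qh y t) \<longlongrightarrow> 1) at_top" "((\<lambda>y. qh y t) \<longlongrightarrow> 1) at_bot"
    proof -
      have *: "\<exists>R. \<forall>y. \<bar>y\<bar> \<ge> R \<longrightarrow> dist (qh y t) 1 < e" if e: "e > 0" for e
      proof -
        obtain R where "R > 0" "\<And>y s. \<bar>y\<bar> \<ge> R \<Longrightarrow> s \<in> {0..t} \<Longrightarrow> \<bar>qh y s - 1\<bar> < e"
          by (rule qh_limit[OF e t]) blast
        then show ?thesis using t by (intro exI[of _ R]) (auto simp: dist_real_def)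
      qed
      show "((\<lambda>y. qh y t) \<longlongrightarrow> 1) at_top" "((\<lambda>y. qh y t) \<longlongrightarrow> 1) at_bot"
        unfolding tendsto_iff eventually_at_top_linorder eventually_at_bot_linorder
        using * by (metis abs_ge_self order_trans, metis * abs_ge_minus_self minus_le_iff order_trans neg_le_iff_le)
    qed
    then have "((\<lambda>y. qh y t) \<longlongrightarrow> 1) ?F" by (simp add: far_end_def)
    then have "((\<lambda>y. complex_of_real (qh y t)) \<longlongrightarrow> of_real 1) ?F" by (rule tendsto_of_real)
    then have q1: "((\<lambda>y. complex_of_real (qh y t)) \<longlongrightarrow> 1) ?F" by simp
    have "((\<lambda>y. 1 / complex_of_real (qh y t)) \<longlongrightarrow> 1 / 1) ?F" by (intro tendsto_intros q1) simp
    then show ?thesis using q1 exhaust_3[of i] by (auto simp: dfac_simps)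
  qed
  have small: "((\<lambda>y. f y * g y) \<longlongrightarrow> 0) ?F" if "(f \<longlongrightarrow> 0) ?F" "\<And>y. norm (g y) \<le> B" for f g :: "real \<Rightarrow> complex" and B
  proof (rule Lim_null_comparison[OF always_eventually])
    show "\<forall>y. norm (f y * g y) \<le> norm (f y) * B"
      using that(2) by (auto simp: norm_mult intro!: mult_left_mono)
    show "((\<lambda>y. norm (f y) * B) \<longlongrightarrow> 0) ?F"
      using tendsto_mult[OF tendsto_norm_zero[OF that(1)] tendsto_const[of B]] by simp
  qed
  \<comment> \<open>The propagator is split into its limit, which \<open>vinv\<close> diagonalizes,
    and an error tending to 0 multiplied by bounded entries of \<open>M\<close>.\<close>
  have main: "((\<lambda>y. \<Sum>i\<in>UNIV. vinv j i * bvec z l i y t) \<longlongrightarrow> ?\<delta> j * ?E j) ?F"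
  proof -
    have "((\<lambda>y. \<Sum>i\<in>UNIV. vinv j i * (\<Sum>k\<in>UNIV. (Bmat i k z y t - vand i k * ?E k) * M (X y 0) z $ k $ l)) \<longlongrightarrow> (\<Sum>i\<in>UNIV. vinv j i * (\<Sum>k\<in>(UNIV::3 set). 0))) ?F"
      by (intro tendsto_sum tendsto_mult_left small[where B = B2, OF LIM_zero[OF Bl]] B2(2))
    moreover have "((\<lambda>y. ?E j * M (X y 0) z $ j $ l) \<longlongrightarrow> ?E j * ?\<delta> j) ?F"
      by (intro tendsto_mult_left filterlim_compose[OF M_limit[OF z] XF])
    ultimately have "((\<lambda>y. (\<Sum>i\<in>UNIV. vinv j i * (\<Sum>k\<in>UNIV. (Bmat i k z y t - vand i k * ?E k) * M (X y 0) z $ k $ l)) + ?E j * M (X y 0) z $ j $ l)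
       \<longlongrightarrow> (\<Sum>i\<in>UNIV. vinv j i * (\<Sum>k\<in>(UNIV::3 set). 0)) + ?E j * ?\<delta> j) ?F"
      by (rule tendsto_add)
    moreover have "(\<Sum>i\<in>UNIV. vinv j i * (\<Sum>k\<in>UNIV. (Bmat i k z y t - vand i k * ?E k) * M (X y 0) z $ k $ l)) + ?E j * M (X y 0) z $ j $ l
      = (\<Sum>i\<in>UNIV. vinv j i * bvec z l i y t)" for y
    proof -
      have "(\<Sum>i\<in>UNIV. vinv j i * (\<Sum>k\<in>UNIV. vand i k * ?E k * M (X y 0) z $ k $ l))
        = (\<Sum>k\<in>UNIV. (\<Sum>i\<in>UNIV. vinv j i * vand i k) * (?E k * M (X y 0) z $ k $ l))"
        unfolding sum_distrib_left sum_distrib_right by (subst sum.swap) (simp add: mult.assoc)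
      also have "\<dots> = (\<Sum>k\<in>UNIV. if j = k then ?E k * M (X y 0) z $ k $ l else 0)"
        unfolding vinv_vand by (intro sum.cong) auto
      also have "\<dots> = ?E j * M (X y 0) z $ j $ l" by simp
      finally have e: "(\<Sum>i\<in>UNIV. vinv j i * (\<Sum>k\<in>UNIV. vand i k * ?E k * M (X y 0) z $ k $ l)) = ?E j * M (X y 0) z $ j $ l" .
      show ?thesis
        unfolding e[symmetric] bvec_def by (simp add: left_diff_distrib sum_subtractf right_diff_distrib)
    qed
    ultimately show ?thesis by (simp add: mult.commute)
  qed
  have "((\<lambda>y. \<Sum>i\<in>UNIV. vinv j i * ((dfac i y t - 1) * bvec z l i y t)) \<longlongrightarrow> (\<Sum>i\<in>(UNIV::3 set). vinv j i * 0)) ?F"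
    by (intro tendsto_sum tendsto_mult_left small[where B = B1, OF LIM_zero[OF dl]] B1(2))
  from tendsto_add[OF this main]
  have "((\<lambda>y. \<Sum>i\<in>UNIV. vinv j i * (dfac i y t * bvec z l i y t)) \<longlongrightarrow> ?\<delta> j * ?E j) ?F"
    by (simp add: sum.distrib[symmetric] algebra_simps)
  then have S: "((\<lambda>x. \<Sum>i\<in>UNIV. vinv j i * (dfac i (Y x t) t * bvec z l i (Y x t) t)) \<longlongrightarrow> ?\<delta> j * ?E j) ?F"
    by (rule filterlim_compose[OF _ YF])
  \<comment> \<open>For \<open>j = l\<close> the relevant end is +\<infinity>, where
    \<open>Y x t - x\<close> tends to 0. For \<open>j \<noteq> l\<close> the limit is 0, so
    boundedness of the exponential suffices, even at -\<infinity> where the shift need not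
    vanish.\<close>
  have "((\<lambda>x. (\<Sum>i\<in>UNIV. vinv j i * (dfac i (Y x t) t * bvec z l i (Y x t) t)) * exp (of_real (Y x t - x) * lam z $ l)) \<longlongrightarrow> ?\<delta> j * ?E j) ?F"
  proof (cases "j = l")
    case True
    have "((\<lambda>x. exp (complex_of_real (Y x t - x) * lam z $ l)) \<longlongrightarrow> exp (of_real 0 * lam z $ l)) ?F"
      using True Y_at_top[OF t] by (intro tendsto_intros) simp
    from tendsto_mult[OF S this] show ?thesis by simp
  next
    case False
    have "((\<lambda>x. (\<Sum>i\<in>UNIV. vinv j i * (dfac i (Y x t) t * bvec z l i (Y x t) t)) * exp (of_real (Y x t - x) * lam z $ l)) \<longlongrightarrow> 0) ?F"
      by (rule small[OF _ B3(2)]) (use S False in simp)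
    then show ?thesis using False by simp
  qed
  from tendsto_mult_right[OF this, of "exp (- (of_real t * inverse (lam z $ l)))"]
  show ?thesis
    unfolding Efun_def by (cases "j = l") (auto simp: mult.assoc simp flip: exp_add)
qed

lemma Efun_small_z:
  assumes t: "t \<ge> 0"
  obtains C where "C > 0" "\<And>z l j x. z \<notin> contour \<union> Z \<Longrightarrow> C * norm z \<le> 1 \<Longrightarrow>
    norm (Efun z l t j x - (if j = l then 1 else 0)) \<le> C * norm z
    \<and> norm ((\<Sum>j\<in>UNIV. Efun z l t j x) - 1) \<le> C * (norm z)\<^sup>2"
proof -
  obtain C where C: "C > 0" and CE:
    "\<And>s z l E j x. \<lbrakk>s \<in> {0..t}; C * norm z \<le> 1;
      \<And>j x. (E j has_vector_derivative z * (om j - om l) * E j x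
               - z * of_real (D 2 x s) * (om j / 3) * (\<Sum>k\<in>UNIV. E k x)) (at x);
      \<And>j. bounded (range (E j));
      \<And>j. (E j \<longlongrightarrow> (if j = l then 1 else 0)) (far_end (z * (om j - om l)))\<rbrakk>
      \<Longrightarrow> norm (E j x - (if j = l then 1 else 0)) \<le> C * norm z
        \<and> norm ((\<Sum>j\<in>UNIV. E j x) - 1) \<le> C * (norm z)\<^sup>2"
    by (rule small_z[of t]) blast
  show ?thesis
  proof (rule that[OF C])
    fix z :: complex and l j x assume z: "z \<notin> contour \<union> Z" "C * norm z \<le> 1"
    show "norm (Efun z l t j x - (if j = l then 1 else 0)) \<le> C * norm z
      \<and> norm ((\<Sum>j\<in>UNIV. Efun z l t j x) - 1) \<le> C * (norm z)\<^sup>2"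
      by (rule CE[where E = "\<lambda>j x. Efun z l t j x" and s = t])
        (use t z Efun_deriv[OF z(1) t] Efun_bounded[OF z(1) t] Efun_limit[OF z(1) t] in auto)
  qed
qed

end

section \<open>The solution of the Riemann--Hilbert problem\<close>

lemma matrix_entry_mult: "(A ** B) $ i $ j = (\<Sum>k\<in>UNIV. A $ i $ k * B $ k $ j)"
  by (simp add: matrix_matrix_mult_def)

lemma tendsto_matrix_mult:
  fixes f g :: "'a \<Rightarrow> complex^3^3"
  assumes "(f \<longlongrightarrow> A) F" "(g \<longlongrightarrow> B) F"
  shows "((\<lambda>x. f x ** g x) \<longlongrightarrow> A ** B) F"
  by (intro vec_tendstoI, unfold matrix_entry_mult, intro tendsto_sum tendsto_mult tendsto_vec_nth assms)

lemma diag_matrix_mult: "diag_matrix a ** diag_matrix b = diag_matrix (\<chi> j. a $ j * b $ j)"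
  by (simp add: vec_eq_iff diag_matrix_mult_left) (simp add: diag_matrix_def)

text \<open>AB - I = (A - I)(B - I) + (A - I) + (B - I), the quadratic term being of order 1/r as
  well since \<open>r \<ge> 1\<close>.\<close>

lemma near_identity_mult:
  fixes A B :: "complex^3^3"
  assumes A: "\<And>i j. norm (A $ i $ j - (if i = j then 1 else 0)) \<le> a / r"
    and B: "\<And>i j. norm (B $ i $ j - (if i = j then 1 else 0)) \<le> b / r"
    and r: "r \<ge> 1" and ab: "a \<ge> 0" "b \<ge> 0"
  shows "norm ((A ** B) $ i $ j - (if i = j then 1 else 0)) \<le> (a + b + 3 * a * b) / r"
proof -
  let ?\<delta> = "\<lambda>i j :: 3. (if i = j then 1 else 0) :: complex"
  have "A $ i $ k * B $ k $ j = (A $ i $ k - ?\<delta> i k) * (B $ k $ j - ?\<delta> k j) + (A $ i $ k - ?\<delta> i k) * ?\<delta> k j + ?\<delta> i k * B $ k $ j" for k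
    by (simp add: algebra_simps)
  then have "(A ** B) $ i $ j = (\<Sum>k\<in>UNIV. (A $ i $ k - ?\<delta> i k) * (B $ k $ j - ?\<delta> k j))
      + (\<Sum>k\<in>UNIV. (A $ i $ k - ?\<delta> i k) * ?\<delta> k j) + (\<Sum>k\<in>UNIV. ?\<delta> i k * B $ k $ j)"
    unfolding matrix_entry_mult by (simp only: sum.distrib)
  also have "(\<Sum>k\<in>UNIV. (A $ i $ k - ?\<delta> i k) * ?\<delta> k j) = A $ i $ j - ?\<delta> i j"
    by (simp add: if_distrib[of "\<lambda>x. _ * x"] cong: if_cong)
  also have "(\<Sum>k\<in>UNIV. ?\<delta> i k * B $ k $ j) = B $ i $ j"
    by (simp add: if_distrib[of "\<lambda>x. x * _"] cong: if_cong)
  finally have eq: "(A ** B) $ i $ j - ?\<delta> i j = (\<Sum>k\<in>UNIV. (A $ i $ k - ?\<delta> i k) * (B $ k $ j - ?\<delta> k j))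
      + (A $ i $ j - ?\<delta> i j) + (B $ i $ j - ?\<delta> i j)" by simp
  have "norm (\<Sum>k\<in>UNIV. (A $ i $ k - ?\<delta> i k) * (B $ k $ j - ?\<delta> k j)) \<le> 3 * (a / r * (b / r))"
    proof (rule norm_sum_3_le)
    show "norm ((A $ i $ k - ?\<delta> i k) * (B $ k $ j - ?\<delta> k j)) \<le> a / r * (b / r)" for k
      unfolding norm_mult by (rule mult_mono[OF A B]) (use ab r in auto)
  qed
  moreover have "3 * (a / r * (b / r)) \<le> 3 * a * b / r"
  proof -
    have "b / r \<le> b" using r ab by (simp add: divide_le_eq mult_le_cancel_left1)
    then have "a / r * (b / r) \<le> a / r * b" using r ab by (intro mult_left_mono) auto
    then show ?thesis by simp
  qed
  ultimately have "norm (\<Sum>k\<in>UNIV. (A $ i $ k - ?\<delta> i k) * (B $ k $ j - ?\<delta> k j)) \<le> 3 * a * b / r"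
    by (rule order.trans)
  then have "norm ((A ** B) $ i $ j - ?\<delta> i j) \<le> 3 * a * b / r + a / r + b / r"
    unfolding eq
    using norm_triangle_ineq[of "(\<Sum>k\<in>UNIV. (A $ i $ k - ?\<delta> i k) * (B $ k $ j - ?\<delta> k j)) + (A $ i $ j - ?\<delta> i j)" "B $ i $ j - ?\<delta> i j"]
      norm_triangle_ineq[of "\<Sum>k\<in>UNIV. (A $ i $ k - ?\<delta> i k) * (B $ k $ j - ?\<delta> k j)" "A $ i $ j - ?\<delta> i j"]
      A[of i j] B[of i j] by linarith
  then show ?thesis by (simp add: add_divide_distrib add_ac)
qed

lemma tendsto_exp_quotient:
  "((\<lambda>z. (exp (c * z) - 1) / z) \<longlongrightarrow> c) (at (0::complex) within S)"
proof -
  have "((\<lambda>z. exp (c * z)) has_field_derivative c) (at 0)"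
    by (auto intro!: derivative_eq_intros)
  then have "((\<lambda>z. (exp (c * z) - 1) / z) \<longlongrightarrow> c) (at 0)"
    by (simp add: has_field_derivative_iff)
  then show ?thesis by (rule Lim_at_imp_Lim_at_within)
qed

section \<open>Construction of the solution and the limit formula\<close>

context scattering_problem
begin

lemma finite_Z: "finite Z" and Z_contour: "p \<in> Z \<Longrightarrow> p \<notin> contour" and discrete_data_Z: "discrete_data Z col src"
  using data by (auto simp: scattering_data_def discrete_data_def)

definition Amat :: "real \<Rightarrow> real \<Rightarrow> complex \<Rightarrow> complex^3^3" where
  "Amat y t z = (\<chi> a k. \<Sum>i\<in>UNIV. vinv a i * Bmat i k z y t)"

definition Dmat :: "real \<Rightarrow> complex \<Rightarrow> complex^3^3" where
  "Dmat t z = diag_matrix (\<chi> l. exp (- (of_real t * inverse (lam z $ l))))"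

text \<open>The left factor acts on rows and leaves relations between columns alone. The right
  factor is diagonal and changes the exponentials in the jump and residue relations from time 0 to
  time \<open>t\<close>.\<close>

definition Fmat :: "real \<Rightarrow> real \<Rightarrow> complex \<Rightarrow> complex^3^3" where
  "Fmat y t z = Amat y t z ** M (X y 0) z ** Dmat t z"

lemma Fmat_entry:
  "Fmat y t z $ a $ l = (\<Sum>k\<in>UNIV. Amat y t z $ a $ k * M (X y 0) z $ k $ l) * exp (- (of_real t * inverse (lam z $ l)))"
  unfolding Fmat_def Dmat_def diag_matrix_mult_right unfolding matrix_entry_mult by simp

lemma Fmat_bvec:
  "Fmat y t z $ a $ l = (\<Sum>i\<in>UNIV. vinv a i * bvec z l i y t) * exp (- (of_real t * inverse (lam z $ l)))"
proof -
  have "(\<Sum>k\<in>UNIV. Amat y t z $ a $ k * M (X y 0) z $ k $ l) = (\<Sum>i\<in>UNIV. vinv a i * bvec z l i y t)"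
    unfolding Amat_def bvec_def vec_lambda_beta sum_distrib_left sum_distrib_right
    by (subst sum.swap) (simp add: mult.assoc)
  then show ?thesis by (simp add: Fmat_entry)
qed

text \<open>The same matrix seen from z = 0: expressed through \<open>Efun\<close>, the essential
  singularities of the two outer factors have disappeared, and the change of phase from
  \<open>x\<close> back to \<open>y\<close> remains as an exponential.\<close>

lemma Fmat_Efun:
  assumes t: "t \<ge> 0"
  shows "Fmat y t z $ a $ l = (\<Sum>i\<in>UNIV. vinv a i * ((\<Sum>j\<in>UNIV. vand i j * Efun z l t j (X y t)) / dfac i y t))
      * exp (of_real (X y t - y) * lam z $ l)"
proof -
  let ?\<kappa> = "exp (of_real (y - X y t) * lam z $ l) * exp (- (of_real t * inverse (lam z $ l)))"
  let ?c = "\<lambda>i. dfac i y t * bvec z l i y t"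
  have "(\<Sum>j\<in>UNIV. vand i j * Efun z l t j (X y t)) = ?c i * ?\<kappa>" for i
  proof -
    have "(\<Sum>j\<in>UNIV. vand i j * (\<Sum>k\<in>UNIV. vinv j k * ?c k)) = (\<Sum>k\<in>UNIV. (\<Sum>j\<in>UNIV. vand i j * vinv j k) * ?c k)"
      unfolding sum_distrib_left sum_distrib_right by (subst sum.swap) (simp add: mult.assoc)
    also have "\<dots> = (\<Sum>k\<in>UNIV. if i = k then ?c k else 0)"
      unfolding vand_vinv by (intro sum.cong) auto
    also have "\<dots> = ?c i" by simp
    finally have "(\<Sum>j\<in>UNIV. vand i j * (\<Sum>k\<in>UNIV. vinv j k * ?c k)) * ?\<kappa> = ?c i * ?\<kappa>" by simp
    then show ?thesis
      unfolding Efun_def Y_X[OF t] by (simp add: sum_distrib_right mult.assoc)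
  qed
  then have "(\<Sum>j\<in>UNIV. vand i j * Efun z l t j (X y t)) / dfac i y t = bvec z l i y t * ?\<kappa>" for i
    using dfac_nonzero[OF t, of i y] by simp
  then have "(\<Sum>i\<in>UNIV. vinv a i * ((\<Sum>j\<in>UNIV. vand i j * Efun z l t j (X y t)) / dfac i y t)) * exp (of_real (X y t - y) * lam z $ l)
    = (\<Sum>i\<in>UNIV. vinv a i * bvec z l i y t) * (?\<kappa> * exp (of_real (X y t - y) * lam z $ l))"
    by (simp add: sum_distrib_right mult.assoc)
  also have "?\<kappa> * exp (of_real (X y t - y) * lam z $ l) = exp (- (of_real t * inverse (lam z $ l)))"
    unfolding exp_add[symmetric] by (simp add: algebra_simps)
  finally show ?thesis by (simp add: Fmat_bvec)
qed

text \<open>Summing over rows leaves only the first component, and \<lambda>_3(z) = z, so for the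
  third column the exponential contributes \<open>X y t - y\<close> without a root of unity.\<close>

lemma Fmat_column_sum:
  assumes t: "t \<ge> 0"
  shows "(\<Sum>a\<in>UNIV. Fmat y t z $ a $ 3) = of_real (qh y t) * (\<Sum>j\<in>UNIV. Efun z 3 t j (X y t)) * exp (of_real (X y t - y) * z)"
proof -
  let ?h = "\<lambda>i. (\<Sum>j\<in>UNIV. vand i j * Efun z 3 t j (X y t)) / dfac i y t"
  have "(\<Sum>a\<in>UNIV. \<Sum>i\<in>UNIV. vinv a i * ?h i) = (\<Sum>i\<in>UNIV. (\<Sum>a\<in>UNIV. vinv a i) * ?h i)"
    unfolding sum_distrib_right by (rule sum.swap)
  also have "\<dots> = ?h 1" by (simp add: sum_vinv sum_3)
  also have "\<dots> = of_real (qh y t) * (\<Sum>j\<in>UNIV. Efun z 3 t j (X y t))"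
    by (simp add: vand_simps dfac_simps)
  finally show ?thesis
    unfolding Fmat_Efun[OF t] by (simp add: sum_distrib_right[symmetric] lam_om)
qed

text \<open>The matrix V^-1 diag(q, 1, 1/q) V, obtained by putting z = 0 and \<open>Efun\<close> =
  \<delta> in \<open>Fmat_Efun\<close>.\<close>

definition F0mat :: "real \<Rightarrow> real \<Rightarrow> complex^3^3" where
  "F0mat y t = (\<chi> a l. \<Sum>i\<in>UNIV. vinv a i * (vand i l / dfac i y t))"

lemma near_zero_off_contour: "d > 0 \<Longrightarrow> \<forall>\<^sub>F z in at 0 within - contour. z \<notin> contour \<union> Z \<and> norm z < d"
proof -
  assume d: "d > 0"
  have "open (- Z)" "0 \<in> - Z" using finite_Z Z_contour[of 0] by (auto intro: finite_imp_closed)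
  then have "\<forall>\<^sub>F z in at 0 within - contour. z \<in> - Z"
    by (intro eventually_at_in_open'[THEN filter_leD[OF at_le[OF subset_UNIV]]])
  moreover have "\<forall>\<^sub>F z in at 0 within - contour. z \<notin> contour \<and> norm z < d"
    unfolding eventually_at using d by (intro exI[of _ d]) auto
  ultimately show ?thesis by eventually_elim auto
qed

text \<open>The second limit rests on the quadratic bound; a linear one would leave an unknown
  constant beside x - y in the final formula.\<close>

lemma Efun_at_zero:
  assumes t: "t \<ge> 0"
  shows "((\<lambda>z. Efun z l t j x) \<longlongrightarrow> (if j = l then 1 else 0)) (at 0 within - contour)"
    "((\<lambda>z. ((\<Sum>j\<in>UNIV. Efun z l t j x) - 1) / z) \<longlongrightarrow> 0) (at 0 within - contour)"
proof -
  obtain C where C: "C > 0" "\<And>z l j x. z \<notin> contour \<union> Z \<Longrightarrow> C * norm z \<le> 1 \<Longrightarrow>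
    norm (Efun z l t j x - (if j = l then 1 else 0)) \<le> C * norm z
    \<and> norm ((\<Sum>j\<in>UNIV. Efun z l t j x) - 1) \<le> C * (norm z)\<^sup>2"
    by (rule Efun_small_z[OF t]) blast
  have ev: "\<forall>\<^sub>F z in at 0 within - contour. z \<notin> contour \<union> Z \<and> C * norm z \<le> 1"
    using near_zero_off_contour[of "1 / C"] C(1) by (auto elim!: eventually_mono simp: field_simps)
  have lim: "((\<lambda>z::complex. C * norm z) \<longlongrightarrow> 0) (at 0 within - contour)"
    by (intro tendsto_eq_intros refl) auto
  have "((\<lambda>z. Efun z l t j x - (if j = l then 1 else 0)) \<longlongrightarrow> 0) (at 0 within - contour)"
    by (rule Lim_null_comparison[OF eventually_mono[OF ev] lim]) (use C(2) in auto)
  then show "((\<lambda>z. Efun z l t j x) \<longlongrightarrow> (if j = l then 1 else 0)) (at 0 within - contour)"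
    by (simp add: LIM_zero_iff)
  show "((\<lambda>z. ((\<Sum>j\<in>UNIV. Efun z l t j x) - 1) / z) \<longlongrightarrow> 0) (at 0 within - contour)"
  proof (rule Lim_null_comparison[OF eventually_mono[OF ev] lim])
    fix z assume z: "z \<notin> contour \<union> Z \<and> C * norm z \<le> 1"
    then have "z \<noteq> 0" by auto
    have "norm ((\<Sum>j\<in>UNIV. Efun z l t j x) - 1) / norm z \<le> C * (norm z)\<^sup>2 / norm z"
      using C(2)[of z l _ x] z by (intro divide_right_mono) auto
    then show "norm (((\<Sum>j\<in>UNIV. Efun z l t j x) - 1) / z) \<le> C * norm z"
      using \<open>z \<noteq> 0\<close> by (simp add: norm_divide power2_eq_square)
  qed
qed

lemma Fmat_at_zero:
  assumes t: "t \<ge> 0"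
  shows "(Fmat y t \<longlongrightarrow> F0mat y t) (at 0 within - contour)"
proof (intro vec_tendstoI)
  fix a l
  have "((\<lambda>z. exp (of_real (X y t - y) * lam z $ l)) \<longlongrightarrow> exp (of_real (X y t - y) * (0 * om l))) (at 0 within - contour)"
    unfolding lam_om by (intro tendsto_intros)
  then have e: "((\<lambda>z. exp (of_real (X y t - y) * lam z $ l)) \<longlongrightarrow> 1) (at 0 within - contour)" by simp
  have "((\<lambda>z. Fmat y t z $ a $ l) \<longlongrightarrow> (\<Sum>i\<in>UNIV. vinv a i * ((\<Sum>j\<in>UNIV. vand i j * (if j = l then 1 else 0)) / dfac i y t)) * 1) (at 0 within - contour)"
    unfolding Fmat_Efun[OF t]
    by (intro tendsto_mult tendsto_sum tendsto_divide tendsto_const Efun_at_zero(1)[OF t] dfac_nonzero[OF t] e)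
  moreover have "(\<Sum>j\<in>UNIV. vand i j * (if j = l then 1 else 0)) = vand i l" for i
    by (simp add: if_distrib[of "\<lambda>x. _ * x"] cong: if_cong)
  ultimately show "((\<lambda>z. Fmat y t z $ a $ l) \<longlongrightarrow> F0mat y t $ a $ l) (at 0 within - contour)"
    by (simp add: F0mat_def)
qed

lemma F0mat_column_sum: "(\<Sum>a\<in>UNIV. F0mat y t $ a $ 3) = of_real (qh y t)"
proof -
  have "(\<Sum>a\<in>UNIV. F0mat y t $ a $ 3) = (\<Sum>i\<in>UNIV. (\<Sum>a\<in>UNIV. vinv a i) * (vand i 3 / dfac i y t))"
    unfolding F0mat_def vec_lambda_beta sum_distrib_right by (rule sum.swap)
  also have "\<dots> = of_real (qh y t)" by (simp add: sum_vinv sum_3 vand_simps dfac_simps)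
  finally show ?thesis .
qed

lemma Amat_holomorphic:
  assumes "t \<ge> 0"
  shows "(\<lambda>z. Amat y t z $ a $ k) holomorphic_on - {0}"
  unfolding Amat_def vec_lambda_beta using Bmat_holomorphic[OF assms] by (intro holomorphic_intros) auto

lemma Dmat_holomorphic: "(\<lambda>z. exp (- (of_real t * inverse (lam z $ l)))) holomorphic_on - {0}"
  unfolding lam_om by (intro holomorphic_intros) auto

lemma tendsto_of_holomorphic:
  assumes "f holomorphic_on - {0}" "w \<noteq> 0"
  shows "(f \<longlongrightarrow> f w) (at w within R)"
proof -
  have "isCont f w"
    using assms continuous_on_eq_continuous_at[of "- {0}" f] holomorphic_on_imp_continuous_on by auto
  then show ?thesis by (simp add: isCont_def Lim_at_imp_Lim_at_within)
qed

lemma Amat_tendsto: "t \<ge> 0 \<Longrightarrow> w \<noteq> 0 \<Longrightarrow> (Amat y t \<longlongrightarrow> Amat y t w) (at w within R)"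
  by (intro vec_tendstoI tendsto_of_holomorphic Amat_holomorphic)

lemma Dmat_tendsto: "w \<noteq> 0 \<Longrightarrow> (Dmat t \<longlongrightarrow> Dmat t w) (at w within R)"
proof (intro vec_tendstoI)
  fix i j assume w: "w \<noteq> 0"
  show "((\<lambda>z. Dmat t z $ i $ j) \<longlongrightarrow> Dmat t w $ i $ j) (at w within R)"
    using tendsto_of_holomorphic[OF Dmat_holomorphic w] by (auto simp: Dmat_def diag_matrix_def)
qed

lemma yfun_X: "yfun u0 (X y 0) = y"
  using Y_X[of 0 y] by (simp add: Y_def)

lemma Fmat_jump:
  assumes t: "t \<ge> 0"
  shows "jump_condition S y t (Fmat y t)"
  unfolding jump_condition_def Let_def
proof (intro allI impI)
  fix k :: nat and s :: real assume k: "k < 3" and s: "s \<noteq> 0"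
  let ?w = "of_real s * omega ^ k"
  have w: "?w \<noteq> 0" using s by simp
  have "jump_condition S y 0 (M (X y 0))"
    using data yfun_X[of y] by (auto simp: scattering_data_def dest!: spec[of _ "X y 0"])
  then obtain Mp Mm where
    p: "(M (X y 0) \<longlongrightarrow> Mp) (at ?w within {u. Im (u / omega ^ k) > 0})" and
    m: "(M (X y 0) \<longlongrightarrow> Mm) (at ?w within {u. Im (u / omega ^ k) < 0})" and
    e: "Mp = Mm ** expQ y 0 ?w ** S ?w ** expQ (- y) (- 0) ?w"
    using k s unfolding jump_condition_def Let_def by blast
  \<comment> \<open>Here and in the next identity \<open>Dmat\<close> is pulled through the
    conjugating exponentials, which advances them from time 0 to time \<open>t\<close>.\<close>
  have 1: "expQ y 0 ?w = Dmat t ?w ** expQ y t ?w"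
    unfolding Dmat_def expQ_def diag_matrix_mult by (simp flip: exp_add)
  have 2: "expQ (- y) (- 0) ?w ** Dmat t ?w = expQ (- y) (- t) ?w"
    unfolding Dmat_def expQ_def diag_matrix_mult by (simp flip: exp_add)
  have "Amat y t ?w ** Mp ** Dmat t ?w
      = (Amat y t ?w ** Mm ** Dmat t ?w) ** expQ y t ?w ** S ?w ** expQ (- y) (- t) ?w"
    unfolding e 1 2[symmetric] by (simp only: matrix_mul_assoc)
  then show "\<exists>Fplus Fminus.
      (Fmat y t \<longlongrightarrow> Fplus) (at ?w within {w. Im (w / omega ^ k) > 0}) \<and>
      (Fmat y t \<longlongrightarrow> Fminus) (at ?w within {w. Im (w / omega ^ k) < 0}) \<and>
      Fplus = Fminus ** expQ y t ?w ** S ?w ** expQ (- y) (- t) ?w"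
    unfolding Fmat_def[abs_def]
    by (intro exI[of _ "Amat y t ?w ** Mp ** Dmat t ?w"] exI[of _ "Amat y t ?w ** Mm ** Dmat t ?w"] conjI
        tendsto_matrix_mult Amat_tendsto[OF t w] Dmat_tendsto[OF w] p m)
qed

text \<open>The residue relation is linear in the columns and survives multiplication by
  \<open>Amat\<close>; the quotient of the two entries of \<open>Dmat\<close> supplies the time
  dependence of the residue constant.\<close>

lemma Fmat_pole:
  assumes t: "t \<ge> 0"
  shows "pole_condition Z col src v y t (Fmat y t)"
proof (rule pole_conditionI[OF discrete_data_Z])
  have pole: "pole_condition Z col src v y 0 (M (X y 0))"
    using data yfun_X[of y] by (auto simp: scattering_data_def dest!: spec[of _ "X y 0"])
  have sub: "- (contour \<union> {p \<in> Z. col p = l}) \<subseteq> - {0}" for l by auto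
  have "(\<lambda>z. M (X y 0) z $ i $ l) holomorphic_on - (contour \<union> {p \<in> Z. col p = l})" for i l
    using pole by (simp add: pole_condition_def)
  then show "(\<lambda>z. Fmat y t z $ i $ l) holomorphic_on - (contour \<union> {p \<in> Z. col p = l})" for i l
    unfolding Fmat_entry
    by (intro holomorphic_on_mult holomorphic_on_sum holomorphic_on_subset[OF Amat_holomorphic[OF t] sub]
        holomorphic_on_subset[OF Dmat_holomorphic sub])
  fix p i assume p: "p \<in> Z"
  have p0: "p \<noteq> 0" using Z_contour[OF p] by auto
  let ?j = "src p" and ?l = "col p"
  let ?D = "\<lambda>l. exp (- (of_real t * inverse (lam p $ l)))"
  let ?r = "\<lambda>k. M (X y 0) p $ k $ ?j * v p *
     exp (of_real y * (lam p $ ?j - lam p $ ?l) + of_real 0 * (inverse (lam p $ ?j) - inverse (lam p $ ?l)))"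
  have "((\<lambda>z. (\<Sum>k\<in>UNIV. Amat y t z $ i $ k * ((z - p) * M (X y 0) z $ k $ ?l)) * exp (- (of_real t * inverse (lam z $ ?l))))
     \<longlongrightarrow> (\<Sum>k\<in>UNIV. Amat y t p $ i $ k * ?r k) * ?D ?l) (at p)"
    by (intro tendsto_mult tendsto_sum tendsto_of_holomorphic[OF Amat_holomorphic[OF t] p0]
        tendsto_of_holomorphic[OF Dmat_holomorphic p0] pole_condition_tendsto[OF discrete_data_Z pole p])
  moreover have "(\<Sum>k\<in>UNIV. Amat y t z $ i $ k * ((z - p) * M (X y 0) z $ k $ ?l)) * exp (- (of_real t * inverse (lam z $ ?l)))
      = (z - p) * Fmat y t z $ i $ ?l" for z
    unfolding Fmat_entry by (simp add: sum_distrib_left sum_distrib_right mult_ac)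
  moreover have "(\<Sum>k\<in>UNIV. Amat y t p $ i $ k * ?r k) * ?D ?l = Fmat y t p $ i $ ?j * v p *
     exp (of_real y * (lam p $ ?j - lam p $ ?l) + of_real t * (inverse (lam p $ ?j) - inverse (lam p $ ?l)))"
  proof -
    let ?e = "exp (of_real y * (lam p $ ?j - lam p $ ?l))"
    have "(\<Sum>k\<in>UNIV. Amat y t p $ i $ k * ?r k) * ?D ?l = (\<Sum>k\<in>UNIV. Amat y t p $ i $ k * M (X y 0) p $ k $ ?j) * v p * (?e * ?D ?l)"
      by (simp add: sum_distrib_right mult.assoc)
    also have "?e * ?D ?l = ?D ?j * exp (of_real y * (lam p $ ?j - lam p $ ?l) + of_real t * (inverse (lam p $ ?j) - inverse (lam p $ ?l)))"
      unfolding exp_add[symmetric] by (simp add: algebra_simps)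
    finally show ?thesis unfolding Fmat_entry by (simp add: mult_ac)
  qed
  ultimately show "((\<lambda>z. (z - p) * Fmat y t z $ i $ ?l) \<longlongrightarrow> Fmat y t p $ i $ ?j * v p *
     exp (of_real y * (lam p $ ?j - lam p $ ?l) + of_real t * (inverse (lam p $ ?j) - inverse (lam p $ ?l)))) (at p)"
    by (simp only:)
qed

lemma Fmat_infinity:
  assumes t: "t \<ge> 0"
  shows "(\<lambda>z. Fmat y t z $ i $ j - mat 1 $ i $ j) \<in> O[inf at_infinity (principal (- contour))](\<lambda>z. 1 / z)"
proof -
  obtain C1 where C1: "C1 > 0" "\<And>x z j l. z \<notin> contour \<union> Z \<Longrightarrow> norm z \<ge> C1 \<Longrightarrow>
    norm (M x z $ j $ l - (if j = l then 1 else 0)) \<le> C1 / norm z"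
    by (rule large_z) blast
  obtain C2 where C2: "C2 \<ge> 0" "\<And>i j y z. norm z \<ge> 1 \<Longrightarrow> norm (Bmat i j z y t - vand i j) \<le> C2 / norm z"
    by (rule Bmat_large_z[OF t]) blast
  have A: "norm (Amat y t z $ a $ k - (if a = k then 1 else 0)) \<le> 3 * C2 / norm z" if z: "norm z \<ge> 1" for z a k
  proof -
    have "Amat y t z $ a $ k - (if a = k then 1 else 0) = (\<Sum>i\<in>UNIV. vinv a i * (Bmat i k z y t - vand i k))"
      unfolding Amat_def vec_lambda_beta vinv_vand[symmetric] by (simp add: right_diff_distrib sum_subtractf)
    moreover have "norm (\<Sum>i\<in>UNIV. vinv a i * (Bmat i k z y t - vand i k)) \<le> 3 * (1 * (C2 / norm z))"
      proof (rule norm_sum_3_le)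
      show "norm (vinv a i * (Bmat i k z y t - vand i k)) \<le> 1 * (C2 / norm z)" for i
        unfolding norm_mult by (rule mult_mono[OF norm_vinv C2(2)[OF z]]) auto
    qed
    ultimately show ?thesis by simp
  qed
  have Dm: "norm (Dmat t z $ a $ k - (if a = k then 1 else 0)) \<le> 2 * t / norm z" if z: "norm z \<ge> 2 * t + 1" for z a k
  proof (cases "a = k")
    case True
    let ?w = "- (of_real t * inverse (lam z $ k))"
    have n: "norm ?w = t / norm z" using t by (simp add: lam_om norm_mult norm_inverse divide_inverse)
    have zp: "norm z > 0" using z t by linarith
    have "norm ?w \<le> 1 / 2" unfolding n using z t zp by (simp add: divide_le_eq)
    then have "norm (exp ?w - 1) \<le> 3 / 2 * norm ?w" by (rule norm_exp_bounds)
    also have "\<dots> \<le> 2 * (t / norm z)" unfolding n using t zp by (intro mult_right_mono) auto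
    finally show ?thesis using True by (simp add: Dmat_def diag_matrix_def)
  next
    case False
    then show ?thesis using t by (simp add: Dmat_def diag_matrix_def)
  qed
  define c where "c = 3 * C2 + C1 + 3 * (3 * C2) * C1"
  define c' where "c' = c + 2 * t + 3 * c * (2 * t)"
  have c: "c \<ge> 0" using C1 C2 by (simp add: c_def)
  have "bounded Z" using finite_Z by (rule finite_imp_bounded)
  then obtain R where R: "\<And>p. p \<in> Z \<Longrightarrow> norm p \<le> R" by (auto simp: bounded_iff)
  have "\<forall>\<^sub>F z in inf at_infinity (principal (- contour)). norm (Fmat y t z $ i $ j - mat 1 $ i $ j) \<le> c' * norm (1 / z)"
    unfolding eventually_inf_principal eventually_at_infinity
  \<comment> \<open>Beyond \<open>R + 1\<close> there are no poles, beyond \<open>C1\<close> the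
    estimate for the eigenfunctions holds, and beyond \<open>2 * t + 1\<close> the exponent in
    \<open>Dmat\<close> is at most 1/2 in modulus.\<close>
  proof (intro exI[of _ "max (R + 1) (max C1 (2 * t + 1))"] allI impI)
    fix z assume "max (R + 1) (max C1 (2 * t + 1)) \<le> norm z" "z \<in> - contour"
    then have z: "norm z \<ge> R + 1" "norm z \<ge> C1" "norm z \<ge> 2 * t + 1" "norm z \<ge> 1" "z \<notin> contour" using t by auto
    then have zZ: "z \<notin> contour \<union> Z" using R[of z] by auto
    have "norm ((Amat y t z ** M (X y 0) z) $ a $ k - (if a = k then 1 else 0)) \<le> c / norm z" for a k
      unfolding c_def by (rule near_identity_mult[OF A C1(2)[OF zZ]]) (use z C1 C2 in auto)
    then have "norm (Fmat y t z $ i $ j - (if i = j then 1 else 0)) \<le> c' / norm z"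
      unfolding c'_def Fmat_def by (rule near_identity_mult[OF _ Dm]) (use z c t in auto)
    then show "norm (Fmat y t z $ i $ j - mat 1 $ i $ j) \<le> c' * norm (1 / z)"
      by (simp add: mat_def norm_divide)
  qed
  then show ?thesis by (rule bigoI)
qed

lemma Fmat_rh_solution: "t \<ge> 0 \<Longrightarrow> rh_solution S Z col src v y t (Fmat y t)"
  unfolding rh_solution_def using Fmat_jump Fmat_pole Fmat_infinity Fmat_at_zero by blast

text \<open>By uniqueness any solution agrees with \<open>Fmat\<close> off the contour and the
  poles, in particular near 0, so the limits may be computed for \<open>Fmat\<close>.\<close>

lemma parametrization:
  assumes RH: "\<And>y t. t \<ge> 0 \<Longrightarrow> rh_solution S Z col src v y t (Mhat y t)"
  shows "is_parametrization Mhat X"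
  unfolding is_parametrization_def
proof (intro allI impI)
  fix y t :: real assume t: "t \<ge> 0"
  have "Fmat y t z = Mhat y t z" if "z \<notin> contour \<union> Z" for z
    by (rule rh_solution_unique[OF discrete_data_Z det_S Fmat_rh_solution[OF t] RH[OF t] that])
  then have ev: "\<forall>\<^sub>F z in at 0 within - contour. Fmat y t z = Mhat y t z"
    using near_zero_off_contour[of 1] by (auto elim!: eventually_mono)
  have q: "complex_of_real (qh y t) \<noteq> 0" using qh_pos[OF t, of y] by simp
  let ?c = "complex_of_real (X y t - y)" and ?S = "\<lambda>z. \<Sum>j\<in>UNIV. Efun z 3 t j (X y t)"
  have "((\<lambda>z. exp (?c * z)) \<longlongrightarrow> exp (?c * 0)) (at 0 within - contour)" by (intro tendsto_intros)
  then have "((\<lambda>z. (?S z - 1) / z * exp (?c * z) + (exp (?c * z) - 1) / z) \<longlongrightarrow> 0 * exp (?c * 0) + ?c) (at 0 within - contour)"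
    by (intro tendsto_add tendsto_mult Efun_at_zero(2)[OF t] tendsto_exp_quotient)
  then have lim: "((\<lambda>z. (?S z - 1) / z * exp (?c * z) + (exp (?c * z) - 1) / z) \<longlongrightarrow> ?c) (at 0 within - contour)" by simp
  \<comment> \<open>With e = exp(c z) this is S e - 1 = (S - 1) e + (e - 1), divided by
    \<open>z\<close>. At z = 0 both sides are 0 by the convention for division.\<close>
  have eq: "(?S z - 1) / z * exp (?c * z) + (exp (?c * z) - 1) / z
      = ((\<Sum>j\<in>UNIV. Fmat y t z $ j $ 3) / of_real (qh y t) - 1) * (1 / z)" for z
    unfolding Fmat_column_sum[OF t] using q by (cases "z = 0") (simp_all add: field_simps)
  show "\<exists>M0 L. (Mhat y t \<longlongrightarrow> M0) (at 0 within - contour) \<and> (\<Sum>j\<in>UNIV. M0 $ j $ 3) \<noteq> 0 \<and>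
        ((\<lambda>z. ((\<Sum>j\<in>UNIV. Mhat y t z $ j $ 3) / (\<Sum>j\<in>UNIV. M0 $ j $ 3) - 1) * (1 / z)) \<longlongrightarrow> L) (at 0 within - contour) \<and>
        of_real (X y t) = of_real y + L"
  proof (intro exI[of _ "F0mat y t"] exI[of _ ?c] conjI)
    show "(Mhat y t \<longlongrightarrow> F0mat y t) (at 0 within - contour)"
      by (rule Lim_transform_eventually[OF Fmat_at_zero[OF t] ev])
    show "(\<Sum>j\<in>UNIV. F0mat y t $ j $ 3) \<noteq> 0" using q by (simp add: F0mat_column_sum)
    show "((\<lambda>z. ((\<Sum>j\<in>UNIV. Mhat y t z $ j $ 3) / (\<Sum>j\<in>UNIV. F0mat y t $ j $ 3) - 1) * (1 / z)) \<longlongrightarrow> ?c) (at 0 within - contour)"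
      using lim unfolding eq F0mat_column_sum
      by (rule Lim_transform_eventually) (use ev in \<open>eventually_elim; simp\<close>)
  qed simp
qed

end

theorem theorem2p1:
  fixes u :: "real \<Rightarrow> real \<Rightarrow> real" and u0 :: "real \<Rightarrow> real"
    and M :: "real \<Rightarrow> complex \<Rightarrow> complex^3^3"
    and S0 :: "complex \<Rightarrow> complex^3^3"
    and Z :: "complex set" and col src :: "complex \<Rightarrow> 3" and v :: "complex \<Rightarrow> complex"
    and Mhat :: "real \<Rightarrow> real \<Rightarrow> complex \<Rightarrow> complex^3^3"
  assumes u0: "smooth_line u0" "decays_line u0" "\<And>x. - deriv (deriv u0) x + 1 > 0"
    and u_sol: "cauchy_solution u0 u"
    and u_reg: "smooth_halfplane u" "decays_halfplane u"
    and u_pos: "\<And>x t. t \<ge> 0 \<Longrightarrow> 1 - dx (dx u) x t > 0"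
    and data: "scattering_data u0 M S0 Z col src v"
    and RH: "\<And>y t. t \<ge> 0 \<Longrightarrow> rh_solution S0 Z col src v y t (Mhat y t)"
  shows "\<exists>xhat uhat :: real \<Rightarrow> real \<Rightarrow> real.
      is_parametrization Mhat xhat \<and>
      (\<forall>y. \<forall>t\<ge>0. (xhat y has_real_derivative uhat y t) (at t within {0..})) \<and>
      (\<forall>t\<ge>0. bij (\<lambda>y. xhat y t)) \<and>
      (\<forall>x. \<forall>t\<ge>0. u x t = uhat (inv (\<lambda>y. xhat y t) x) t)"
proof -
  have "u0 = (\<lambda>x. u x 0)" using u_sol by (auto simp: cauchy_solution_def)
  then interpret scattering_problem u M S0 Z col src v
    using u_reg u_pos data u_sol by unfold_locales (auto simp: cauchy_solution_def)
  show ?thesis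
  \<comment> \<open>The second witness is the wave along the characteristic, which is the time
    derivative of \<open>X\<close>; evaluation at y = Y(x,t) returns u(x,t).\<close>
  proof (rule exI[of _ X], rule exI[of _ "\<lambda>y t. u (X y t) t"], intro conjI allI impI)
    show "is_parametrization Mhat X" by (rule parametrization[OF RH])
    show "(X y has_real_derivative u (X y t) t) (at t within {0..})" if "t \<ge> 0" for y t
      by (rule X_t[OF that])
    show "bij (\<lambda>y. X y t)" if "t \<ge> 0" for t by (rule X_bij[OF that])
    show "u x t = u (X (inv (\<lambda>y. X y t) x) t) t" if "t \<ge> 0" for x t
      by (simp add: inv_X that)
  qed
qed

end
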